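(* Let $D$ be a Dedekind domain with finite residue fields and fraction field $K$, let $n\ge 2$, and let $A$ be a torsion-free $D$-algebra that is finitely generated as a $D$-module and such that $A\cap K=D$. Assume that there exists a nonzero prime $P$ of $D$ such that $A/P^qA\cong M_n(D/P^q)$, where $q=|D/P|$. Let $F\in K[x]$ be the polynomial constructed from $V=D_P$ and $n$ as described in the context, and let $c\in D\setminus P$ be such that $cF$ is properly integral over $\mathrm{Int}_K(M_n(D))$. Then $cF$ is properly integral over $\mathrm{Int}_K(A)$. Thus, $\mathrm{Int}_K(A)$ is not integrally closed.
   Context: For a torsion-free $D$-algebra $A$ (associative with identity, not necessarily commutative), finitely generated as a $D$-module with $A\cap K=D$ (where $K$ and $A$ are identified with their canonical images $K\otimes 1$ and $1\otimes A$ in $K\otimes_DA$), put $\mathrm{Int}_K(A)=\{f\in K[x]\mid f(A)\subseteq A\}$, with evaluation in $K\otimes_DA$; in particular this defines $\mathrm{Int}_K(M_n(D))$. A polynomial $f\in K[x]$ is properly integral over $\mathrm{Int}_K(A)$ if $f$ lies in the integral closure of $\mathrm{Int}_K(A)$ (in its fraction field $K(x)$) but $f\notin\mathrm{Int}_K(A)$. Construction of $F$. Let $V=D_P$, a discrete valuation ring with maximal ideal $\pi V$ and finite residue field $V/\pi V\cong D/P\cong\mathbb{F}_q$. Fix a representative in $V$ for each element of $\mathbb{F}_q$; write $\mathbb{F}_q$ also for this set of representatives and $\mathbb{F}_q^\times$ for the representatives of the nonzero residue classes. Let $\mathscr{P}$ be the set of monic irreducible polynomials $f\in\mathbb{F}_q[x]$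 with $2\le\deg f\le n$; for each of them fix a monic lift of the same degree in $V[x]$, denoted by the same symbol. Put $$\theta(x)=\prod_{f\in\mathscr{P}}f(x)^{\lfloor n/\deg f\rfloor},\quad h(x)=x^{n-1}\prod_{a\in\mathbb{F}_q^\times}(x^n+\pi a),\quad H(x)=\prod_{b\in\mathbb{F}_q}h(x-b),\quad F(x)=\frac{H(x)\,\theta(x)^q}{\pi^q}.$$ An element $c\in D\setminus P$ with $cF$ properly integral over $\mathrm{Int}_K(M_n(D))$ always exists. *)

theory Defs
  imports
    "HOL-Algebra.Ring_Divisibility"
    "HOL-Algebra.Ideal_Product"
    "HOL-Algebra.UnivPoly"
    "HOL-Algebra.Free_Abelian_Groups"
    "HOL-Computational_Algebra.Fraction_Field"
    "HOL-Computational_Algebra.Polynomial"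
    "Jordan_Normal_Form.Matrix"
begin

text \<open>
  The field \<open>K\<close> is a type of class \<^class>\<open>field\<close>, and subrings of \<open>K\<close>, of \<open>K[x]\<close> and of
  \<open>K(x)\<close> are sets; \<open>K[x]\<close> is the type \<open>'k poly\<close> and \<open>K(x)\<close> the type \<open>'k poly fract\<close>.
  The algebras, whose operations are not those of a type class, are records of the type
  \<^type>\<open>module\<close>, used with all of its ring operations.
\<close>

section \<open>Integral closure\<close>

definition frac_field :: "'b::field set \<Rightarrow> 'b set" where
  "frac_field S = {a / b | a b. a \<in> S \<and> b \<in> S \<and> b \<noteq> 0}"

definition integral_over :: "'b::comm_ring_1 set \<Rightarrow> 'b \<Rightarrow> bool" where
  "integral_over S x \<longleftrightarrow>
     (\<exists>p. Polynomial.lead_coeff p = 1 \<and> (\<forall>i. Polynomial.coeff p i \<in> S) \<and> poly p x = 0)"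

definition integral_closure :: "'b::field set \<Rightarrow> 'b set" where
  "integral_closure S = {x \<in> frac_field S. integral_over S x}"

definition integrally_closed :: "'b::field set \<Rightarrow> bool" where
  "integrally_closed S \<longleftrightarrow> integral_closure S = S"


section \<open>Dedekind domains inside a field\<close>

text \<open>A subring \<open>S\<close> as a ring record, which is at the same time the \<open>S\<close>-algebra \<open>S\<close>.
  \<open>ring_of UNIV\<close> is the ambient ring as an algebra over any of its subrings.\<close>

definition ring_of :: "'b::comm_ring_1 set \<Rightarrow> ('b, 'b) module" where
  "ring_of S = \<lparr>carrier = S, monoid.mult = (*), one = 1, ring.zero = 0, add = (+), module.smult = (*)\<rparr>"

definition dedekind_domain :: "'k::field set \<Rightarrow> bool" where
  "dedekind_domain D \<longleftrightarrow>
     noetherian_domain (ring_of D) \<and>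
     integrally_closed D \<and>
     (\<forall>Q. primeideal Q (ring_of D) \<and> Q \<noteq> {0} \<longrightarrow> maximalideal Q (ring_of D))"

definition finite_residue_fields :: "'k::field set \<Rightarrow> bool" where
  "finite_residue_fields D \<longleftrightarrow>
     (\<forall>Q. primeideal Q (ring_of D) \<and> Q \<noteq> {0} \<longrightarrow> finite (carrier (ring_of D Quot Q)))"

definition localization :: "'k::field set \<Rightarrow> 'k set \<Rightarrow> 'k set" where
  "localization D P = {a / s | a s. a \<in> D \<and> s \<in> D - P}"


section \<open>Algebras\<close>

text \<open>In contrast to the locale \<^locale>\<open>algebra\<close>, multiplication is not assumed commutative.\<close>

locale assoc_algebra = module R A + A?: ring A for R (structure) and A (structure) +
  assumes smult_mult_left:
      "\<lbrakk>r \<in> carrier R; x \<in> carrier A; y \<in> carrier A\<rbrakk> \<Longrightarrow>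
        r \<odot>\<^bsub>A\<^esub> (x \<otimes>\<^bsub>A\<^esub> y) = (r \<odot>\<^bsub>A\<^esub> x) \<otimes>\<^bsub>A\<^esub> y"
    and smult_mult_right:
      "\<lbrakk>r \<in> carrier R; x \<in> carrier A; y \<in> carrier A\<rbrakk> \<Longrightarrow>
        r \<odot>\<^bsub>A\<^esub> (x \<otimes>\<^bsub>A\<^esub> y) = x \<otimes>\<^bsub>A\<^esub> (r \<odot>\<^bsub>A\<^esub> y)"

definition torsion_free :: "('r, 'm) ring_scheme \<Rightarrow> ('r, 'a, 'n) module_scheme \<Rightarrow> bool" where
  "torsion_free R A \<longleftrightarrow>
     (\<forall>r\<in>carrier R. \<forall>a\<in>carrier A. r \<odot>\<^bsub>A\<^esub> a = \<zero>\<^bsub>A\<^esub> \<longrightarrow> r = \<zero>\<^bsub>R\<^esub> \<or> a = \<zero>\<^bsub>A\<^esub>)"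

definition fin_gen_module :: "('r, 'm) ring_scheme \<Rightarrow> ('r, 'a, 'n) module_scheme \<Rightarrow> bool" where
  "fin_gen_module R A \<longleftrightarrow>
     (\<exists>S. finite S \<and> S \<subseteq> carrier A \<and>
        (\<forall>a\<in>carrier A. \<exists>r\<in>S \<rightarrow> carrier R. a = (\<Oplus>\<^bsub>A\<^esub>s\<in>S. r s \<odot>\<^bsub>A\<^esub> s)))"

definition quot_algebra :: "('r, 'a, 'n) module_scheme \<Rightarrow> 'a set \<Rightarrow> ('r, 'a set) module" where
  "quot_algebra A I =
     \<lparr>carrier = carrier (A Quot I), monoid.mult = monoid.mult (A Quot I), one = one (A Quot I),
      ring.zero = ring.zero (A Quot I), add = add (A Quot I),
      module.smult = (\<lambda>r X. \<Union>x\<in>X. I +>\<^bsub>A\<^esub> (r \<odot>\<^bsub>A\<^esub> x))\<rparr>"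

definition ideal_smult :: "'r set \<Rightarrow> ('r, 'a, 'n) module_scheme \<Rightarrow> 'a set" where
  "ideal_smult J A = generate (add_monoid A) {r \<odot>\<^bsub>A\<^esub> a | r a. r \<in> J \<and> a \<in> carrier A}"

definition mat_algebra :: "nat \<Rightarrow> ('r, 'a, 'n) module_scheme \<Rightarrow> ('r, 'a mat) module" where
  "mat_algebra n A =
     \<lparr>carrier = {M \<in> carrier_mat n n. elements_mat M \<subseteq> carrier A},
      monoid.mult = (\<lambda>M N. mat n n (\<lambda>(i, j). \<Oplus>\<^bsub>A\<^esub>k\<in>{..<n}. M $$ (i, k) \<otimes>\<^bsub>A\<^esub> N $$ (k, j))),
      one = mat n n (\<lambda>(i, j). if i = j then \<one>\<^bsub>A\<^esub> else \<zero>\<^bsub>A\<^esub>),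
      ring.zero = mat n n (\<lambda>(i, j). \<zero>\<^bsub>A\<^esub>),
      add = (\<lambda>M N. mat n n (\<lambda>(i, j). M $$ (i, j) \<oplus>\<^bsub>A\<^esub> N $$ (i, j))),
      module.smult = (\<lambda>r M. mat n n (\<lambda>(i, j). r \<odot>\<^bsub>A\<^esub> M $$ (i, j)))\<rparr>"

definition algebra_iso ::
    "('r, 'm) ring_scheme \<Rightarrow> ('r, 'a, 'n) module_scheme \<Rightarrow> ('r, 'b, 'p) module_scheme \<Rightarrow> bool" where
  "algebra_iso R A B \<longleftrightarrow>
     (\<exists>\<phi>\<in>ring_iso A B. \<forall>r\<in>carrier R. \<forall>x\<in>carrier A. \<phi> (r \<odot>\<^bsub>A\<^esub> x) = r \<odot>\<^bsub>B\<^esub> \<phi> x)"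


section \<open>Tensor product of algebras\<close>

text \<open>The additive group of \<open>B \<otimes>\<^sub>R C\<close> is the free abelian group on \<open>B \<times> C\<close> modulo the
  bilinearity relations. The multiplication is induced by \<open>(b, c)(b', c') = (bb', cc')\<close>,
  extended biadditively to the free abelian group.\<close>

definition free_pair_ring ::
    "('r, 'b, 'm) module_scheme \<Rightarrow> ('r, 'c, 'n) module_scheme \<Rightarrow> ('b \<times> 'c \<Rightarrow>\<^sub>0 int) ring" where
  "free_pair_ring B C =
     \<lparr>carrier = carrier (free_Abelian_group (carrier B \<times> carrier C)),
      monoid.mult = (\<lambda>u v. frag_extend (\<lambda>(b, c).
                frag_extend (\<lambda>(b', c'). frag_of (b \<otimes>\<^bsub>B\<^esub> b', c \<otimes>\<^bsub>C\<^esub> c')) v) u),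
      one = frag_of (\<one>\<^bsub>B\<^esub>, \<one>\<^bsub>C\<^esub>), ring.zero = 0, add = (+)\<rparr>"

definition tensor_relations ::
    "('r, 'k) ring_scheme \<Rightarrow> ('r, 'b, 'm) module_scheme \<Rightarrow> ('r, 'c, 'n) module_scheme
      \<Rightarrow> ('b \<times> 'c \<Rightarrow>\<^sub>0 int) set" where
  "tensor_relations R B C =
     {frag_of (b \<oplus>\<^bsub>B\<^esub> b', c) - frag_of (b, c) - frag_of (b', c) | b b' c.
        b \<in> carrier B \<and> b' \<in> carrier B \<and> c \<in> carrier C} \<union>
     {frag_of (b, c \<oplus>\<^bsub>C\<^esub> c') - frag_of (b, c) - frag_of (b, c') | b c c'.
        b \<in> carrier B \<and> c \<in> carrier C \<and> c' \<in> carrier C} \<union>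
     {frag_of (r \<odot>\<^bsub>B\<^esub> b, c) - frag_of (b, r \<odot>\<^bsub>C\<^esub> c) | r b c.
        r \<in> carrier R \<and> b \<in> carrier B \<and> c \<in> carrier C}"

definition tensor_kernel ::
    "('r, 'k) ring_scheme \<Rightarrow> ('r, 'b, 'm) module_scheme \<Rightarrow> ('r, 'c, 'n) module_scheme
      \<Rightarrow> ('b \<times> 'c \<Rightarrow>\<^sub>0 int) set" where
  "tensor_kernel R B C =
     generate (free_Abelian_group (carrier B \<times> carrier C)) (tensor_relations R B C)"

definition tensor_algebra ::
    "('r, 'k) ring_scheme \<Rightarrow> ('r, 'b, 'm) module_scheme \<Rightarrow> ('r, 'c, 'n) module_scheme
      \<Rightarrow> ('b \<times> 'c \<Rightarrow>\<^sub>0 int) set ring" where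
  "tensor_algebra R B C = free_pair_ring B C Quot tensor_kernel R B C"

definition pure_tensor ::
    "('r, 'k) ring_scheme \<Rightarrow> ('r, 'b, 'm) module_scheme \<Rightarrow> ('r, 'c, 'n) module_scheme
      \<Rightarrow> 'b \<Rightarrow> 'c \<Rightarrow> ('b \<times> 'c \<Rightarrow>\<^sub>0 int) set" where
  "pure_tensor R B C b c = tensor_kernel R B C +>\<^bsub>free_pair_ring B C\<^esub> frag_of (b, c)"


section \<open>Integer-valued polynomials on an algebra\<close>

text \<open>Throughout, \<open>D\<close> is a subring of the field \<open>K\<close> and \<open>A\<close> a \<open>D\<close>-algebra.\<close>

definition scalar_ext ::
    "'k::field set \<Rightarrow> ('k, 'a) module \<Rightarrow> ('k \<times> 'a \<Rightarrow>\<^sub>0 int) set ring" where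
  "scalar_ext D A = tensor_algebra (ring_of D) (ring_of UNIV) A"

text \<open>The canonical maps \<open>k \<mapsto> k \<otimes> 1\<close> and \<open>a \<mapsto> 1 \<otimes> a\<close> into \<open>K \<otimes>\<^sub>D A\<close>.\<close>

definition emb_K :: "'k::field set \<Rightarrow> ('k, 'a) module \<Rightarrow> 'k \<Rightarrow> ('k \<times> 'a \<Rightarrow>\<^sub>0 int) set" where
  "emb_K D A k = pure_tensor (ring_of D) (ring_of UNIV) A k \<one>\<^bsub>A\<^esub>"

definition emb_A :: "'k::field set \<Rightarrow> ('k, 'a) module \<Rightarrow> 'a \<Rightarrow> ('k \<times> 'a \<Rightarrow>\<^sub>0 int) set" where
  "emb_A D A a = pure_tensor (ring_of D) (ring_of UNIV) A 1 a"

definition eval_ext ::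
    "'k::field set \<Rightarrow> ('k, 'a) module \<Rightarrow> 'k poly \<Rightarrow> ('k \<times> 'a \<Rightarrow>\<^sub>0 int) set
      \<Rightarrow> ('k \<times> 'a \<Rightarrow>\<^sub>0 int) set" where
  "eval_ext D A f t =
     (\<Oplus>\<^bsub>scalar_ext D A\<^esub>i\<in>{..Polynomial.degree f}.
        emb_K D A (Polynomial.coeff f i) \<otimes>\<^bsub>scalar_ext D A\<^esub> t [^]\<^bsub>scalar_ext D A\<^esub> i)"

definition Int_K :: "'k::field set \<Rightarrow> ('k, 'a) module \<Rightarrow> 'k poly set" where
  "Int_K D A =
     {f. \<forall>a\<in>carrier A. eval_ext D A f (emb_A D A a) \<in> emb_A D A ` carrier A}"

text \<open>The standing assumptions on \<open>A\<close>; the last conjunct is \<open>A \<inter> K = D\<close>,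
  read in \<open>K \<otimes>\<^sub>D A\<close>.\<close>

definition admissible_algebra :: "'k::field set \<Rightarrow> ('k, 'a) module \<Rightarrow> bool" where
  "admissible_algebra D A \<longleftrightarrow>
     assoc_algebra (ring_of D) A \<and> torsion_free (ring_of D) A \<and> fin_gen_module (ring_of D) A \<and>
     emb_A D A ` carrier A \<inter> range (emb_K D A) = emb_K D A ` D"

definition Int_K_rat :: "'k::field set \<Rightarrow> ('k, 'a) module \<Rightarrow> 'k poly fract set" where
  "Int_K_rat D A = (\<lambda>f. Fract f 1) ` Int_K D A"

definition properly_integral :: "'k::field set \<Rightarrow> ('k, 'a) module \<Rightarrow> 'k poly \<Rightarrow> bool" where
  "properly_integral D A f \<longleftrightarrow> Fract f 1 \<in> integral_closure (Int_K_rat D A) \<and> f \<notin> Int_K D A"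


section \<open>The polynomial \<open>F\<close>\<close>

definition residue_ring :: "'k::field set \<Rightarrow> 'k \<Rightarrow> 'k set ring" where
  "residue_ring V \<pi> = ring_of V Quot (PIdl\<^bsub>ring_of V\<^esub> \<pi>)"

text \<open>Polynomials over the residue field are functions from exponents to cosets.\<close>

definition irred_polys :: "'k::field set \<Rightarrow> 'k \<Rightarrow> nat \<Rightarrow> (nat \<Rightarrow> 'k set) set" where
  "irred_polys V \<pi> n =
     {f \<in> carrier (UP (residue_ring V \<pi>)).
        Divisibility.irreducible (UP (residue_ring V \<pi>)) f \<and>
        2 \<le> deg (residue_ring V \<pi>) f \<and> deg (residue_ring V \<pi>) f \<le> n \<and>
        up_ring.coeff (UP (residue_ring V \<pi>)) f (deg (residue_ring V \<pi>) f)
          = \<one>\<^bsub>residue_ring V \<pi>\<^esub>}"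

text \<open>The choices entering the construction: a generator \<open>\<pi>\<close> of the maximal ideal of \<open>V\<close>,
  a representative \<open>rep X\<close> of every residue class \<open>X\<close>, and for every member of
  \<^const>\<open>irred_polys\<close> a monic lift of the same degree. A coset is a subset of \<open>V\<close>, so
  membership in it says both that an element lies in \<open>V\<close> and what it reduces to.\<close>

definition F_choices ::
    "'k::field set \<Rightarrow> nat \<Rightarrow> 'k \<Rightarrow> ('k set \<Rightarrow> 'k) \<Rightarrow> ((nat \<Rightarrow> 'k set) \<Rightarrow> 'k poly) \<Rightarrow> bool" where
  "F_choices V n \<pi> rep lift \<longleftrightarrow>
     \<pi> \<in> V \<and> maximalideal (PIdl\<^bsub>ring_of V\<^esub> \<pi>) (ring_of V) \<and>
     (\<forall>X\<in>carrier (residue_ring V \<pi>). rep X \<in> X) \<and>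
     (\<forall>f\<in>irred_polys V \<pi> n.
        Polynomial.lead_coeff (lift f) = 1 \<and>
        Polynomial.degree (lift f) = deg (residue_ring V \<pi>) f \<and>
        (\<forall>i. Polynomial.coeff (lift f) i \<in> up_ring.coeff (UP (residue_ring V \<pi>)) f i))"

definition theta_poly ::
    "'k::field set \<Rightarrow> nat \<Rightarrow> 'k \<Rightarrow> ((nat \<Rightarrow> 'k set) \<Rightarrow> 'k poly) \<Rightarrow> 'k poly" where
  "theta_poly V n \<pi> lift =
     (\<Prod>f\<in>irred_polys V \<pi> n. lift f ^ (n div deg (residue_ring V \<pi>) f))"

definition h_poly :: "'k::field set \<Rightarrow> nat \<Rightarrow> 'k \<Rightarrow> ('k set \<Rightarrow> 'k) \<Rightarrow> 'k poly" where
  "h_poly V n \<pi> rep =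
     [:0, 1:] ^ (n - 1) *
     (\<Prod>a\<in>rep ` (carrier (residue_ring V \<pi>) - {\<zero>\<^bsub>residue_ring V \<pi>\<^esub>}). [:0, 1:] ^ n + [:\<pi> * a:])"

definition H_poly :: "'k::field set \<Rightarrow> nat \<Rightarrow> 'k \<Rightarrow> ('k set \<Rightarrow> 'k) \<Rightarrow> 'k poly" where
  "H_poly V n \<pi> rep =
     (\<Prod>b\<in>rep ` carrier (residue_ring V \<pi>). pcompose (h_poly V n \<pi> rep) [:- b, 1:])"

definition F_poly ::
    "'k::field set \<Rightarrow> nat \<Rightarrow> 'k \<Rightarrow> ('k set \<Rightarrow> 'k) \<Rightarrow> ((nat \<Rightarrow> 'k set) \<Rightarrow> 'k poly) \<Rightarrow> 'k poly" where
  "F_poly V n \<pi> rep lift =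
     (let q = card (carrier (residue_ring V \<pi>))
      in Polynomial.smult (1 / \<pi> ^ q) (H_poly V n \<pi> rep * theta_poly V n \<pi> lift ^ q))"

end

theory Submission
  imports
    Defs
    "Jordan_Normal_Form.Char_Poly"
    "Jordan_Normal_Form.Jordan_Normal_Form"
    "HOL-Algebra.Algebraic_Closure_Type"
begin

text \<open>
  Put \<open>f = cF\<close>. Two facts about \<open>A\<close> carry the proof.

  The first is that every element of \<open>A\<close> is a root of a monic polynomial of degree \<open>n\<close> over \<open>D\<close>
  (\<open>monic_annihilator_degree_n\<close>). It implies that \<open>Int\<^sub>K(M\<^sub>n(D)) \<subseteq> Int\<^sub>K(A)\<close>
  (\<open>Int_K_mat_subset\<close>): if \<open>a\<close> is a root of such a polynomial \<open>m\<close>, then the coefficients of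
  \<open>g mod m\<close> form the first column of \<open>g(C)\<close> for the companion matrix \<open>C\<close> of \<open>m\<close>. So
  they lie in \<open>D\<close> when \<open>g\<close> is integer-valued on matrices, and \<open>g(a) = (g mod m)(a)\<close> lies in \<open>A\<close>.
  An equation of integral dependence of \<open>f\<close> over \<open>Int\<^sub>K(M\<^sub>n(D))\<close> is therefore one over \<open>Int\<^sub>K(A)\<close>.

  Behind the first fact is that \<open>A\<close> becomes a full matrix algebra in the completion at \<open>P\<close>; this is
  replaced by an approximation. Let \<open>e\<close> correspond to the matrix unit \<open>E\<^sub>0\<^sub>0\<close> modulo \<open>P\<close>. It lifts to
  an idempotent modulo each power \<open>P\<^sup>k\<close>, the left ideal generated by the lift is spanned modulo \<open>P\<^sup>k\<close>
  by \<open>n\<close> elements, and it is faithful. The determinant trick for left multiplication by \<open>a\<close> on it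
  gives a monic polynomial of degree \<open>n\<close> with value at \<open>a\<close> in \<open>P\<^sup>kA\<close>, locally at \<open>P\<close>
  (\<open>approximate_annihilator\<close>). If \<open>1, a, \<dots>, a\<^sup>n\<close> were independent over \<open>K\<close>, a linear form on \<open>A\<close> with
  bounded denominators would send \<open>a\<^sup>n\<close> to \<open>1\<close> and the smaller powers to \<open>0\<close>; its common denominator
  would lie in every \<open>P\<^sup>k\<close>, against Krull's intersection theorem. Hence the minimal polynomial of \<open>a\<close>
  over \<open>K\<close> has degree at most \<open>n\<close>, and it has coefficients in \<open>D\<close> because it divides a monic polynomial
  over the integrally closed ring \<open>D\<close> (\<open>monic_factor_over_integrally_closed\<close>).

  The second fact is that \<open>f \<notin> Int\<^sub>K(A)\<close>, for a reason local at \<open>P\<close>. Let \<open>b\<^sub>0\<close> be the representative of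
  the zero class. The numerator of \<open>F\<close> is \<open>(x - b\<^sub>0)\<^sup>n\<^sup>-\<^sup>1 k(x)\<close>, where \<open>k(b\<^sub>0)\<close> is a unit times
  \<open>\<pi>\<^sup>q\<^sup>-\<^sup>1\<close> (\<open>F_decomposition\<close>). Choose \<open>a \<in> A\<close> such that, modulo \<open>P\<^sup>q\<close>, the difference \<open>y = a - b\<^sub>0\<close>
  is the nilpotent Jordan block. Then \<open>y\<^sup>n\<close> vanishes modulo \<open>P\<^sup>q\<close>, so that the numerator of \<open>F\<close> at \<open>a\<close> is
  congruent to a unit times \<open>\<pi>\<^sup>q\<^sup>-\<^sup>1 y\<^sup>n\<^sup>-\<^sup>1\<close>, which is not divisible by \<open>\<pi>\<^sup>q\<close>
  (\<open>not_integer_valued\<close>).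
\<close>

section \<open>Subrings of a commutative ring\<close>

locale unital_subring =
  fixes S :: "'b::comm_ring_1 set"
  assumes zero_mem [simp]: "0 \<in> S" and one_mem [simp]: "1 \<in> S"
    and add_mem: "\<lbrakk>x \<in> S; y \<in> S\<rbrakk> \<Longrightarrow> x + y \<in> S"
    and mult_mem: "\<lbrakk>x \<in> S; y \<in> S\<rbrakk> \<Longrightarrow> x * y \<in> S"
    and uminus_mem: "x \<in> S \<Longrightarrow> - x \<in> S"
begin

lemma diff_mem: "x \<in> S \<Longrightarrow> y \<in> S \<Longrightarrow> x - y \<in> S"
  using add_mem[of x "- y"] uminus_mem by simp

lemma sum_mem: "(\<And>i. i \<in> I \<Longrightarrow> f i \<in> S) \<Longrightarrow> sum f I \<in> S"
  by (induction I rule: infinite_finite_induct) (auto intro: add_mem)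

lemma prod_mem: "(\<And>i. i \<in> I \<Longrightarrow> f i \<in> S) \<Longrightarrow> prod f I \<in> S"
  by (induction I rule: infinite_finite_induct) (auto intro: mult_mem)

lemma power_mem: "x \<in> S \<Longrightarrow> x ^ k \<in> S"
  by (induction k) (auto intro: mult_mem)

end

lemma ring_of_simps [simp]:
  "carrier (ring_of S) = S" "x \<otimes>\<^bsub>ring_of S\<^esub> y = x * y" "\<one>\<^bsub>ring_of S\<^esub> = 1"
  "\<zero>\<^bsub>ring_of S\<^esub> = 0" "x \<oplus>\<^bsub>ring_of S\<^esub> y = x + y" "x \<odot>\<^bsub>ring_of S\<^esub> y = x * y"
  by (simp_all add: ring_of_def)

lemma unital_subring_of_ring:
  assumes "Ring.ring (ring_of S)"
  shows "unital_subring S"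
proof -
  interpret Ring.ring "ring_of S" by fact
  show ?thesis
  proof
    fix x assume x: "x \<in> S"
    then have "\<ominus>\<^bsub>ring_of S\<^esub> x \<in> S" "x + \<ominus>\<^bsub>ring_of S\<^esub> x = 0"
      using a_inv_closed[of x] r_neg[of x] by simp_all
    then show "- x \<in> S" by (metis minus_unique add_eq_0_iff)
  qed (use zero_closed one_closed a_closed m_closed in simp_all)
qed

lemma (in unital_subring) cring_ring_of: "cring (ring_of S)"
proof (rule cringI)
  show "abelian_group (ring_of S)"
    by (rule abelian_groupI) (auto simp: add_mem algebra_simps intro!: bexI[of _ "- x" for x] uminus_mem)
  show "Group.comm_monoid (ring_of S)"
    by unfold_locales (auto simp: mult_mem algebra_simps)
qed (auto simp: algebra_simps)

lemma (in unital_subring) a_inv_ring_of [simp]: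
  assumes "x \<in> S" shows "\<ominus>\<^bsub>ring_of S\<^esub> x = - x"
proof -
  interpret cring "ring_of S" by (rule cring_ring_of)
  have "- x + x = (0::'b)" by simp
  then show ?thesis
    using assms uminus_mem minus_equality[of "- x" x] by simp
qed

definition poly_over :: "'b::comm_ring_1 set \<Rightarrow> 'b poly \<Rightarrow> bool" where
  "poly_over S p \<longleftrightarrow> (\<forall>i. Polynomial.coeff p i \<in> S)"

context unital_subring
begin

lemma poly_over_0 [simp]: "poly_over S 0"
  by (simp add: poly_over_def)

lemma poly_over_1 [simp]: "poly_over S 1"
  by (simp add: poly_over_def Polynomial.coeff_1)

lemma poly_over_pCons [simp]: "poly_over S (pCons c p) \<longleftrightarrow> c \<in> S \<and> poly_over S p"
  unfolding poly_over_def by (metis coeff_pCons_0 coeff_pCons_Suc not0_implies_Suc)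

lemma poly_over_add: "poly_over S p \<Longrightarrow> poly_over S r \<Longrightarrow> poly_over S (p + r)"
  by (simp add: poly_over_def add_mem)

lemma poly_over_uminus: "poly_over S p \<Longrightarrow> poly_over S (- p)"
  by (simp add: poly_over_def uminus_mem)

lemma poly_over_diff: "poly_over S p \<Longrightarrow> poly_over S r \<Longrightarrow> poly_over S (p - r)"
  by (simp add: poly_over_def diff_mem)

lemma poly_over_smult: "c \<in> S \<Longrightarrow> poly_over S p \<Longrightarrow> poly_over S (Polynomial.smult c p)"
  by (simp add: poly_over_def mult_mem)

lemma poly_over_mult: "poly_over S p \<Longrightarrow> poly_over S r \<Longrightarrow> poly_over S (p * r)"
  unfolding poly_over_def by (auto simp: coeff_mult intro!: sum_mem mult_mem)

lemma poly_over_power: "poly_over S p \<Longrightarrow> poly_over S (p ^ k)"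
  by (induction k) (auto intro: poly_over_mult)

lemma poly_over_sum: "(\<And>i. i \<in> I \<Longrightarrow> poly_over S (f i)) \<Longrightarrow> poly_over S (sum f I)"
  by (induction I rule: infinite_finite_induct) (auto intro: poly_over_add)

lemma poly_over_prod: "(\<And>i. i \<in> I \<Longrightarrow> poly_over S (f i)) \<Longrightarrow> poly_over S (prod f I)"
  by (induction I rule: infinite_finite_induct) (auto intro: poly_over_mult)

lemma poly_over_monom: "c \<in> S \<Longrightarrow> poly_over S (Polynomial.monom c k)"
  by (simp add: poly_over_def)

lemma poly_over_pcompose: "poly_over S p \<Longrightarrow> poly_over S r \<Longrightarrow> poly_over S (pcompose p r)"
  by (induction p) (auto simp: pcompose_pCons intro!: poly_over_add poly_over_mult)

lemma poly_mem: "poly_over S p \<Longrightarrow> x \<in> S \<Longrightarrow> poly p x \<in> S"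
  by (induction p) (auto intro: add_mem mult_mem)

end

lemma (in Ring.ring) diff_add_diff:
  "\<lbrakk>a \<in> carrier R; b \<in> carrier R; c \<in> carrier R; d \<in> carrier R\<rbrakk> \<Longrightarrow>
    (a \<ominus> b) \<oplus> (c \<ominus> d) = (a \<oplus> c) \<ominus> (b \<oplus> d)"
  by algebra

section \<open>Evaluating polynomials over the base ring\<close>

locale algebra_over = assoc_algebra "ring_of D" A
  for D :: "'k::field set" and A :: "('k, 'a) module" (structure)
begin

sublocale D: unital_subring D
  by (rule unital_subring_of_ring) (rule R.ring_axioms)

text \<open>The value at \<open>a \<in> A\<close> of a polynomial over \<open>D\<close>, computed in \<open>A\<close> itself. The lemma
  \<open>eval_ext_eq_pt\<close> relates it to evaluation in the scalar extension.\<close>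

definition ev :: "'k poly \<Rightarrow> 'a \<Rightarrow> 'a" where
  "ev p a = (\<Oplus>i\<in>{..Polynomial.degree p}. Polynomial.coeff p i \<odot> (a [^] i))"

text \<open>The axioms of the module and of the algebra with the operations of \<open>ring_of D\<close> unfolded to those of \<open>K\<close>.\<close>

lemma smult_closed' [simp]: "c \<in> D \<Longrightarrow> x \<in> carrier A \<Longrightarrow> c \<odot> x \<in> carrier A"
  using smult_closed[of c x] by simp

lemma smult_add_left: "c \<in> D \<Longrightarrow> d \<in> D \<Longrightarrow> x \<in> carrier A \<Longrightarrow> (c + d) \<odot> x = c \<odot> x \<oplus> d \<odot> x"
  using smult_l_distr[of c d x] by simp

lemma smult_add_right:
  "c \<in> D \<Longrightarrow> x \<in> carrier A \<Longrightarrow> y \<in> carrier A \<Longrightarrow> c \<odot> (x \<oplus> y) = c \<odot> x \<oplus> c \<odot> y"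
  using smult_r_distr[of c x y] by simp

lemma smult_smult: "c \<in> D \<Longrightarrow> d \<in> D \<Longrightarrow> x \<in> carrier A \<Longrightarrow> c \<odot> (d \<odot> x) = (c * d) \<odot> x"
  using smult_assoc1[of c d x] by simp

lemma smult_1 [simp]: "x \<in> carrier A \<Longrightarrow> 1 \<odot> x = x"
  using smult_one[of x] by simp

lemma smult_0 [simp]: "x \<in> carrier A \<Longrightarrow> 0 \<odot> x = \<zero>"
  using smult_l_null[of x] by simp

lemma smult_zero [simp]: "c \<in> D \<Longrightarrow> c \<odot> \<zero> = \<zero>"
  using smult_r_null[of c] by simp

lemma smult_uminus_left: "c \<in> D \<Longrightarrow> x \<in> carrier A \<Longrightarrow> (- c) \<odot> x = \<ominus> (c \<odot> x)"
  using smult_l_minus[of c x] by simp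

lemma smult_uminus_right: "c \<in> D \<Longrightarrow> x \<in> carrier A \<Longrightarrow> c \<odot> (\<ominus> x) = \<ominus> (c \<odot> x)"
  using smult_r_minus[of c x] by simp

lemma smult_diff_left:
  "c \<in> D \<Longrightarrow> d \<in> D \<Longrightarrow> x \<in> carrier A \<Longrightarrow> (c - d) \<odot> x = c \<odot> x \<ominus> d \<odot> x"
  using smult_add_left[of c "- d" x] by (simp add: smult_uminus_left M.minus_eq D.uminus_mem)

lemma smult_diff_right:
  "c \<in> D \<Longrightarrow> x \<in> carrier A \<Longrightarrow> y \<in> carrier A \<Longrightarrow> c \<odot> (x \<ominus> y) = c \<odot> x \<ominus> c \<odot> y"
  by (simp add: smult_uminus_right M.minus_eq smult_add_right)

lemma mult_smult_left:
  "c \<in> D \<Longrightarrow> x \<in> carrier A \<Longrightarrow> y \<in> carrier A \<Longrightarrow> (c \<odot> x) \<otimes> y = c \<odot> (x \<otimes> y)"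
  using smult_mult_left[of c x y] by simp

lemma mult_smult_right:
  "c \<in> D \<Longrightarrow> x \<in> carrier A \<Longrightarrow> y \<in> carrier A \<Longrightarrow> x \<otimes> (c \<odot> y) = c \<odot> (x \<otimes> y)"
  using smult_mult_right[of c x y] by simp

lemma smult_finsum:
  "c \<in> D \<Longrightarrow> f \<in> I \<rightarrow> carrier A \<Longrightarrow> c \<odot> (\<Oplus>i\<in>I. f i) = (\<Oplus>i\<in>I. c \<odot> f i)"
proof (induction I rule: infinite_finite_induct)
  case (insert x I)
  then show ?case by (simp add: Pi_def smult_add_right)
qed (simp_all)

lemma finsum_minus:
  "f \<in> I \<rightarrow> carrier A \<Longrightarrow> g \<in> I \<rightarrow> carrier A \<Longrightarrow>
    (\<Oplus>i\<in>I. f i \<ominus> g i) = (\<Oplus>i\<in>I. f i) \<ominus> (\<Oplus>i\<in>I. g i)"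
proof (induction I rule: infinite_finite_induct)
  case (insert x I)
  then have "f x \<in> carrier A" "g x \<in> carrier A" "finsum A f I \<in> carrier A" "finsum A g I \<in> carrier A"
    by (auto intro!: M.finsum_closed)
  moreover have "(\<Oplus>i\<in>insert x I. f i \<ominus> g i) = (f x \<ominus> g x) \<oplus> (\<Oplus>i\<in>I. f i \<ominus> g i)"
    using insert by (intro M.finsum_insert) (auto simp: Pi_def)
  ultimately show ?case using insert by (simp add: Pi_def A.diff_add_diff)
qed (simp_all add: M.minus_eq)

lemma ev_term_closed:
  "poly_over D p \<Longrightarrow> a \<in> carrier A \<Longrightarrow> Polynomial.coeff p i \<odot> (a [^] i) \<in> carrier A"
  by (simp add: poly_over_def)

lemma ev_closed [simp]: "poly_over D p \<Longrightarrow> a \<in> carrier A \<Longrightarrow> ev p a \<in> carrier A"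
  unfolding ev_def by (intro M.finsum_closed) (auto intro: ev_term_closed)

lemma ev_bound:
  assumes "poly_over D p" "a \<in> carrier A" "Polynomial.degree p \<le> N"
  shows "ev p a = (\<Oplus>i\<in>{..N}. Polynomial.coeff p i \<odot> (a [^] i))"
  unfolding ev_def
  by (rule M.add.finprod_mono_neutral_cong_left)
    (use assms in \<open>auto simp: coeff_eq_0 intro!: smult_closed' simp: poly_over_def\<close>)

lemma ev_0 [simp]: "a \<in> carrier A \<Longrightarrow> ev 0 a = \<zero>"
  by (simp add: ev_def)

lemma ev_add:
  assumes "poly_over D p" "poly_over D r" "a \<in> carrier A"
  shows "ev (p + r) a = ev p a \<oplus> ev r a"
proof -
  let ?N = "max (Polynomial.degree p) (Polynomial.degree r)"
  have "ev (p + r) a = (\<Oplus>i\<in>{..?N}. Polynomial.coeff (p + r) i \<odot> (a [^] i))"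
    using assms by (intro ev_bound) (auto intro: D.poly_over_add degree_add_le)
  also have "\<dots> = (\<Oplus>i\<in>{..?N}. Polynomial.coeff p i \<odot> (a [^] i) \<oplus> Polynomial.coeff r i \<odot> (a [^] i))"
    using assms by (intro M.finsum_cong')
      (auto simp: poly_over_def smult_add_left)
  also have "\<dots> = ev p a \<oplus> ev r a"
    using assms by (subst M.finsum_addf) (auto simp: ev_bound[of _ _ ?N] intro: ev_term_closed)
  finally show ?thesis .
qed

lemma ev_smult:
  assumes "poly_over D p" "c \<in> D" "a \<in> carrier A"
  shows "ev (Polynomial.smult c p) a = c \<odot> ev p a"
proof -
  have "ev (Polynomial.smult c p) a = (\<Oplus>i\<in>{..Polynomial.degree p}. (c * Polynomial.coeff p i) \<odot> (a [^] i))"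
    using assms by (subst ev_bound[of _ _ "Polynomial.degree p"])
      (auto intro: D.poly_over_smult degree_smult_le)
  also have "\<dots> = (\<Oplus>i\<in>{..Polynomial.degree p}. c \<odot> (Polynomial.coeff p i \<odot> (a [^] i)))"
    using assms by (intro M.finsum_cong') (auto simp: poly_over_def smult_smult D.mult_mem)
  also have "\<dots> = c \<odot> ev p a"
    using assms unfolding ev_def by (subst smult_finsum) (auto intro: ev_term_closed)
  finally show ?thesis .
qed

lemma ev_uminus:
  assumes "poly_over D p" "a \<in> carrier A"
  shows "ev (- p) a = \<ominus> ev p a"
  using ev_smult[of p "- 1" a] assms by (simp add: D.uminus_mem smult_uminus_left)

lemma ev_diff:
  assumes "poly_over D p" "poly_over D r" "a \<in> carrier A"
  shows "ev (p - r) a = ev p a \<ominus> ev r a"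
  using ev_add[of p "- r" a] ev_uminus[of r a] assms by (simp add: D.poly_over_uminus M.minus_eq)

lemma ev_const: "c \<in> D \<Longrightarrow> a \<in> carrier A \<Longrightarrow> ev [:c:] a = c \<odot> \<one>"
  by (simp add: ev_def)

lemma ev_1 [simp]: "a \<in> carrier A \<Longrightarrow> ev 1 a = \<one>"
  using ev_const[of 1 a] by (simp add: one_pCons)

lemma ev_pCons_0:
  assumes "poly_over D p" "a \<in> carrier A"
  shows "ev (pCons 0 p) a = a \<otimes> ev p a"
proof -
  have "ev (pCons 0 p) a = (\<Oplus>i\<in>{..Suc (Polynomial.degree p)}. Polynomial.coeff (pCons 0 p) i \<odot> (a [^] i))"
    using assms by (intro ev_bound) (auto simp: degree_pCons_le)
  also have "\<dots> = (\<Oplus>i\<in>{..Polynomial.degree p}. Polynomial.coeff p i \<odot> (a [^] Suc i))"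
    using assms by (subst M.finsum_Suc2) (auto simp: poly_over_def coeff_pCons split: nat.splits)
  also have "\<dots> = (\<Oplus>i\<in>{..Polynomial.degree p}. a \<otimes> (Polynomial.coeff p i \<odot> (a [^] i)))"
    using assms by (intro M.finsum_cong') (auto simp: poly_over_def mult_smult_right A.nat_pow_Suc2[symmetric])
  also have "\<dots> = a \<otimes> ev p a"
    using assms unfolding ev_def by (subst A.finsum_rdistr) (auto intro: ev_term_closed)
  finally show ?thesis .
qed

lemma ev_pCons:
  assumes "poly_over D p" "c \<in> D" "a \<in> carrier A"
  shows "ev (pCons c p) a = c \<odot> \<one> \<oplus> a \<otimes> ev p a"
proof -
  have "pCons c p = [:c:] + pCons 0 p" by simp
  then show ?thesis
    using assms by (metis D.poly_over_0 D.poly_over_pCons D.zero_mem ev_add ev_const ev_pCons_0)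
qed

lemma ev_x [simp]: "a \<in> carrier A \<Longrightarrow> ev [:0, 1:] a = a"
  by (simp add: ev_pCons)

lemma ev_mult:
  assumes "poly_over D p" "poly_over D r" "a \<in> carrier A"
  shows "ev (p * r) a = ev p a \<otimes> ev r a"
  using assms(1)
proof (induction p)
  case 0
  then show ?case using assms by simp
next
  case (pCons c p)
  then have cp: "c \<in> D" "poly_over D p" by auto
  have "pCons c p * r = Polynomial.smult c r + pCons 0 (p * r)"
    by (rule mult_pCons_left)
  then have "ev (pCons c p * r) a = c \<odot> ev r a \<oplus> a \<otimes> (ev p a \<otimes> ev r a)"
    using cp assms pCons.IH by (simp add: ev_add ev_smult ev_pCons_0 D.poly_over_smult D.poly_over_mult)
  also have "\<dots> = ev (pCons c p) a \<otimes> ev r a"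
    using cp assms by (simp add: ev_pCons A.l_distr mult_smult_left A.m_assoc)
  finally show ?case .
qed

lemma ev_power:
  assumes "poly_over D p" "a \<in> carrier A"
  shows "ev (p ^ k) a = ev p a [^] k"
proof (induction k)
  case (Suc k)
  have "ev (p ^ Suc k) a = ev (p ^ k * p) a" by (simp add: mult.commute)
  then show ?case using Suc assms by (simp add: ev_mult D.poly_over_power)
qed (use assms in simp)

end

section \<open>The scalar extension of an algebra\<close>

lemma frag_extend_plus_fun: "frag_extend (\<lambda>x. f x + g x) u = frag_extend f u + frag_extend g u"
  by (simp add: frag_extend_def frag_cmul_distrib2 sum.distrib)

lemma frag_extend_minus_fun: "frag_extend (\<lambda>x. f x - g x) u = frag_extend f u - frag_extend g u"
  using frag_extend_plus_fun[of "\<lambda>x. f x - g x" g u] by (simp add: eq_diff_eq)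

lemma (in Ring.ring) add_diff_diff_eq_zero:
  "x \<in> carrier R \<Longrightarrow> y \<in> carrier R \<Longrightarrow> x \<oplus> y \<ominus> x \<ominus> y = \<zero>"
  by algebra

context algebra_over
begin

abbreviation "FP \<equiv> free_pair_ring (ring_of (UNIV :: 'k set)) A"
abbreviation "ker \<equiv> tensor_kernel (ring_of D) (ring_of (UNIV :: 'k set)) A"
abbreviation "rels \<equiv> tensor_relations (ring_of D) (ring_of (UNIV :: 'k set)) A"
abbreviation "FG \<equiv> free_Abelian_group (UNIV \<times> carrier A) :: ('k \<times> 'a \<Rightarrow>\<^sub>0 int) monoid"

lemma FP_simps [simp]:
  "u \<in> carrier FP \<longleftrightarrow> Poly_Mapping.keys u \<subseteq> UNIV \<times> carrier A"
  "\<one>\<^bsub>FP\<^esub> = frag_of (1, \<one>)" "\<zero>\<^bsub>FP\<^esub> = 0" "u \<oplus>\<^bsub>FP\<^esub> v = u + v"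
  by (simp_all add: free_pair_ring_def)

lemma FP_mult_frag_of [simp]:
  "frag_of (b, c) \<otimes>\<^bsub>FP\<^esub> frag_of (b', c') = frag_of (b * b', c \<otimes> c')"
  by (simp add: free_pair_ring_def)

lemma FP_mult_linear:
  "(u + u') \<otimes>\<^bsub>FP\<^esub> v = u \<otimes>\<^bsub>FP\<^esub> v + u' \<otimes>\<^bsub>FP\<^esub> v"
  "(u - u') \<otimes>\<^bsub>FP\<^esub> v = u \<otimes>\<^bsub>FP\<^esub> v - u' \<otimes>\<^bsub>FP\<^esub> v"
  "u \<otimes>\<^bsub>FP\<^esub> (v + v') = u \<otimes>\<^bsub>FP\<^esub> v + u \<otimes>\<^bsub>FP\<^esub> v'"
  "u \<otimes>\<^bsub>FP\<^esub> (v - v') = u \<otimes>\<^bsub>FP\<^esub> v - u \<otimes>\<^bsub>FP\<^esub> v'"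
  "0 \<otimes>\<^bsub>FP\<^esub> v = 0" "u \<otimes>\<^bsub>FP\<^esub> 0 = 0"
  by (simp_all add: free_pair_ring_def frag_extend_add frag_extend_diff case_prod_unfold
        frag_extend_plus_fun frag_extend_minus_fun frag_extend_eq_0)

lemma FP_induct [consumes 1, case_names zero diff frag]:
  assumes "Poly_Mapping.keys u \<subseteq> UNIV \<times> carrier A" "P 0"
    "\<And>u v. \<lbrakk>Poly_Mapping.keys u \<subseteq> UNIV \<times> carrier A; Poly_Mapping.keys v \<subseteq> UNIV \<times> carrier A; P u; P v\<rbrakk>
      \<Longrightarrow> P (u - v)"
    "\<And>b c. c \<in> carrier A \<Longrightarrow> P (frag_of (b, c))"
  shows "P u"
  using assms(1) by (rule free_Abelian_group_induct) (use assms in auto)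

lemma keys_diff_subset: "Poly_Mapping.keys u \<subseteq> S \<Longrightarrow> Poly_Mapping.keys v \<subseteq> S \<Longrightarrow> Poly_Mapping.keys (u - v) \<subseteq> S"
  by (rule order_trans[OF keys_diff]) blast

lemma FP_mult_closed:
  assumes "Poly_Mapping.keys u \<subseteq> UNIV \<times> carrier A" and v: "Poly_Mapping.keys v \<subseteq> UNIV \<times> carrier A"
  shows "Poly_Mapping.keys (u \<otimes>\<^bsub>FP\<^esub> v) \<subseteq> UNIV \<times> carrier A"
  using assms(1)
proof (induction u rule: FP_induct)
  case (frag b c)
  show ?case using v
  proof (induction v rule: FP_induct)
    case (frag b' c')
    then show ?case using \<open>c \<in> carrier A\<close> by simp
  qed (simp_all add: FP_mult_linear keys_diff_subset)
qed (simp_all add: FP_mult_linear keys_diff_subset)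

lemma FP_mult_assoc:
  assumes "Poly_Mapping.keys u \<subseteq> UNIV \<times> carrier A" and v: "Poly_Mapping.keys v \<subseteq> UNIV \<times> carrier A"
    and w: "Poly_Mapping.keys w \<subseteq> UNIV \<times> carrier A"
  shows "u \<otimes>\<^bsub>FP\<^esub> v \<otimes>\<^bsub>FP\<^esub> w = u \<otimes>\<^bsub>FP\<^esub> (v \<otimes>\<^bsub>FP\<^esub> w)"
  using assms(1)
proof (induction u rule: FP_induct)
  case u: (frag b c)
  show ?case using v
  proof (induction v rule: FP_induct)
    case v: (frag b' c')
    show ?case using w
    proof (induction w rule: FP_induct)
      case (frag b'' c'')
      then show ?case using u v by (simp add: A.m_assoc mult.assoc)
    qed (simp_all add: FP_mult_linear)
  qed (simp_all add: FP_mult_linear)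
qed (simp_all add: FP_mult_linear)

lemma FP_mult_one:
  assumes "Poly_Mapping.keys u \<subseteq> UNIV \<times> carrier A"
  shows "frag_of (1, \<one>) \<otimes>\<^bsub>FP\<^esub> u = u" "u \<otimes>\<^bsub>FP\<^esub> frag_of (1, \<one>) = u"
  using assms by (induction u rule: FP_induct) (simp_all add: FP_mult_linear)

lemma ring_FP: "Ring.ring FP"
proof (rule ringI)
  show "abelian_group FP"
  proof (rule abelian_groupI)
    fix x assume "x \<in> carrier FP"
    then show "\<exists>y\<in>carrier FP. y \<oplus>\<^bsub>FP\<^esub> x = \<zero>\<^bsub>FP\<^esub>"
      by (intro bexI[of _ "- x"]) auto
  qed (auto dest: subsetD[OF keys_add] simp: algebra_simps)
  show "Group.monoid FP"
    by unfold_locales (use FP_mult_closed in \<open>auto simp: FP_mult_assoc FP_mult_one\<close>)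
qed (simp_all add: FP_mult_linear)

lemma rels_intros:
  "c \<in> carrier A \<Longrightarrow> frag_of (b + b', c) - frag_of (b, c) - frag_of (b', c) \<in> rels"
  "c \<in> carrier A \<Longrightarrow> c' \<in> carrier A \<Longrightarrow>
    frag_of (b, c \<oplus> c') - frag_of (b, c) - frag_of (b, c') \<in> rels"
  "r \<in> D \<Longrightarrow> c \<in> carrier A \<Longrightarrow> frag_of (r * b, c) - frag_of (b, r \<odot> c) \<in> rels"
  unfolding tensor_relations_def ring_of_simps
    apply (rule UnI1, rule UnI1, rule CollectI, rule exI[of _ b], rule exI[of _ b'], rule exI[of _ c], simp)
   apply (rule UnI1, rule UnI2, rule CollectI, rule exI[of _ b], rule exI[of _ c], rule exI[of _ c'], simp)
  apply (rule UnI2, rule CollectI, rule exI[of _ r], rule exI[of _ b], rule exI[of _ c], simp)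
  done

lemma rels_cases:
  assumes "u \<in> rels"
  obtains
    (left) b b' c where "c \<in> carrier A" "u = frag_of (b + b', c) - frag_of (b, c) - frag_of (b', c)"
  | (right) b c c' where "c \<in> carrier A" "c' \<in> carrier A"
      "u = frag_of (b, c \<oplus> c') - frag_of (b, c) - frag_of (b, c')"
  | (scalar) r b c where "r \<in> D" "c \<in> carrier A" "u = frag_of (r * b, c) - frag_of (b, r \<odot> c)"
  using assms unfolding tensor_relations_def ring_of_simps
  by (elim UnE CollectE exE conjE) (rule left right scalar; assumption)+

lemma rels_in_carrier: "rels \<subseteq> carrier FG"
proof
  fix u assume "u \<in> rels"
  then show "u \<in> carrier FG"
    by (cases rule: rels_cases) (simp_all add: keys_diff_subset)
qed

lemma subgroup_ker: "subgroup ker FG"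
  unfolding tensor_kernel_def using rels_in_carrier
  by (auto intro: group.generate_is_subgroup)

lemma ker_props:
  "u \<in> ker \<Longrightarrow> Poly_Mapping.keys u \<subseteq> UNIV \<times> carrier A" "0 \<in> ker"
  "u \<in> ker \<Longrightarrow> v \<in> ker \<Longrightarrow> u + v \<in> ker" "u \<in> ker \<Longrightarrow> - u \<in> ker"
  "u \<in> ker \<Longrightarrow> v \<in> ker \<Longrightarrow> u - v \<in> ker"
proof -
  show keys: "Poly_Mapping.keys u \<subseteq> UNIV \<times> carrier A" if "u \<in> ker" for u
    using subgroup.mem_carrier[OF subgroup_ker that] by simp
  show "0 \<in> ker" using subgroup.one_closed[OF subgroup_ker] by simp
  show add: "u + v \<in> ker" if "u \<in> ker" "v \<in> ker" for u v
    using subgroup.m_closed[OF subgroup_ker that] by simp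
  show neg: "- u \<in> ker" if "u \<in> ker" for u
    using subgroup.m_inv_closed[OF subgroup_ker that] keys[OF that] by simp
  show "u - v \<in> ker" if "u \<in> ker" "v \<in> ker"
    using add[OF that(1) neg[OF that(2)]] by simp
qed

lemma rels_in_ker: "u \<in> rels \<Longrightarrow> u \<in> ker"
  unfolding tensor_kernel_def by (rule generate.incl)

lemma rels_mult:
  assumes "u \<in> rels" and c: "c \<in> carrier A"
  shows "u \<otimes>\<^bsub>FP\<^esub> frag_of (b, c) \<in> rels" "frag_of (b, c) \<otimes>\<^bsub>FP\<^esub> u \<in> rels"
proof -
  have "u \<otimes>\<^bsub>FP\<^esub> frag_of (b, c) \<in> rels \<and> frag_of (b, c) \<otimes>\<^bsub>FP\<^esub> u \<in> rels"
    using assms(1)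
  proof (cases rule: rels_cases)
    case (left b1 b2 c1)
    then show ?thesis
      using c rels_intros(1)[of "c1 \<otimes> c" "b1 * b" "b2 * b"] rels_intros(1)[of "c \<otimes> c1" "b * b1" "b * b2"]
      by (simp add: FP_mult_linear ring_distribs)
  next
    case (right b1 c1 c2)
    then show ?thesis
      using c rels_intros(2)[of "c1 \<otimes> c" "c2 \<otimes> c" "b1 * b"]
        rels_intros(2)[of "c \<otimes> c1" "c \<otimes> c2" "b * b1"]
      by (simp add: FP_mult_linear A.l_distr A.r_distr)
  next
    case (scalar r b1 c1)
    then show ?thesis
      using c rels_intros(3)[of r "c1 \<otimes> c" "b1 * b"] rels_intros(3)[of r "c \<otimes> c1" "b * b1"]
      by (simp add: FP_mult_linear mult_smult_left mult_smult_right mult.assoc mult.left_commute[of b r])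
  qed
  then show "u \<otimes>\<^bsub>FP\<^esub> frag_of (b, c) \<in> rels" "frag_of (b, c) \<otimes>\<^bsub>FP\<^esub> u \<in> rels" by auto
qed

text \<open>The kernel is generated as a group, and differences alone reach everything.\<close>

lemma ker_induct [consumes 1, case_names rel diff zero]:
  assumes "u \<in> ker" and rel: "\<And>u. u \<in> rels \<Longrightarrow> P u"
    and diff: "\<And>u v. u \<in> ker \<Longrightarrow> v \<in> ker \<Longrightarrow> P u \<Longrightarrow> P v \<Longrightarrow> P (u - v)"
    and zero: "P 0"
  shows "P u"
proof -
  have "u \<in> generate FG rels" using assms(1) by (simp add: tensor_kernel_def)
  then have "u \<in> ker \<and> P u"
  proof (induction rule: generate.induct)
    case one
    then show ?case using zero ker_props(2) by simp
  next
    case (incl h)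
    then show ?case using rel rels_in_ker by blast
  next
    case (inv h)
    have "inv\<^bsub>FG\<^esub> h = 0 - h" using subsetD[OF rels_in_carrier inv] by simp
    moreover have "0 - h \<in> ker" using ker_props(5)[OF ker_props(2) rels_in_ker[OF inv]] .
    moreover have "P (0 - h)" using diff[OF ker_props(2) rels_in_ker[OF inv] zero rel[OF inv]] .
    ultimately show ?case by simp
  next
    case (eng h1 h2)
    have h2: "0 - h2 \<in> ker" "P (0 - h2)"
      using eng ker_props(5)[OF ker_props(2)] diff[OF ker_props(2) _ zero] by blast+
    then have "h1 - (0 - h2) \<in> ker" "P (h1 - (0 - h2))"
      using eng ker_props(5) diff by blast+
    then show ?case by simp
  qed
  then show ?thesis by simp
qed

lemma ker_mult:
  assumes u: "u \<in> ker" and "Poly_Mapping.keys v \<subseteq> UNIV \<times> carrier A"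
  shows "v \<otimes>\<^bsub>FP\<^esub> u \<in> ker \<and> u \<otimes>\<^bsub>FP\<^esub> v \<in> ker"
  using assms(2)
proof (induction v rule: FP_induct)
  case zero
  show ?case by (simp add: FP_mult_linear(5,6) ker_props(2))
next
  case (diff v w)
  then show ?case by (simp add: FP_mult_linear(2,4) ker_props(5))
next
  case (frag b c)
  from u show ?case
  proof (induction u rule: ker_induct)
    case (rel u)
    then show ?case using rels_mult[OF rel frag] rels_in_ker by blast
  next
    case (diff u v)
    then show ?case by (simp add: FP_mult_linear(2,4) ker_props(5))
  next
    case zero
    show ?case by (simp add: FP_mult_linear(5,6) ker_props(2))
  qed
qed

lemma ideal_ker: "ideal ker FP"
proof (rule idealI)
  show "Ring.ring FP" by (rule ring_FP)
  have "add_monoid FP = FG"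
    by (simp add: free_pair_ring_def free_Abelian_group_def)
  then show "subgroup ker (add_monoid FP)" using subgroup_ker by simp
qed (use ker_mult in simp_all)

abbreviation "KA \<equiv> scalar_ext D A"
abbreviation pt :: "'k \<Rightarrow> 'a \<Rightarrow> ('k \<times> 'a \<Rightarrow>\<^sub>0 int) set" where
  "pt k a \<equiv> pure_tensor (ring_of D) (ring_of UNIV) A k a"

lemma ring_KA: "Ring.ring KA"
  unfolding scalar_ext_def tensor_algebra_def by (rule ideal.quotient_is_ring[OF ideal_ker])

lemma coset_hom: "(\<lambda>u. ker +>\<^bsub>FP\<^esub> u) \<in> Ring.ring_hom FP KA"
  unfolding scalar_ext_def tensor_algebra_def by (rule ideal.rcos_ring_hom[OF ideal_ker])

lemma pt_closed [simp]: "a \<in> carrier A \<Longrightarrow> pt k a \<in> carrier KA"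
  unfolding pure_tensor_def by (rule ring_hom_closed[OF coset_hom]) simp

lemma pt_mult:
  assumes "a \<in> carrier A" "b \<in> carrier A"
  shows "pt k a \<otimes>\<^bsub>KA\<^esub> pt l b = pt (k * l) (a \<otimes> b)"
  using ring_hom_mult[OF coset_hom, of "frag_of (k, a)" "frag_of (l, b)"] assms
  unfolding pure_tensor_def by simp

lemma coset_eq_iff:
  assumes "Poly_Mapping.keys u \<subseteq> UNIV \<times> carrier A" "Poly_Mapping.keys v \<subseteq> UNIV \<times> carrier A"
  shows "ker +>\<^bsub>FP\<^esub> u = ker +>\<^bsub>FP\<^esub> v \<longleftrightarrow> u - v \<in> ker"
proof
  interpret ideal ker FP by (rule ideal_ker)
  {
    assume "ker +>\<^bsub>FP\<^esub> u = ker +>\<^bsub>FP\<^esub> v"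
    then have "u \<in> ker +>\<^bsub>FP\<^esub> v" using a_rcos_self[of u] assms by auto
    then show "u - v \<in> ker" by (auto simp: a_r_coset_def r_coset_def)
  next
    assume "u - v \<in> ker"
    then have "u \<in> ker +>\<^bsub>FP\<^esub> v"
      by (auto simp: a_r_coset_def r_coset_def intro!: bexI[of _ "u - v"])
    then show "ker +>\<^bsub>FP\<^esub> u = ker +>\<^bsub>FP\<^esub> v"
      using a_repr_independence[of u ker v] assms a_subgroup by auto
  }
qed

lemma coset_add:
  assumes "Poly_Mapping.keys u \<subseteq> UNIV \<times> carrier A" "Poly_Mapping.keys v \<subseteq> UNIV \<times> carrier A"
  shows "(ker +>\<^bsub>FP\<^esub> u) \<oplus>\<^bsub>KA\<^esub> (ker +>\<^bsub>FP\<^esub> v) = ker +>\<^bsub>FP\<^esub> (u + v)"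
  using ring_hom_add[OF coset_hom, of u v] assms by simp

lemma pt_add_right:
  assumes "a \<in> carrier A" "b \<in> carrier A"
  shows "pt k (a \<oplus> b) = pt k a \<oplus>\<^bsub>KA\<^esub> pt k b"
proof -
  have "frag_of (k, a \<oplus> b) - frag_of (k, a) - frag_of (k, b) \<in> rels"
    using assms by (intro rels_intros)
  then have "frag_of (k, a \<oplus> b) - (frag_of (k, a) + frag_of (k, b)) \<in> ker"
    by (simp add: rels_in_ker diff_diff_eq)
  moreover have "Poly_Mapping.keys (frag_of (k, a) + frag_of (k, b)) \<subseteq> UNIV \<times> carrier A"
    using assms by (auto dest!: subsetD[OF keys_add])
  ultimately show ?thesis
    using assms unfolding pure_tensor_def by (simp add: coset_add coset_eq_iff)
qed

text \<open>This moves a common denominator to the left factor: \<open>k \<otimes> a = (1/d) \<otimes> (dk)a\<close> if \<open>dk \<in> D\<close>.\<close>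

lemma pt_balanced:
  assumes "r \<in> D" "a \<in> carrier A"
  shows "pt (r * k) a = pt k (r \<odot> a)"
proof -
  have "frag_of (r * k, a) - frag_of (k, r \<odot> a) \<in> rels"
    using assms by (intro rels_intros)
  then show ?thesis
    using assms unfolding pure_tensor_def by (simp add: coset_eq_iff rels_in_ker)
qed

lemma pt_zero: "pt k \<zero> = \<zero>\<^bsub>KA\<^esub>"
proof -
  interpret KA: Ring.ring KA by (rule ring_KA)
  show ?thesis using pt_add_right[of \<zero> \<zero> k] by (metis KA.add.r_cancel_one' M.l_zero M.zero_closed pt_closed)
qed

lemma pt_finsum:
  assumes "finite I" "f \<in> I \<rightarrow> carrier A"
  shows "pt k (\<Oplus>i\<in>I. f i) = (\<Oplus>\<^bsub>KA\<^esub>i\<in>I. pt k (f i))"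
proof -
  interpret KA: Ring.ring KA by (rule ring_KA)
  show ?thesis using assms
    by (induction I rule: finite_induct) (auto simp: pt_zero pt_add_right Pi_def intro!: M.finsum_closed)
qed

lemma pt_pow: "a \<in> carrier A \<Longrightarrow> pt 1 a [^]\<^bsub>KA\<^esub> (i::nat) = pt 1 (a [^] i)"
proof (induction i)
  case 0
  have "\<one>\<^bsub>KA\<^esub> = pt 1 \<one>"
    using ring_hom_one[OF coset_hom] by (simp add: pure_tensor_def)
  then show ?case by (simp add: nat_pow_def)
next
  case (Suc i)
  interpret KA: Ring.ring KA by (rule ring_KA)
  show ?case using Suc by (simp add: pt_mult)
qed

lemma eval_ext_eq_pt:
  assumes a: "a \<in> carrier A" and d: "d \<noteq> 0" and over: "poly_over D (Polynomial.smult d f)"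
  shows "eval_ext D A f (emb_A D A a) = pt (1 / d) (ev (Polynomial.smult d f) a)"
proof -
  interpret KA: Ring.ring KA by (rule ring_KA)
  have "emb_K D A (Polynomial.coeff f i) \<otimes>\<^bsub>KA\<^esub> emb_A D A a [^]\<^bsub>KA\<^esub> i
      = pt (1 / d) (Polynomial.coeff (Polynomial.smult d f) i \<odot> (a [^] i))" for i
  proof -
    have "d * Polynomial.coeff f i \<in> D" using over by (simp add: poly_over_def)
    then have "pt (d * Polynomial.coeff f i * (1 / d)) (a [^] i) = pt (1 / d) ((d * Polynomial.coeff f i) \<odot> (a [^] i))"
      using a by (intro pt_balanced) auto
    then show ?thesis
      using a d by (simp add: emb_K_def emb_A_def pt_pow pt_mult)
  qed
  then have "eval_ext D A f (emb_A D A a)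
      = (\<Oplus>\<^bsub>KA\<^esub>i\<in>{..Polynomial.degree f}. pt (1 / d) (Polynomial.coeff (Polynomial.smult d f) i \<odot> (a [^] i)))"
    unfolding eval_ext_def by simp
  also have "\<dots> = pt (1 / d) (\<Oplus>i\<in>{..Polynomial.degree f}. Polynomial.coeff (Polynomial.smult d f) i \<odot> (a [^] i))"
    by (rule pt_finsum[symmetric]) (use ev_term_closed[OF over a] in auto)
  also have "(\<Oplus>i\<in>{..Polynomial.degree f}. Polynomial.coeff (Polynomial.smult d f) i \<odot> (a [^] i)) = ev (Polynomial.smult d f) a"
    using d by (simp add: ev_def)
  finally show ?thesis .
qed

end

section \<open>Integer-valued polynomials in terms of the algebra alone\<close>

locale torsion_free_algebra_over = algebra_over D A
  for D :: "'k::field set" and A :: "('k, 'a) module" (structure) +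
  assumes torsion_free: "torsion_free (ring_of D) A"
    and frac_field: "frac_field D = UNIV"
begin

lemma smult_eq_zero: "c \<in> D \<Longrightarrow> x \<in> carrier A \<Longrightarrow> c \<noteq> 0 \<Longrightarrow> c \<odot> x = \<zero> \<Longrightarrow> x = \<zero>"
  using torsion_free unfolding torsion_free_def by auto

lemma smult_cancel:
  assumes "c \<in> D" "c \<noteq> 0" "x \<in> carrier A" "y \<in> carrier A" "c \<odot> x = c \<odot> y"
  shows "x = y"
proof -
  have "c \<odot> (x \<ominus> y) = \<zero>" using assms by (simp add: smult_diff_right)
  then have "x \<ominus> y = \<zero>" using assms smult_eq_zero[of c "x \<ominus> y"] by simp
  then show ?thesis using assms by simp
qed

lemma common_denom:
  assumes "finite W"
  obtains d where "d \<in> D" "d \<noteq> 0" "\<And>x. x \<in> W \<Longrightarrow> d * x \<in> D"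
proof -
  have "\<exists>d\<in>D. d \<noteq> 0 \<and> (\<forall>x\<in>W. d * x \<in> D)"
    using assms
  proof (induction W rule: finite_induct)
    case empty
    then show ?case using D.one_mem by (intro bexI[of _ 1]) auto
  next
    case (insert x W)
    then obtain d where d: "d \<in> D" "d \<noteq> 0" "\<forall>x\<in>W. d * x \<in> D" by auto
    have "x \<in> frac_field D" using frac_field by simp
    then obtain a b where x: "x = a / b" "a \<in> D" "b \<in> D" "b \<noteq> 0" by (auto simp: frac_field_def)
    have "d * b * y \<in> D" if "y \<in> insert x W" for y
    proof (cases "y = x")
      case True
      then have "d * b * y = d * a" using x by simp
      then show ?thesis using D.mult_mem[OF d(1) x(2)] by metis
    next
      case False
      then have "b * (d * y) \<in> D" using that d x by (auto intro: D.mult_mem)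
      moreover have "d * b * y = b * (d * y)" by simp
      ultimately show ?thesis by metis
    qed
    then show ?case using d x by (intro bexI[of _ "d * b"]) (auto intro: D.mult_mem)
  qed
  then show ?thesis using that by blast
qed

lemma poly_common_denom:
  obtains d where "d \<in> D" "d \<noteq> 0" "poly_over D (Polynomial.smult d f)"
proof -
  obtain d where d: "d \<in> D" "d \<noteq> 0"
    and m: "\<And>x. x \<in> Polynomial.coeff f ` {..Polynomial.degree f} \<Longrightarrow> d * x \<in> D"
    using common_denom[of "Polynomial.coeff f ` {..Polynomial.degree f}"] by auto
  have "d * Polynomial.coeff f i \<in> D" for i
    using m by (cases "i \<le> Polynomial.degree f") (auto simp: coeff_eq_0)
  then show ?thesis using that d by (auto simp: poly_over_def)
qed

text \<open>This replaces the map from \<open>K \<otimes>\<^sub>D A\<close> to a localization of \<open>A\<close>. An element of the kernel involves finitely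
  many scalars of \<open>K\<close>. After multiplication by a common denominator \<open>e\<close>, or by any multiple of \<open>e\<close>, they
  lie in \<open>D\<close>, and then \<open>k \<otimes> a \<mapsto> (ek)a\<close> respects the bilinearity relations. The homomorphism \<open>h s\<close> is this map with
  scaling factor \<open>s\<close>, set to \<open>0\<close> where \<open>sk\<close> is not in \<open>D\<close>. The quantifier over multiples of \<open>e\<close> lets the
  denominators of two elements be combined.\<close>

lemma ker_denom:
  assumes "u \<in> ker"
    and hom: "\<And>s. h s \<in> hom FG (add_monoid A)"
    and h: "\<And>s k a. a \<in> carrier A \<Longrightarrow> h s (frag_of (k, a)) = (if s * k \<in> D then (s * k) \<odot> a else \<zero>)"
  shows "\<exists>e\<in>D. e \<noteq> 0 \<and> (\<forall>m\<in>D. h (m * e) u = \<zero>)"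
proof -
  have group_hom: "group_hom FG (add_monoid A) (h s)" for s
    using hom[of s] M.a_group unfolding group_hom_def group_hom_axioms_def by simp
  have h_diff: "h s (u - v) = h s u \<ominus> h s v"
    if "Poly_Mapping.keys u \<subseteq> UNIV \<times> carrier A" "Poly_Mapping.keys v \<subseteq> UNIV \<times> carrier A" for s u v
  proof -
    interpret group_hom FG "add_monoid A" "h s" by (rule group_hom)
    have "h s (u + - v) = h s u \<oplus> h s (- v)" using that hom_mult[of u "- v"] by simp
    also have "h s (- v) = \<ominus> h s v" using that hom_inv[of v] by (simp add: a_inv_def)
    finally show ?thesis by (simp add: M.minus_eq)
  qed
  have h_zero: "h s 0 = \<zero>" for s
    using group_hom.hom_one[OF group_hom, of s] by simp
  have D2: "x * y \<in> D" if "x \<in> D" "y \<in> D" for x y using that by (rule D.mult_mem)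
  show ?thesis
    using assms(1)
  proof (induction rule: ker_induct)
    case (rel u)
    then show ?case
    proof (cases rule: rels_cases)
      case (left b b' c)
      obtain e where e: "e \<in> D" "e \<noteq> 0" "\<And>x. x \<in> {b, b'} \<Longrightarrow> e * x \<in> D"
        using common_denom[of "{b, b'}"] by auto
      have "h (m * e) u = \<zero>" if m: "m \<in> D" for m
      proof -
        have "m * (e * b) \<in> D" "m * (e * b') \<in> D" using m e by (simp_all add: D2)
        then have *: "m * e * b \<in> D" "m * e * b' \<in> D" by (simp_all add: mult.assoc)
        then have "m * e * (b + b') = m * e * b + m * e * b'" "m * e * b + m * e * b' \<in> D"
          by (auto simp: ring_distribs intro: D.add_mem)
        then show ?thesis
          using left(1) * by (simp add: left(2) h_diff keys_diff_subset h smult_add_left A.add_diff_diff_eq_zero)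
      qed
      then show ?thesis using e by auto
    next
      case (right b c c')
      obtain e where e: "e \<in> D" "e \<noteq> 0" "e * b \<in> D"
        using common_denom[of "{b}"] by auto
      have "h (m * e) u = \<zero>" if m: "m \<in> D" for m
      proof -
        have "m * (e * b) \<in> D" using m e by (simp add: D2)
        then have *: "m * e * b \<in> D" by (simp_all add: mult.assoc)
        then show ?thesis
          using right(1,2) by (simp add: right(3) h_diff keys_diff_subset h smult_add_right A.add_diff_diff_eq_zero)
      qed
      then show ?thesis using e by auto
    next
      case (scalar r b c)
      obtain e where e: "e \<in> D" "e \<noteq> 0" "e * b \<in> D"
        using common_denom[of "{b}"] by auto
      have "h (m * e) u = \<zero>" if m: "m \<in> D" for m
      proof -
        have "m * (e * b) \<in> D" "r * (m * (e * b)) \<in> D" using m e scalar by (simp_all add: D2)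
        then have *: "m * e * b \<in> D" "m * e * (r * b) \<in> D" by (simp_all add: mult_ac)
        have "m * e * b * r = m * e * (r * b)" by simp
        then have "m * e * (r * b) \<odot> c = m * e * b \<odot> (r \<odot> c)"
          using smult_smult[OF *(1) scalar(1,2)] by metis
        then show ?thesis
          using scalar(1,2) * by (simp add: scalar(3) h_diff h)
      qed
      then show ?thesis using e by auto
    qed
  next
    case (diff u v)
    then obtain e f where e: "e \<in> D" "e \<noteq> 0" "\<And>m. m \<in> D \<Longrightarrow> h (m * e) u = \<zero>"
      and f: "f \<in> D" "f \<noteq> 0" "\<And>m. m \<in> D \<Longrightarrow> h (m * f) v = \<zero>" by blast
    have "h (m * (e * f)) (u - v) = \<zero>" if m: "m \<in> D" for m
    proof -
      have "h (m * f * e) u = \<zero>" "h (m * e * f) v = \<zero>" using e f m D2 by auto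
      then show ?thesis using diff(1,2) ker_props(1) by (subst h_diff) (auto simp: mult_ac)
    qed
    then show ?case using e f D2 by (intro bexI[of _ "e * f"]) auto
  next
    case zero
    then show ?case using h_zero by (intro bexI[of _ 1]) auto
  qed
qed

text \<open>In particular \<open>a \<mapsto> 1 \<otimes> a\<close> is injective. Torsion-freeness is what allows
  cancelling the common denominator.\<close>

lemma pt_in_A_iff:
  assumes x: "x \<in> carrier A" and b: "b \<in> carrier A" and d: "d \<in> D" "d \<noteq> 0"
  shows "pt (1 / d) x = pt 1 b \<longleftrightarrow> x = d \<odot> b"
proof
  assume "x = d \<odot> b"
  then show "pt (1 / d) x = pt 1 b"
    using pt_balanced[of d b "1 / d"] b d by simp
next
  assume "pt (1 / d) x = pt 1 b"
  then have u: "frag_of (1 / d, x) - frag_of (1, b) \<in> ker"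
    using x b unfolding pure_tensor_def by (simp add: coset_eq_iff)
  define g where "g s p = (if s * fst p \<in> D then (s * fst p) \<odot> snd p else \<zero>)" for s :: 'k and p :: "'k \<times> 'a"
  have "\<exists>h. h \<in> hom FG (add_monoid A) \<and> (\<forall>p\<in>UNIV \<times> carrier A. h (frag_of p) = g s p)" for s
  proof -
    have "g s ` (UNIV \<times> carrier A) \<subseteq> carrier (add_monoid A)" by (auto simp: g_def)
    then obtain h where "h \<in> hom FG (add_monoid A)" "\<And>p. p \<in> UNIV \<times> carrier A \<Longrightarrow> h (frag_of p) = g s p"
      using comm_group.free_Abelian_group_universal[OF M.a_comm_group] by metis
    then show ?thesis by blast
  qed
  then obtain h where hom: "\<And>s. h s \<in> hom FG (add_monoid A)"
    and h: "\<And>s p. p \<in> UNIV \<times> carrier A \<Longrightarrow> h s (frag_of p) = g s p" by metis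
  \<comment> \<open>The multiple \<open>m = d\<close> makes both scalars \<open>de/d\<close> and \<open>de\<close> lie in \<open>D\<close>.\<close>
  obtain e where e: "e \<in> D" "e \<noteq> 0" "\<And>m. m \<in> D \<Longrightarrow> h (m * e) (frag_of (1 / d, x) - frag_of (1, b)) = \<zero>"
  proof -
    have "h s (frag_of (k, a)) = (if s * k \<in> D then (s * k) \<odot> a else \<zero>)" if "a \<in> carrier A" for s k a
      using h[of "(k, a)" s] that by (simp add: g_def)
    from ker_denom[OF u hom this] show ?thesis using that by blast
  qed
  interpret group_hom FG "add_monoid A" "h (d * e)"
    using hom M.a_group unfolding group_hom_def group_hom_axioms_def by simp
  have "h (d * e) (frag_of (1 / d, x) + - frag_of (1, b)) = h (d * e) (frag_of (1 / d, x)) \<oplus> h (d * e) (- frag_of (1, b))"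
    using x b hom_mult[of "frag_of (1 / d, x)" "- frag_of (1, b)"] by simp
  also have "h (d * e) (- frag_of (1, b)) = \<ominus> h (d * e) (frag_of (1, b))"
    using b hom_inv[of "frag_of (1, b)"] by (simp add: a_inv_def)
  finally have "h (d * e) (frag_of (1 / d, x)) \<oplus> \<ominus> h (d * e) (frag_of (1, b)) = \<zero>"
    using e(3)[OF d(1)] by simp
  then have "e \<odot> x \<ominus> (e * d) \<odot> b = \<zero>"
    using h[of "(1 / d, x)" "d * e"] h[of "(1, b)" "d * e"] x b d e D.mult_mem[OF d(1) e(1)]
    by (simp add: g_def M.minus_eq mult.commute[of e d])
  then have "e \<odot> x = e \<odot> (d \<odot> b)"
    using x b d e D.mult_mem[OF e(1) d(1)] by (simp add: smult_smult)
  then show "x = d \<odot> b" using smult_cancel[OF e(1,2)] x b d by simp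
qed

theorem Int_K_iff:
  assumes d: "d \<in> D" "d \<noteq> 0" and over: "poly_over D (Polynomial.smult d f)"
  shows "f \<in> Int_K D A \<longleftrightarrow> (\<forall>a\<in>carrier A. \<exists>b\<in>carrier A. ev (Polynomial.smult d f) a = d \<odot> b)"
proof -
  have "eval_ext D A f (emb_A D A a) \<in> emb_A D A ` carrier A \<longleftrightarrow>
      (\<exists>b\<in>carrier A. ev (Polynomial.smult d f) a = d \<odot> b)" if a: "a \<in> carrier A" for a
  proof -
    have "pt (1 / d) (ev (Polynomial.smult d f) a) = emb_A D A b \<longleftrightarrow> ev (Polynomial.smult d f) a = d \<odot> b"
      if "b \<in> carrier A" for b
      unfolding emb_A_def by (rule pt_in_A_iff[OF ev_closed[OF over a] that d])
    then show ?thesis unfolding image_iff eval_ext_eq_pt[OF a d(2) over] by metis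
  qed
  then show ?thesis unfolding Int_K_def by simp
qed

end

section \<open>The determinant trick\<close>

lemma (in unital_subring) signof_mem: "signof p \<in> S"
  by (cases p rule: sign_cases) (auto simp: sign_def uminus_mem)

lemma (in unital_subring) det_mem:
  assumes "A \<in> carrier_mat n n" "\<And>i j. i < n \<Longrightarrow> j < n \<Longrightarrow> A $$ (i, j) \<in> S"
  shows "det A \<in> S"
  unfolding det_def'[OF assms(1)]
proof (intro sum_mem mult_mem prod_mem)
  fix p i assume "p \<in> {p. p permutes {0..<n}}" "i \<in> {0..<n}"
  then have "p i < n" by (auto dest: permutes_in_image)
  then show "A $$ (i, p i) \<in> S" using assms(2) \<open>i \<in> {0..<n}\<close> by auto
qed (rule signof_mem)

lemma (in unital_subring) adj_mat_mem:
  assumes "A \<in> carrier_mat n n" "\<And>i j. i < n \<Longrightarrow> j < n \<Longrightarrow> A $$ (i, j) \<in> S" "i < n" "j < n"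
  shows "adj_mat A $$ (i, j) \<in> S"
proof -
  have "det (mat_delete A j i) \<in> S"
  proof (rule det_mem[of _ "n - 1"])
    show "mat_delete A j i \<in> carrier_mat (n - 1) (n - 1)"
      using assms(1) by (rule mat_delete_carrier)
    show "mat_delete A j i $$ (k, l) \<in> S" if "k < n - 1" "l < n - 1" for k l
      using assms that unfolding mat_delete_def by auto
  qed
  then show ?thesis
    using assms by (auto simp: adj_mat_def cofactor_def intro!: mult_mem power_mem uminus_mem)
qed

lemma (in unital_subring) unital_subring_poly_over: "unital_subring {p. poly_over S p}"
  by unfold_locales (auto intro: poly_over_add poly_over_mult poly_over_uminus)

lemma char_poly_matrix_index:
  assumes "T \<in> carrier_mat n n" "i < n" "j < n"
  shows "char_poly_matrix T $$ (i, j) = (if i = j then [:0, 1:] else 0) - [:T $$ (i, j):]"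
  using assms by (auto simp: char_poly_matrix_def)

lemma (in unital_subring) char_poly_matrix_over:
  assumes "T \<in> carrier_mat n n" "\<And>i j. i < n \<Longrightarrow> j < n \<Longrightarrow> T $$ (i, j) \<in> S" "i < n" "j < n"
  shows "poly_over S (char_poly_matrix T $$ (i, j))"
  using assms by (auto simp: char_poly_matrix_index uminus_mem intro!: poly_over_diff)

lemma (in unital_subring) char_poly_over:
  assumes "T \<in> carrier_mat n n" "\<And>i j. i < n \<Longrightarrow> j < n \<Longrightarrow> T $$ (i, j) \<in> S"
  shows "poly_over S (char_poly T)"
  using unital_subring.det_mem[OF unital_subring_poly_over, of "char_poly_matrix T" n]
    char_poly_matrix_over[of T n] assms by (auto simp: char_poly_def)

lemma (in unital_subring) adj_char_poly_matrix_over: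
  assumes "T \<in> carrier_mat n n" "\<And>i j. i < n \<Longrightarrow> j < n \<Longrightarrow> T $$ (i, j) \<in> S" "i < n" "j < n"
  shows "poly_over S (adj_mat (char_poly_matrix T) $$ (i, j))"
  using unital_subring.adj_mat_mem[OF unital_subring_poly_over, of "char_poly_matrix T" n i j]
    char_poly_matrix_over[of T n] assms by auto

context algebra_over
begin

lemma ev_sum:
  assumes "finite I" "\<And>i. i \<in> I \<Longrightarrow> poly_over D (f i)" "a \<in> carrier A"
  shows "ev (sum f I) a = (\<Oplus>i\<in>I. ev (f i) a)"
  using assms
  by (induction I rule: finite_induct) (simp_all add: ev_add D.poly_over_sum Pi_def)

lemma finsum_mem_subgroup:
  assumes "finite I" "\<And>i. i \<in> I \<Longrightarrow> f i \<in> L" "L \<subseteq> carrier A" "\<zero> \<in> L"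
    "\<And>x y. x \<in> L \<Longrightarrow> y \<in> L \<Longrightarrow> x \<oplus> y \<in> L"
  shows "(\<Oplus>i\<in>I. f i) \<in> L"
  using assms(1,2)
proof (induction I rule: finite_induct)
  case (insert x I)
  then show ?case using assms(3,5) by (subst M.finsum_insert) (auto simp: Pi_def)
qed (use assms in simp)

text \<open>The Cayley-Hamilton argument: the matrix \<open>xI - T\<close> over \<open>D[x]\<close>, evaluated at \<open>a\<close>, kills the column of the
  \<open>v i\<close> modulo \<open>L\<close>; multiply by its adjugate. Only polynomials in the single element \<open>a\<close> occur as
  matrix entries, so that the noncommutativity of \<open>A\<close> does no harm.\<close>

lemma determinant_trick:
  assumes a: "a \<in> carrier A" and v: "\<And>i. i < N \<Longrightarrow> v i \<in> carrier A"
    and T: "T \<in> carrier_mat N N" "\<And>i j. i < N \<Longrightarrow> j < N \<Longrightarrow> T $$ (i, j) \<in> D"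
    and L: "L \<subseteq> carrier A" "\<zero> \<in> L" "\<And>x y. x \<in> L \<Longrightarrow> y \<in> L \<Longrightarrow> x \<oplus> y \<in> L"
      "\<And>x y. x \<in> carrier A \<Longrightarrow> y \<in> L \<Longrightarrow> x \<otimes> y \<in> L"
    and rel: "\<And>j. j < N \<Longrightarrow> a \<otimes> v j \<ominus> (\<Oplus>l\<in>{..<N}. T $$ (j, l) \<odot> v l) \<in> L"
    and i: "i < N"
  shows "ev (char_poly T) a \<otimes> v i \<in> L"
proof -
  define Y where "Y = char_poly_matrix T"
  define B where "B = adj_mat Y"
  have Y: "Y \<in> carrier_mat N N" using T by (simp add: Y_def)
  have Yo: "poly_over D (Y $$ (j, l))" if "j < N" "l < N" for j l
    using D.char_poly_matrix_over[of T N] T that by (simp add: Y_def)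
  have Bo: "poly_over D (B $$ (j, l))" if "j < N" "l < N" for j l
    using D.adj_char_poly_matrix_over[of T N] T that by (simp add: B_def Y_def)
  have B: "B \<in> carrier_mat N N" "B * Y = char_poly T \<cdot>\<^sub>m 1\<^sub>m N"
    using adj_mat[OF Y] by (simp_all add: B_def char_poly_def Y_def)
  have evY: "ev (Y $$ (j, l)) a = (if l = j then a else \<zero>) \<ominus> T $$ (j, l) \<odot> \<one>" if "j < N" "l < N" for j l
    using that T a by (simp add: Y_def char_poly_matrix_index ev_diff ev_const)
  have vc: "v \<in> {..<N} \<rightarrow> carrier A" using v by auto
  \<comment> \<open>The matrix \<open>Y = xI - T\<close>, evaluated at \<open>a\<close>, kills the column \<open>v\<close> modulo \<open>L\<close>.\<close>
  have rel': "(\<Oplus>l\<in>{..<N}. ev (Y $$ (j, l)) a \<otimes> v l) \<in> L" if j: "j < N" for j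
  proof -
    have "(\<Oplus>l\<in>{..<N}. ev (Y $$ (j, l)) a \<otimes> v l)
        = (\<Oplus>l\<in>{..<N}. (if j = l then a \<otimes> v l else \<zero>) \<ominus> T $$ (j, l) \<odot> v l)"
    proof (rule M.finsum_cong')
      fix l assume "l \<in> {..<N}"
      then have l: "l < N" by simp
      have "((if l = j then a else \<zero>) \<ominus> T $$ (j, l) \<odot> \<one>) \<otimes> v l
          = (if l = j then a else \<zero>) \<otimes> v l \<ominus> (T $$ (j, l) \<odot> \<one>) \<otimes> v l"
        using a v l j T by (simp add: M.minus_eq A.l_distr A.l_minus)
      then show "ev (Y $$ (j, l)) a \<otimes> v l = (if j = l then a \<otimes> v l else \<zero>) \<ominus> T $$ (j, l) \<odot> v l"
        using v l j T by (auto simp: evY mult_smult_left)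
    qed (use a v T j in auto)
    also have "\<dots> = (\<Oplus>l\<in>{..<N}. if j = l then a \<otimes> v l else \<zero>) \<ominus> (\<Oplus>l\<in>{..<N}. T $$ (j, l) \<odot> v l)"
      using a v T j by (intro finsum_minus) auto
    also have "(\<Oplus>l\<in>{..<N}. if j = l then a \<otimes> v l else \<zero>) = a \<otimes> v j"
      using j a v M.finsum_singleton[of j "{..<N}" "\<lambda>l. a \<otimes> v l"] by simp
    finally show ?thesis using rel[OF j] by simp
  qed
  have "ev (char_poly T) a \<otimes> v i = (\<Oplus>l\<in>{..<N}. if i = l then ev (char_poly T) a \<otimes> v l else \<zero>)"
    using i a v D.char_poly_over[OF T] M.finsum_singleton[of i "{..<N}" "\<lambda>l. ev (char_poly T) a \<otimes> v l"] by simp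
  also have "\<dots> = (\<Oplus>l\<in>{..<N}. ev ((B * Y) $$ (i, l)) a \<otimes> v l)"
    using i a v D.char_poly_over[OF T] by (intro M.finsum_cong') (auto simp: B(2))
  also have "\<dots> = (\<Oplus>l\<in>{..<N}. (\<Oplus>j\<in>{..<N}. ev (B $$ (i, j)) a \<otimes> (ev (Y $$ (j, l)) a \<otimes> v l)))"
  proof (rule M.finsum_cong')
    fix l assume "l \<in> {..<N}"
    then have l: "l < N" by simp
    have "(B * Y) $$ (i, l) = (\<Sum>j\<in>{..<N}. B $$ (i, j) * Y $$ (j, l))"
      using B(1) Y i l by (simp add: scalar_prod_def atLeast0LessThan)
    then have "ev ((B * Y) $$ (i, l)) a = (\<Oplus>j\<in>{..<N}. ev (B $$ (i, j) * Y $$ (j, l)) a)"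
      using Bo Yo i l a by (simp only:) (rule ev_sum, auto intro: D.poly_over_mult)
    also have "\<dots> = (\<Oplus>j\<in>{..<N}. ev (B $$ (i, j)) a \<otimes> ev (Y $$ (j, l)) a)"
      using Bo Yo i l a by (intro M.finsum_cong') (auto simp: ev_mult)
    also have "\<dots> \<otimes> v l = (\<Oplus>j\<in>{..<N}. ev (B $$ (i, j)) a \<otimes> ev (Y $$ (j, l)) a \<otimes> v l)"
      using Bo Yo i l a v by (intro A.finsum_ldistr) auto
    also have "\<dots> = (\<Oplus>j\<in>{..<N}. ev (B $$ (i, j)) a \<otimes> (ev (Y $$ (j, l)) a \<otimes> v l))"
      using Bo Yo i l a v by (intro M.finsum_cong') (auto simp: A.m_assoc)
    finally show "ev ((B * Y) $$ (i, l)) a \<otimes> v l = (\<Oplus>j\<in>{..<N}. ev (B $$ (i, j)) a \<otimes> (ev (Y $$ (j, l)) a \<otimes> v l))" .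
  qed (use Bo Yo i a v in \<open>auto intro!: M.finsum_closed\<close>)
  also have "\<dots> = (\<Oplus>j\<in>{..<N}. (\<Oplus>l\<in>{..<N}. ev (B $$ (i, j)) a \<otimes> (ev (Y $$ (j, l)) a \<otimes> v l)))"
    using Bo Yo i a v by (intro A.finsum_finsum_swap) auto
  also have "\<dots> = (\<Oplus>j\<in>{..<N}. ev (B $$ (i, j)) a \<otimes> (\<Oplus>l\<in>{..<N}. ev (Y $$ (j, l)) a \<otimes> v l))"
  proof (rule M.finsum_cong')
    fix j assume "j \<in> {..<N}"
    then show "(\<Oplus>l\<in>{..<N}. ev (B $$ (i, j)) a \<otimes> (ev (Y $$ (j, l)) a \<otimes> v l))
        = ev (B $$ (i, j)) a \<otimes> (\<Oplus>l\<in>{..<N}. ev (Y $$ (j, l)) a \<otimes> v l)"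
      using Bo Yo i a v by (intro A.finsum_rdistr[symmetric]) auto
  qed (use Bo Yo i a v in \<open>auto intro!: M.finsum_closed\<close>)
  also have "\<dots> \<in> L"
    using L Bo i a rel' by (intro finsum_mem_subgroup) auto
  finally show ?thesis .
qed

text \<open>Left multiplication by \<open>a\<close> on a finite generating set, with \<open>L = 0\<close>.\<close>

lemma monic_annihilator:
  assumes "fin_gen_module (ring_of D) A" and a: "a \<in> carrier A"
  obtains p where "poly_over D p" "Polynomial.lead_coeff p = 1" "ev p a = \<zero>"
proof -
  obtain S where S: "finite S" "S \<subseteq> carrier A"
    and gen: "\<And>x. x \<in> carrier A \<Longrightarrow> \<exists>r\<in>S \<rightarrow> D. x = (\<Oplus>s\<in>S. r s \<odot> s)"
    using assms(1) unfolding fin_gen_module_def by auto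
  obtain v where "bij_betw v {0..<card S} S"
    using ex_bij_betw_nat_finite[OF S(1)] ..
  moreover define N where "N = card S"
  ultimately have v: "bij_betw v {0..<N} S" by simp
  then have inj: "inj_on v {..<N}" and img: "v ` {..<N} = S"
    by (auto simp: bij_betw_def atLeast0LessThan)
  have vc: "v i \<in> carrier A" if "i < N" for i
    using that img S by auto
  have ex: "\<exists>r. (\<forall>i<N. r i \<in> D) \<and> x = (\<Oplus>l\<in>{..<N}. r l \<odot> v l)" if "x \<in> carrier A" for x
  proof -
    obtain r where r: "r \<in> S \<rightarrow> D" "x = (\<Oplus>s\<in>S. r s \<odot> s)" using gen[OF \<open>x \<in> carrier A\<close>] by blast
    have "r s \<odot> s \<in> carrier A" if "s \<in> v ` {..<N}" for s
      using that r(1) S img by (intro smult_closed') auto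
    then have "(\<Oplus>s\<in>v ` {..<N}. r s \<odot> s) = (\<Oplus>l\<in>{..<N}. r (v l) \<odot> v l)"
      using inj by (intro M.add.finprod_reindex) auto
    then show ?thesis
      using r img by (intro exI[of _ "\<lambda>l. r (v l)"]) auto
  qed
  have "\<exists>r. \<forall>j<N. (\<forall>i<N. r j i \<in> D) \<and> a \<otimes> v j = (\<Oplus>l\<in>{..<N}. r j l \<odot> v l)"
    using ex vc a by (intro choice allI) (metis A.m_closed)
  then obtain r where r: "\<And>j i. j < N \<Longrightarrow> i < N \<Longrightarrow> r j i \<in> D"
    "\<And>j. j < N \<Longrightarrow> a \<otimes> v j = (\<Oplus>l\<in>{..<N}. r j l \<odot> v l)" by blast
  define T where "T = mat N N (\<lambda>(j, l). r j l)"
  have T: "T \<in> carrier_mat N N" "\<And>i j. i < N \<Longrightarrow> j < N \<Longrightarrow> T $$ (i, j) \<in> D"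
    using r by (auto simp: T_def)
  have over: "poly_over D (char_poly T)" by (rule D.char_poly_over[OF T])
  have rel: "a \<otimes> v j \<ominus> (\<Oplus>l\<in>{..<N}. T $$ (j, l) \<odot> v l) \<in> {\<zero>}" if "j < N" for j
  proof -
    have "(\<Oplus>l\<in>{..<N}. T $$ (j, l) \<odot> v l) = (\<Oplus>l\<in>{..<N}. r j l \<odot> v l)"
      using that r vc by (intro M.finsum_cong') (auto simp: T_def)
    also have "\<dots> = a \<otimes> v j" using r(2)[OF that] by simp
    finally show ?thesis using a vc[OF that] by simp
  qed
  have kill: "ev (char_poly T) a \<otimes> v i = \<zero>" if "i < N" for i
    using determinant_trick[where L = "{\<zero>}" and N = N and v = v and T = T, OF a vc T _ _ _ _ rel that] by simp
  obtain c where c: "\<And>i. i < N \<Longrightarrow> c i \<in> D" "\<one> = (\<Oplus>l\<in>{..<N}. c l \<odot> v l)"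
    using ex[OF A.one_closed] by blast
  have "ev (char_poly T) a = ev (char_poly T) a \<otimes> (\<Oplus>l\<in>{..<N}. c l \<odot> v l)"
    using over a by (simp add: c(2)[symmetric])
  also have "\<dots> = (\<Oplus>l\<in>{..<N}. ev (char_poly T) a \<otimes> (c l \<odot> v l))"
    using c vc over a by (intro A.finsum_rdistr) auto
  also have "\<dots> = (\<Oplus>l\<in>{..<N}. \<zero>)"
    using c vc over a kill by (intro M.finsum_cong') (auto simp: mult_smult_right)
  also have "\<dots> = \<zero>" by simp
  finally have "ev (char_poly T) a = \<zero>" .
  then show ?thesis using that[OF over] degree_monic_char_poly[OF T(1)] by simp
qed

end

section \<open>Matrix algebras over a subring\<close>

context unital_subring
begin

lemma finsum_ring_of:
  assumes "finite I" "\<And>i. i \<in> I \<Longrightarrow> f i \<in> S"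
  shows "(\<Oplus>\<^bsub>ring_of S\<^esub>i\<in>I. f i) = sum f I"
proof -
  interpret R: cring "ring_of S" by (rule cring_ring_of)
  show ?thesis using assms
    by (induction I rule: finite_induct) (simp_all add: Pi_def)
qed

abbreviation "MS n \<equiv> mat_algebra n (ring_of S)"

lemma mat_algebra_carrier:
  "M \<in> carrier (MS n) \<longleftrightarrow> M \<in> carrier_mat n n \<and> (\<forall>i<n. \<forall>j<n. M $$ (i, j) \<in> S)"
  by (fastforce simp: mat_algebra_def)

lemma mat_algebra_mult:
  assumes "M \<in> carrier (MS n)" "N \<in> carrier (MS n)"
  shows "M \<otimes>\<^bsub>MS n\<^esub> N = M * N"
proof (rule eq_matI)
  fix i j assume "i < dim_row (M * N)" "j < dim_col (M * N)"
  then have ij: "i < n" "j < n" using assms by (auto simp: mat_algebra_carrier)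
  have "(M \<otimes>\<^bsub>MS n\<^esub> N) $$ (i, j) = (\<Oplus>\<^bsub>ring_of S\<^esub>k\<in>{..<n}. M $$ (i, k) * N $$ (k, j))"
    using ij by (simp add: mat_algebra_def)
  also have "\<dots> = (\<Sum>k\<in>{..<n}. M $$ (i, k) * N $$ (k, j))"
    using assms ij by (intro finsum_ring_of) (auto simp: mat_algebra_carrier intro!: mult_mem)
  finally show "(M \<otimes>\<^bsub>MS n\<^esub> N) $$ (i, j) = (M * N) $$ (i, j)"
    using assms ij by (auto simp: mat_algebra_carrier scalar_prod_def atLeast0LessThan)
qed (use assms in \<open>auto simp: mat_algebra_carrier\<close>, simp_all add: mat_algebra_def)

lemma mat_algebra_simps:
  assumes "M \<in> carrier (MS n)"
  shows "N \<in> carrier (MS n) \<Longrightarrow> M \<oplus>\<^bsub>MS n\<^esub> N = M + N" "c \<odot>\<^bsub>MS n\<^esub> M = c \<cdot>\<^sub>m M"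
  using assms by (auto simp: mat_algebra_carrier mat_algebra_def intro!: eq_matI)

lemma mat_algebra_consts: "\<one>\<^bsub>MS n\<^esub> = 1\<^sub>m n" "\<zero>\<^bsub>MS n\<^esub> = 0\<^sub>m n n"
  by (auto simp: mat_algebra_def intro!: eq_matI)

lemma mat_algebra_closed:
  assumes "M \<in> carrier (MS n)"
  shows "N \<in> carrier (MS n) \<Longrightarrow> M * N \<in> carrier (MS n)"
    "N \<in> carrier (MS n) \<Longrightarrow> M + N \<in> carrier (MS n)" "c \<in> S \<Longrightarrow> c \<cdot>\<^sub>m M \<in> carrier (MS n)"
    "- M \<in> carrier (MS n)"
  using assms
  by (auto simp: mat_algebra_carrier scalar_prod_def intro!: sum_mem mult_mem add_mem uminus_mem)

lemma mat_algebra_consts_closed: "1\<^sub>m n \<in> carrier (MS n)" "0\<^sub>m n n \<in> carrier (MS n)"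
  by (auto simp: mat_algebra_carrier)

lemma mat_algebra_carrier_mat: "M \<in> carrier (MS n) \<Longrightarrow> M \<in> carrier_mat n n"
  by (simp add: mat_algebra_carrier)

lemmas mat_algebra_rules =
  mat_algebra_mult mat_algebra_simps mat_algebra_consts mat_algebra_closed mat_algebra_consts_closed

lemma ring_mat_algebra: "Ring.ring (MS n)"
proof (rule ringI)
  show "abelian_group (MS n)"
  proof (rule abelian_groupI)
    fix M assume M: "M \<in> carrier (MS n)"
    then show "\<exists>N\<in>carrier (MS n). N \<oplus>\<^bsub>MS n\<^esub> M = \<zero>\<^bsub>MS n\<^esub>"
      by (intro bexI[of _ "- M"]) (auto simp: mat_algebra_rules dest: mat_algebra_carrier_mat)
  qed (auto simp: mat_algebra_rules comm_add_mat[OF mat_algebra_carrier_mat mat_algebra_carrier_mat]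
        assoc_add_mat[OF mat_algebra_carrier_mat mat_algebra_carrier_mat mat_algebra_carrier_mat] dest: mat_algebra_carrier_mat)
  show "Group.monoid (MS n)"
    by unfold_locales (auto simp: mat_algebra_rules assoc_mult_mat[OF mat_algebra_carrier_mat mat_algebra_carrier_mat mat_algebra_carrier_mat] dest: mat_algebra_carrier_mat)
qed (simp_all add: mat_algebra_rules add_mult_distrib_mat[OF mat_algebra_carrier_mat mat_algebra_carrier_mat mat_algebra_carrier_mat]
      mult_add_distrib_mat[OF mat_algebra_carrier_mat mat_algebra_carrier_mat mat_algebra_carrier_mat])

end

lemma (in unital_subring) assoc_algebra_mat: "assoc_algebra (ring_of S) (MS n)"
proof -
  interpret M: Ring.ring "MS n" by (rule ring_mat_algebra)
  have "module (ring_of S) (MS n)"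
  proof (rule moduleI)
    show "cring (ring_of S)" by (rule cring_ring_of)
    show "abelian_group (MS n)" by (rule M.is_abelian_group)
  qed (auto simp: mat_algebra_rules add_smult_distrib_right_mat[OF mat_algebra_carrier_mat]
        add_smult_distrib_left_mat[OF mat_algebra_carrier_mat mat_algebra_carrier_mat] add_mem mult_mem
        dest: mat_algebra_carrier_mat intro!: eq_matI)
  moreover have "Ring.ring (MS n)" by (rule M.ring_axioms)
  ultimately show ?thesis
    unfolding assoc_algebra_def assoc_algebra_axioms_def
    by (auto simp: mat_algebra_rules mult_smult_distrib[OF mat_algebra_carrier_mat mat_algebra_carrier_mat]
        mult_smult_assoc_mat[OF mat_algebra_carrier_mat mat_algebra_carrier_mat])
qed

context algebra_over
begin

lemma torsion_free_mat: "torsion_free (ring_of D) (mat_algebra n (ring_of D))"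
  unfolding torsion_free_def
proof (intro ballI impI)
  fix r M assume r: "r \<in> carrier (ring_of D)" and M: "M \<in> carrier (mat_algebra n (ring_of D))"
    and eq: "r \<odot>\<^bsub>mat_algebra n (ring_of D)\<^esub> M = \<zero>\<^bsub>mat_algebra n (ring_of D)\<^esub>"
  have "M = 0\<^sub>m n n" if "r \<noteq> 0"
  proof (rule eq_matI)
    fix i j assume ij: "i < dim_row (0\<^sub>m n n)" "j < dim_col (0\<^sub>m n n)"
    have "(r \<cdot>\<^sub>m M) $$ (i, j) = 0" using eq M ij by (simp add: D.mat_algebra_rules)
    then show "M $$ (i, j) = 0\<^sub>m n n $$ (i, j)" using that M ij by (auto simp: D.mat_algebra_carrier)
  qed (use M in \<open>auto simp: D.mat_algebra_carrier\<close>)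
  then show "r = \<zero>\<^bsub>ring_of D\<^esub> \<or> M = \<zero>\<^bsub>mat_algebra n (ring_of D)\<^esub>"
    by (auto simp: D.mat_algebra_consts)
qed

end

section \<open>Integer-valued polynomials on matrices\<close>

definition companion_mat :: "'k::comm_ring_1 poly \<Rightarrow> nat \<Rightarrow> 'k mat" where
  "companion_mat m n = mat n n (\<lambda>(i, j). if j = n - 1 then - Polynomial.coeff m i else if i = Suc j then 1 else 0)"

text \<open>The companion matrix is multiplication by \<open>x\<close> on \<open>K[x]/(m)\<close> in the basis of powers of \<open>x\<close>.\<close>

lemma companion_mat_mult_coeffs:
  fixes m f :: "'k::field poly"
  assumes m: "Polynomial.degree m = n" "Polynomial.lead_coeff m = 1" and n: "n \<ge> 1"
  shows "companion_mat m n *\<^sub>v vec n (Polynomial.coeff (f mod m)) = vec n (Polynomial.coeff (pCons 0 f mod m))"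
proof (rule eq_vecI)
  fix i assume "i < dim_vec (vec n (Polynomial.coeff (pCons 0 f mod m)))"
  then have i: "i < n" by simp
  define r where "r = f mod m"
  have "m \<noteq> 0" using m n by auto
  obtain n' where n': "n = Suc n'" using n by (cases n) auto
  have top: "Polynomial.coeff m n = 1" using m by simp
  have step: "pCons 0 f mod m = pCons 0 r - Polynomial.smult (Polynomial.coeff r (n - 1)) m"
    using mod_pCons[OF \<open>m \<noteq> 0\<close>, of 0 f] m n' by (simp add: r_def coeff_pCons)
  have "(companion_mat m n *\<^sub>v vec n (Polynomial.coeff r)) $ i
      = (\<Sum>j\<in>{0..<n}. (if j = n - 1 then - Polynomial.coeff m i else if i = Suc j then 1 else 0) * Polynomial.coeff r j)"
    using i by (simp add: companion_mat_def scalar_prod_def)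
  also have "{0..<n} = insert n' {0..<n'}" using n' by auto
  also have "(\<Sum>j\<in>insert n' {0..<n'}. (if j = n - 1 then - Polynomial.coeff m i else if i = Suc j then 1 else 0) * Polynomial.coeff r j)
      = - Polynomial.coeff m i * Polynomial.coeff r n' + (\<Sum>j\<in>{0..<n'}. (if i = Suc j then 1 else 0) * Polynomial.coeff r j)"
    by (subst sum.insert) (auto simp: n' intro!: sum.cong)
  also have "(\<Sum>j\<in>{0..<n'}. (if i = Suc j then 1 else 0) * Polynomial.coeff r j) = Polynomial.coeff (pCons 0 r) i"
  proof (cases i)
    case (Suc i')
    then have "(\<Sum>j\<in>{0..<n'}. (if i = Suc j then 1 else 0) * Polynomial.coeff r j)
        = (\<Sum>j\<in>{0..<n'}. if j = i' then Polynomial.coeff r j else 0)"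
      by (intro sum.cong) auto
    then show ?thesis using Suc i n' by (simp add: coeff_pCons)
  qed simp
  finally show "(companion_mat m n *\<^sub>v vec n (Polynomial.coeff (f mod m))) $ i
      = vec n (Polynomial.coeff (pCons 0 f mod m)) $ i"
    using i step n' by (simp add: r_def mult.commute)
qed (simp add: companion_mat_def)

context torsion_free_algebra_over
begin

text \<open>For the companion matrix \<open>C\<close> of an annihilator \<open>m\<close> of \<open>a\<close>, the first column of \<open>g(C)\<close> consists of the
  coefficients of \<open>g mod m\<close>. If \<open>g(C)\<close> is divisible by \<open>d\<close>, then so is \<open>g mod m\<close>, and \<open>g(a) = (g mod m)(a)\<close>.\<close>

theorem Int_K_mat_subset:
  assumes n: "n \<ge> 1"
    and ann: "\<And>a. a \<in> carrier A \<Longrightarrow>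
      \<exists>m. poly_over D m \<and> Polynomial.degree m = n \<and> Polynomial.lead_coeff m = 1 \<and> ev m a = \<zero>"
  shows "Int_K D (mat_algebra n (ring_of D)) \<subseteq> Int_K D A"
proof
  let ?M = "mat_algebra n (ring_of D)"
  interpret M: torsion_free_algebra_over D ?M
    unfolding torsion_free_algebra_over_def torsion_free_algebra_over_axioms_def algebra_over_def
    using D.assoc_algebra_mat torsion_free_mat frac_field by blast
  fix f assume f: "f \<in> Int_K D ?M"
  obtain d where d: "d \<in> D" "d \<noteq> 0" and over: "poly_over D (Polynomial.smult d f)"
    using poly_common_denom .
  define g where "g = Polynomial.smult d f"
  have g: "poly_over D g" using over by (simp add: g_def)
  show "f \<in> Int_K D A"
    unfolding Int_K_iff[OF d over]
  proof
    fix a assume a: "a \<in> carrier A"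
    obtain m where m: "poly_over D m" "Polynomial.degree m = n" "Polynomial.lead_coeff m = 1" "ev m a = \<zero>"
      using ann[OF a] by blast
    define C where "C = companion_mat m n"
    have C: "C \<in> carrier ?M"
      using m(1) by (auto simp: C_def companion_mat_def D.mat_algebra_carrier poly_over_def D.uminus_mem)
    have m0: "m \<noteq> 0" using m(3) by auto
    define e where "e = (vec n (Polynomial.coeff (1 mod m)) :: 'k vec)"
    have deg1: "1 mod m = (1 :: 'k poly)" using m n by (simp add: mod_poly_less)
    have col: "M.ev p C *\<^sub>v e = vec n (Polynomial.coeff (p mod m))" if "poly_over D p" for p
      using that
    proof (induction p)
      case 0
      have "0\<^sub>m n n *\<^sub>v e = 0\<^sub>v n" by (rule eq_vecI) (auto simp: e_def scalar_prod_def)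
      then show ?case using C by (auto simp: D.mat_algebra_consts)
    next
      case (pCons c p)
      then have cp: "c \<in> D" "poly_over D p" by auto
      define P where "P = M.ev p C"
      have P: "P \<in> carrier ?M" using cp C by (simp add: P_def)
      have carr: "c \<cdot>\<^sub>m 1\<^sub>m n \<in> carrier_mat n n" "C * P \<in> carrier_mat n n" "C \<in> carrier_mat n n" "P \<in> carrier_mat n n"
        "e \<in> carrier_vec n"
        using C P by (auto simp: D.mat_algebra_carrier e_def)
      have "M.ev (pCons c p) C = c \<cdot>\<^sub>m 1\<^sub>m n + C * P"
        using cp C P by (simp add: M.ev_pCons D.mat_algebra_rules P_def)
      then have "M.ev (pCons c p) C *\<^sub>v e = (c \<cdot>\<^sub>m 1\<^sub>m n) *\<^sub>v e + C *\<^sub>v (P *\<^sub>v e)"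
        using carr by (simp add: add_mult_distrib_mat_vec[of _ n n] assoc_mult_mat_vec[of C n n P n e])
      also have "P *\<^sub>v e = vec n (Polynomial.coeff (p mod m))" using pCons.IH cp by (simp add: P_def)
      also have "C *\<^sub>v \<dots> = vec n (Polynomial.coeff (pCons 0 p mod m))"
        unfolding C_def using m n by (intro companion_mat_mult_coeffs)
      also have "(c \<cdot>\<^sub>m 1\<^sub>m n) *\<^sub>v e = vec n (Polynomial.coeff ([:c:] mod m))"
      proof -
        have "[:c:] = Polynomial.smult c 1" by simp
        then have "[:c:] mod m = Polynomial.smult c (1 mod m)"
          by (simp only: mod_smult_left)
        moreover have "(c \<cdot>\<^sub>m 1\<^sub>m n) *\<^sub>v e = c \<cdot>\<^sub>v e"
        proof (rule eq_vecI)
          fix i assume "i < dim_vec (c \<cdot>\<^sub>v e)"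
          then have i: "i < n" by (simp add: e_def)
          have "(\<Sum>k\<in>{0..<n}. c * (if k = i then 1 else 0) * e $ k) = (\<Sum>k\<in>{0..<n}. if k = i then c * e $ k else 0)"
            by (intro sum.cong) auto
          then have "(\<Sum>k\<in>{0..<n}. c * (if k = i then 1 else 0) * e $ k) = c * e $ i" using i by simp
          then show "((c \<cdot>\<^sub>m 1\<^sub>m n) *\<^sub>v e) $ i = (c \<cdot>\<^sub>v e) $ i" using i carr(5) by (simp add: scalar_prod_def)
        qed (simp add: e_def)
        ultimately show ?thesis by (auto simp: e_def intro!: eq_vecI)
      qed
      also have "vec n (Polynomial.coeff ([:c:] mod m)) + vec n (Polynomial.coeff (pCons 0 p mod m))
          = vec n (Polynomial.coeff (pCons c p mod m))"
      proof -
        have "pCons c p = [:c:] + pCons 0 p" by simp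
        then have "pCons c p mod m = [:c:] mod m + pCons 0 p mod m" by (metis poly_mod_add_left)
        then show ?thesis by (auto intro!: eq_vecI)
      qed
      finally show ?case .
    qed
    obtain B where B: "B \<in> carrier ?M" "M.ev g C = d \<odot>\<^bsub>?M\<^esub> B"
      using f C unfolding M.Int_K_iff[OF d over] g_def by blast
    define r where "r = g mod m"
    define r' where "r' = Polynomial.smult (1 / d) r"
    have rr': "r = Polynomial.smult d r'" using d by (simp add: r'_def)
    have "Polynomial.coeff r' i \<in> D" for i
    proof (cases "i < n")
      case True
      have "Polynomial.coeff r i = (M.ev g C *\<^sub>v e) $ i" using True col[OF g] by (simp add: r_def)
      also have "\<dots> = (\<Sum>k\<in>{0..<n}. d * B $$ (i, k) * e $ k)"
        using B True by (auto simp: D.mat_algebra_simps D.mat_algebra_carrier scalar_prod_def e_def)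
      also have "\<dots> = d * (\<Sum>k\<in>{0..<n}. B $$ (i, k) * e $ k)"
        by (simp add: sum_distrib_left mult.assoc)
      finally have "Polynomial.coeff r' i = (\<Sum>k\<in>{0..<n}. B $$ (i, k) * e $ k)"
        using d by (simp add: r'_def)
      moreover have "e $ k \<in> D" if "k < n" for k using that by (simp add: e_def deg1 Polynomial.coeff_1)
      ultimately show ?thesis
        using B True by (auto simp: D.mat_algebra_carrier intro!: D.sum_mem D.mult_mem)
    next
      case False
      have "r = 0 \<or> Polynomial.degree r < n" using degree_mod_less[OF m0, of g] m by (auto simp: r_def)
      then show ?thesis using False by (auto simp: r'_def coeff_eq_0)
    qed
    then have r': "poly_over D r'" by (simp add: poly_over_def)
    have r: "poly_over D r" using r' d by (simp add: rr' D.poly_over_smult)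
    have "ev g a = ev r a"
    proof -
      obtain t where t: "t \<in> D" "t \<noteq> 0" "poly_over D (Polynomial.smult t (g div m))"
        using poly_common_denom .
      have "g = g div m * m + r" by (simp add: r_def)
      then have "Polynomial.smult t g = Polynomial.smult t (g div m * m + r)" by (rule arg_cong)
      also have "\<dots> = Polynomial.smult t (g div m) * m + Polynomial.smult t r"
        by (simp only: Polynomial.smult_add_right Polynomial.mult_smult_left)
      finally have "Polynomial.smult t g = Polynomial.smult t (g div m) * m + Polynomial.smult t r" .
      then have "ev (Polynomial.smult t g) a = ev (Polynomial.smult t (g div m) * m + Polynomial.smult t r) a"
        by simp
      then have "t \<odot> ev g a = ev (Polynomial.smult t (g div m)) a \<otimes> ev m a \<oplus> t \<odot> ev r a"
        using t g r m(1) a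
        by (simp only: ev_add ev_mult ev_smult D.poly_over_mult D.poly_over_smult)
      then have "t \<odot> ev g a = t \<odot> ev r a" using t m(4) r a by simp
      then show ?thesis using smult_cancel[OF t(1,2)] g r a by simp
    qed
    also have "\<dots> = d \<odot> ev r' a" using r' d a by (simp add: rr' ev_smult)
    finally show "\<exists>b\<in>carrier A. ev (Polynomial.smult d f) a = d \<odot> b"
      using r' a by (auto simp: g_def)
  qed
qed

end

section \<open>Monic factors over an integrally closed domain\<close>

text \<open>A stable finite family makes \<open>z\<close> an eigenvalue of a matrix over \<open>R\<close>, hence a root of its
  characteristic polynomial.\<close>

lemma integral_if_stable_family:
  fixes z :: "'c::field" and R :: "'c set"
  assumes "unital_subring R" "finite I"
    and T: "\<And>i j. i \<in> I \<Longrightarrow> j \<in> I \<Longrightarrow> T i j \<in> R"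
    and eq: "\<And>i. i \<in> I \<Longrightarrow> z * v i = (\<Sum>j\<in>I. T i j * v j)"
    and nz: "k \<in> I" "v k \<noteq> 0"
  shows "integral_over R z"
proof -
  interpret R: unital_subring R by fact
  obtain h where "bij_betw h {0..<card I} I"
    using ex_bij_betw_nat_finite[OF assms(2)] ..
  moreover define N where "N = card I"
  ultimately have h: "bij_betw h {0..<N} I" by simp
  have hI: "h i \<in> I" if "i < N" for i
    using that h by (auto simp: bij_betw_def)
  define M where "M = mat N N (\<lambda>(i, j). T (h i) (h j))"
  define w where "w = vec N (\<lambda>i. v (h i))"
  have M: "M \<in> carrier_mat N N" by (simp add: M_def)
  have "M *\<^sub>v w = z \<cdot>\<^sub>v w"
  proof (rule eq_vecI)
    fix i assume "i < dim_vec (z \<cdot>\<^sub>v w)"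
    then have i: "i < N" by (simp add: w_def)
    have "(M *\<^sub>v w) $ i = (\<Sum>j\<in>{0..<N}. T (h i) (h j) * v (h j))"
      using i by (simp add: M_def w_def scalar_prod_def)
    also have "\<dots> = (\<Sum>j\<in>I. T (h i) j * v j)"
      by (rule sum.reindex_bij_betw[OF h])
    finally show "(M *\<^sub>v w) $ i = (z \<cdot>\<^sub>v w) $ i" using i eq[OF hI[OF i]] by (simp add: w_def)
  qed (simp add: M_def w_def)
  moreover have "w \<noteq> 0\<^sub>v N"
  proof -
    obtain l where l: "l < N" "h l = k" using h nz(1) by (force simp: bij_betw_def)
    then have "w $ l \<noteq> 0\<^sub>v N $ l" using nz(2) by (simp add: w_def)
    then show ?thesis by metis
  qed
  ultimately have "eigenvalue M z"
    unfolding eigenvalue_def eigenvector_def using M by (intro exI[of _ w]) (auto simp: w_def)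
  then have "poly (char_poly M) z = 0" using eigenvalue_root_char_poly[OF M] by simp
  moreover have "poly_over R (char_poly M)"
    using T hI by (intro R.char_poly_over[OF M]) (auto simp: M_def)
  ultimately show ?thesis
    unfolding integral_over_def using degree_monic_char_poly[OF M]
    by (intro exI[of _ "char_poly M"]) (auto simp: poly_over_def)
qed

text \<open>The powers \<open>1, x, \<dots>, x\<^sup>r\<^sup>-\<^sup>1\<close> form a stable family when \<open>r\<close> is the degree of an integral equation.\<close>

lemma integral_over_power_basis:
  fixes x :: "'c::field"
  assumes "unital_subring R" "integral_over R x"
  shows "\<exists>(r::nat) c. r > 0 \<and> (\<forall>i<r. \<forall>j<r. c i j \<in> R) \<and> (\<forall>i<r. x * x ^ i = (\<Sum>j<r. c i j * x ^ j))"
proof -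
  interpret R: unital_subring R by fact
  obtain p where p: "Polynomial.lead_coeff p = 1" "\<And>i. Polynomial.coeff p i \<in> R" "poly p x = 0"
    using assms(2) unfolding integral_over_def by blast
  define r where "r = Polynomial.degree p"
  have r: "r > 0"
  proof (rule ccontr)
    assume "\<not> r > 0"
    then have "p = [:1:]" using p(1) by (metis r_def degree_0_id gr0I)
    then show False using p(3) by simp
  qed
  define c where "c i j = (if Suc i < r then (if j = Suc i then 1 else 0) else - Polynomial.coeff p j)" for i j
  have "x * x ^ i = (\<Sum>j<r. c i j * x ^ j)" if "i < r" for i
  proof (cases "Suc i < r")
    case True
    then have "(\<Sum>j<r. c i j * x ^ j) = (\<Sum>j<r. if j = Suc i then x ^ j else 0)"
      by (intro sum.cong) (auto simp: c_def)
    then show ?thesis using True by simp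
  next
    case False
    then have i: "Suc i = r" using that by simp
    have "0 = (\<Sum>j\<le>r. Polynomial.coeff p j * x ^ j)" using p(3) by (simp add: poly_altdef r_def)
    also have "\<dots> = (\<Sum>j<r. Polynomial.coeff p j * x ^ j) + x ^ r"
      using p(1) by (simp add: lessThan_Suc_atMost[symmetric] r_def)
    finally have "x ^ r = - (\<Sum>j<r. Polynomial.coeff p j * x ^ j)" by (simp add: eq_neg_iff_add_eq_0 add.commute)
    also have "\<dots> = (\<Sum>j<r. c i j * x ^ j)" using False by (simp add: c_def sum_negf)
    finally show ?thesis using i by auto
  qed
  then show ?thesis using r p(2) by (intro exI[of _ r] exI[of _ c]) (auto simp: c_def R.uminus_mem)
qed

text \<open>The products \<open>x\<^sup>i y\<^sup>j\<close> of the two power families are stable under \<open>x + y\<close> and under \<open>xy\<close>.\<close>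

lemma unital_subring_integral:
  fixes R :: "'c::field set"
  assumes "unital_subring R"
  shows "unital_subring {x. integral_over R x}"
proof -
  interpret R: unital_subring R by fact
  have mem: "integral_over R x" if "x \<in> R" for x
    unfolding integral_over_def using that
    by (intro exI[of _ "[:- x, 1:]"]) (auto simp: coeff_pCons R.uminus_mem split: nat.split)
  have *: "integral_over R (x + y) \<and> integral_over R (x * y)"
    if x: "integral_over R x" and y: "integral_over R y" for x y
  proof -
    obtain r c where r: "r > 0" "\<And>i j. i < r \<Longrightarrow> j < r \<Longrightarrow> c i j \<in> R"
      and cx: "\<And>i. i < r \<Longrightarrow> x * x ^ i = (\<Sum>j<r. c i j * x ^ j)"
      using integral_over_power_basis[OF assms x] by blast
    obtain s d where s: "s > 0" "\<And>i j. i < s \<Longrightarrow> j < s \<Longrightarrow> d i j \<in> R"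
      and dy: "\<And>i. i < s \<Longrightarrow> y * y ^ i = (\<Sum>j<s. d i j * y ^ j)"
      using integral_over_power_basis[OF assms y] by blast
    let ?I = "{..<r} \<times> {..<s}"
    define v where "v = (\<lambda>(i, j). x ^ i * y ^ j)"
    have nz: "(0, 0) \<in> ?I" "v (0, 0) \<noteq> 0" using r s by (auto simp: v_def)
    have xv: "x * v (i, j) = (\<Sum>(i', j')\<in>?I. (c i i' * (if j' = j then 1 else 0)) * v (i', j'))"
      if "i < r" "j < s" for i j
    proof -
      have "(\<Sum>(i', j')\<in>?I. (c i i' * (if j' = j then 1 else 0)) * v (i', j'))
          = (\<Sum>i'<r. \<Sum>j'<s. if j' = j then c i i' * v (i', j') else 0)"
        by (simp add: sum.cartesian_product[symmetric] if_distrib if_distribR cong: if_cong)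
      also have "\<dots> = (\<Sum>i'<r. c i i' * v (i', j))" using that by simp
      also have "\<dots> = (\<Sum>i'<r. c i i' * x ^ i') * y ^ j"
        by (simp add: v_def sum_distrib_right mult.assoc)
      also have "\<dots> = x * v (i, j)" using cx[OF that(1)] by (simp add: v_def)
      finally show ?thesis ..
    qed
    have yv: "y * v (i, j) = (\<Sum>(i', j')\<in>?I. ((if i' = i then 1 else 0) * d j j') * v (i', j'))"
      if "i < r" "j < s" for i j
    proof -
      have "(\<Sum>(i', j')\<in>?I. ((if i' = i then 1 else 0) * d j j') * v (i', j'))
          = (\<Sum>i'<r. if i' = i then (\<Sum>j'<s. d j j' * v (i', j')) else 0)"
        unfolding sum.cartesian_product[symmetric] by (rule sum.cong) auto
      also have "\<dots> = (\<Sum>j'<s. d j j' * v (i, j'))" using that by simp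
      also have "\<dots> = x ^ i * (\<Sum>j'<s. d j j' * y ^ j')"
        by (simp add: v_def sum_distrib_left mult_ac)
      also have "\<dots> = y * v (i, j)" using dy[OF that(2)] by (simp add: v_def)
      finally show ?thesis ..
    qed
    have xyv: "(x * y) * v (i, j) = (\<Sum>(i', j')\<in>?I. (c i i' * d j j') * v (i', j'))"
      if "i < r" "j < s" for i j
    proof -
      have "(\<Sum>(i', j')\<in>?I. (c i i' * d j j') * v (i', j'))
          = (\<Sum>i'<r. c i i' * x ^ i') * (\<Sum>j'<s. d j j' * y ^ j')"
        by (simp add: v_def sum_product sum.cartesian_product mult_ac)
      also have "\<dots> = (x * x ^ i) * (y * y ^ j)" using cx[OF that(1)] dy[OF that(2)] by simp
      also have "\<dots> = (x * y) * v (i, j)" by (simp add: v_def mult_ac)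
      finally show ?thesis ..
    qed
    have "integral_over R (x + y)"
    proof (rule integral_if_stable_family[OF assms, where I = ?I and k = "(0, 0)" and v = v
          and T = "\<lambda>(i, j) (i', j'). c i i' * (if j' = j then 1 else 0) + (if i' = i then 1 else 0) * d j j'"])
      fix p assume "p \<in> ?I"
      then obtain i j where p: "p = (i, j)" "i < r" "j < s" by auto
      show "(x + y) * v p = (\<Sum>q\<in>?I. (case p of (i, j) \<Rightarrow> \<lambda>(i', j'). c i i' * (if j' = j then 1 else 0)
          + (if i' = i then 1 else 0) * d j j') q * v q)"
        using xv[OF p(2,3)] yv[OF p(2,3)]
        by (simp add: p(1) case_prod_unfold ring_distribs sum.distrib)
    qed (use r s nz in \<open>auto intro!: R.add_mem R.mult_mem\<close>)
    moreover have "integral_over R (x * y)"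
    proof (rule integral_if_stable_family[OF assms, where I = ?I and k = "(0, 0)" and v = v
          and T = "\<lambda>(i, j) (i', j'). c i i' * d j j'"])
      fix p assume "p \<in> ?I"
      then obtain i j where p: "p = (i, j)" "i < r" "j < s" by auto
      show "(x * y) * v p = (\<Sum>q\<in>?I. (case p of (i, j) \<Rightarrow> \<lambda>(i', j'). c i i' * d j j') q * v q)"
        using xyv[OF p(2,3)] by (simp add: p(1) case_prod_unfold)
    qed (use r s nz in \<open>auto intro!: R.add_mem R.mult_mem\<close>)
    ultimately show ?thesis by blast
  qed
  show ?thesis
  proof
    fix x assume "x \<in> {x. integral_over R x}"
    then have "integral_over R (- 1 * x)"
      using *[of "- 1" x] mem[of "- 1"] R.uminus_mem[of 1] by simp
    then show "- x \<in> {x. integral_over R x}" by simp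
  qed (use * mem in auto)
qed

text \<open>Over an algebraic closure the factor \<open>m\<close> splits, and its roots are roots of \<open>p\<close>, hence integral. Its coefficients
  are polynomials in these roots, so they are integral elements of \<open>K\<close>.\<close>

theorem monic_factor_over_integrally_closed:
  fixes D :: "'k::field set"
  assumes "unital_subring D" and ic: "integrally_closed D" and frac: "frac_field D = UNIV"
    and p: "poly_over D p" "Polynomial.lead_coeff p = 1"
    and m: "m dvd p" "Polynomial.lead_coeff m = 1"
  shows "poly_over D m"
proof -
  interpret D: unital_subring D by fact
  interpret ac: field_hom "to_ac :: 'k \<Rightarrow> 'k alg_closure"
    by unfold_locales simp_all
  interpret acp: map_poly_comm_ring_hom "to_ac :: 'k \<Rightarrow> 'k alg_closure" ..
  define R where "R = (to_ac ` D :: 'k alg_closure set)"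
  have R: "unital_subring R"
  proof
    show "0 \<in> R" "1 \<in> R" using imageI[OF D.zero_mem, of to_ac] imageI[OF D.one_mem, of to_ac] by (simp_all add: R_def)
  next
    fix x y assume "x \<in> R" "y \<in> R"
    then obtain a b where ab: "x = to_ac a" "y = to_ac b" "a \<in> D" "b \<in> D" by (auto simp: R_def)
    then show "x + y \<in> R" "x * y \<in> R"
      using imageI[OF D.add_mem[OF ab(3,4)], of to_ac] imageI[OF D.mult_mem[OF ab(3,4)], of to_ac]
      by (simp_all add: R_def)
  next
    fix x assume "x \<in> R"
    then obtain a where a: "x = to_ac a" "a \<in> D" by (auto simp: R_def)
    then show "- x \<in> R" using imageI[OF D.uminus_mem[OF a(2)], of to_ac] by (simp add: R_def)
  qed
  interpret I: unital_subring "{x. integral_over R x}" by (rule unital_subring_integral[OF R])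
  define M where "M = map_poly (to_ac :: 'k \<Rightarrow> 'k alg_closure) m"
  have lead: "Polynomial.lead_coeff M = 1" using m(2) by (simp add: M_def)
  then have "M \<noteq> 0" by auto
  then obtain W where W: "M = (\<Prod>x\<in>#W. [:- x, 1:])"
    using alg_closed_imp_factorization[of M] lead by auto
  have "integral_over R x" if "x \<in># W" for x
  proof -
    have "poly M x = 0" using that by (simp add: W poly_prod_mset prod_mset_zero_iff)
    then have "poly (map_poly to_ac p) x = 0"
      using m(1) by (auto simp: M_def dvd_def acp.hom_mult)
    then show ?thesis
      unfolding integral_over_def
      using p by (intro exI[of _ "map_poly to_ac p"]) (auto simp: R_def poly_over_def)
  qed
  then have "poly_over {x. integral_over R x} (\<Prod>x\<in>#W. [:- x, 1:])"
  proof (induction W)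
    case (add x W)
    have "poly_over {x. integral_over R x} [:- x, 1:]"
      using add.prems[of x] I.uminus_mem[of x] I.one_mem by simp
    moreover have "poly_over {x. integral_over R x} (\<Prod>x\<in>#W. [:- x, 1:])"
      using add by simp
    ultimately show ?case using I.poly_over_mult by (simp only: image_mset_add_mset prod_mset.add_mset)
  qed simp
  then have int: "integral_over R (to_ac (Polynomial.coeff m i))" for i
  proof -
    have "Polynomial.coeff M i = to_ac (Polynomial.coeff m i)" by (simp add: M_def coeff_map_poly)
    moreover have "integral_over R (Polynomial.coeff M i)"
      using \<open>poly_over {x. integral_over R x} (\<Prod>x\<in>#W. [:- x, 1:])\<close> W by (simp add: poly_over_def)
    ultimately show ?thesis by simp
  qed
  have "Polynomial.coeff m i \<in> D" for i
  proof -
    let ?x = "Polynomial.coeff m i"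
    obtain u where u: "Polynomial.lead_coeff u = 1" "\<And>j. Polynomial.coeff u j \<in> R" "poly u (to_ac ?x) = 0"
      using int[of i] unfolding integral_over_def by blast
    define w where "w = map_poly of_ac u"
    have w: "Polynomial.coeff w j \<in> D \<and> to_ac (Polynomial.coeff w j) = Polynomial.coeff u j" for j
      using u(2)[of j] by (auto simp: w_def R_def coeff_map_poly)
    have uw: "u = map_poly to_ac w" by (rule poly_eqI) (simp add: w)
    have "to_ac (poly w ?x) = 0" using u(3) by (simp add: uw)
    then have "poly w ?x = 0" by simp
    moreover have "Polynomial.lead_coeff w = 1"
    proof -
      have "to_ac (Polynomial.lead_coeff w) = 1" using u(1) unfolding uw by simp
      then show ?thesis using to_ac_eq_iff[of "Polynomial.lead_coeff w" 1] by simp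
    qed
    ultimately have "integral_over D ?x" unfolding integral_over_def using w by blast
    then have "?x \<in> integral_closure D" using frac by (simp add: integral_closure_def)
    then show ?thesis using ic by (simp add: integrally_closed_def)
  qed
  then show ?thesis by (simp add: poly_over_def)
qed

section \<open>The filtration by powers of a prime\<close>

lemma (in Ring.ring) minus_rules:
  "\<lbrakk>x \<in> carrier R; y \<in> carrier R; z \<in> carrier R\<rbrakk> \<Longrightarrow> x \<ominus> z = (x \<ominus> y) \<oplus> (y \<ominus> z)"
  "\<lbrakk>x \<in> carrier R; y \<in> carrier R\<rbrakk> \<Longrightarrow> y \<ominus> x = \<ominus> (x \<ominus> y)"
  "\<lbrakk>x \<in> carrier R; y \<in> carrier R; x' \<in> carrier R; y' \<in> carrier R\<rbrakk> \<Longrightarrow>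
    (x \<oplus> y) \<ominus> (x' \<oplus> y') = (x \<ominus> x') \<oplus> (y \<ominus> y')"
  "\<lbrakk>x \<in> carrier R; y \<in> carrier R; x' \<in> carrier R; y' \<in> carrier R\<rbrakk> \<Longrightarrow>
    (x \<otimes> y) \<ominus> (x' \<otimes> y') = (x \<ominus> x') \<otimes> y \<oplus> x' \<otimes> (y \<ominus> y')"
  "\<lbrakk>x \<in> carrier R; y \<in> carrier R\<rbrakk> \<Longrightarrow> y \<oplus> (x \<ominus> y) = x"
  by (simp_all add: minus_eq a_assoc r_neg1 minus_add l_distr r_distr l_minus r_minus)
    (simp_all add: a_ac a_lcomm[of y x "\<ominus> y"] r_neg)

text \<open>A prime \<open>P\<close> of \<open>D\<close> whose extension to the localization \<open>D\<^sub>P\<close> is generated by \<open>p \<in> P\<close>, expressed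
  inside \<open>D\<close>: equations in \<open>D\<^sub>P\<close> are multiplied by elements of \<open>D - P\<close>. The assumption \<open>krull\<close> says that
  the powers of \<open>p\<close> have intersection \<open>0\<close> in \<open>D\<^sub>P\<close>.\<close>

locale local_uniformizer =
  fixes D P :: "'k::field set" and p :: 'k
  assumes P_subset: "P \<subseteq> D"
    and P_add: "\<lbrakk>x \<in> P; y \<in> P\<rbrakk> \<Longrightarrow> x + y \<in> P"
    and P_mult: "\<lbrakk>c \<in> D; x \<in> P\<rbrakk> \<Longrightarrow> c * x \<in> P"
    and one_notin_P: "1 \<notin> P"
    and P_prime: "\<lbrakk>x \<in> D; y \<in> D; x * y \<in> P\<rbrakk> \<Longrightarrow> x \<in> P \<or> y \<in> P"
    and P_maximal: "s \<in> D - P \<Longrightarrow> \<exists>t\<in>D. 1 - s * t \<in> P"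
    and p_mem: "p \<in> P" and p_nonzero: "p \<noteq> 0"
    and p_generates: "x \<in> P \<Longrightarrow> \<exists>s\<in>D - P. \<exists>d\<in>D. s * x = p * d"
    and krull: "\<lbrakk>d \<in> D; \<And>k. \<exists>s\<in>D - P. \<exists>e\<in>D. s * d = p ^ k * e\<rbrakk> \<Longrightarrow> d = 0"

locale local_algebra = torsion_free_algebra_over D A + local_uniformizer D P p
  for D :: "'k::field set" and A :: "('k, 'a) module" (structure) and P and p
begin

lemma units_mult: "s \<in> D - P \<Longrightarrow> t \<in> D - P \<Longrightarrow> s * t \<in> D - P"
  using P_prime D.mult_mem by auto

lemma units_one: "1 \<in> D - P"
  using one_notin_P by simp

lemma units_D: "s \<in> D - P \<Longrightarrow> s \<in> D" by simp

lemma zero_mem_P: "0 \<in> P"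
  using P_mult[OF D.zero_mem p_mem] by simp

lemma units_nonzero: "s \<in> D - P \<Longrightarrow> s \<noteq> 0"
  using zero_mem_P by auto

lemma p_D: "p \<in> D" using p_mem P_subset by auto

lemma p_pow_D [simp]: "p ^ k \<in> D" by (rule D.power_mem[OF p_D])

text \<open>This is \<open>A \<inter> p\<^sup>k A\<^sub>P\<close> for the localization \<open>A\<^sub>P\<close> of \<open>A\<close> at \<open>P\<close>. In this form,
  powers of \<open>p\<close> (\<open>adic_p_cancel\<close>) and elements of \<open>D - P\<close> (\<open>adic_unit_cancel\<close>) can be cancelled at once.\<close>

definition adic :: "nat \<Rightarrow> 'a set" where
  "adic k = {x \<in> carrier A. \<exists>s\<in>D - P. \<exists>b\<in>carrier A. s \<odot> x = (p ^ k) \<odot> b}"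

lemma adic_I: "\<lbrakk>x \<in> carrier A; s \<in> D - P; b \<in> carrier A; s \<odot> x = (p ^ k) \<odot> b\<rbrakk> \<Longrightarrow> x \<in> adic k"
  unfolding adic_def by blast

lemma adic_E:
  assumes "x \<in> adic k"
  obtains s b where "x \<in> carrier A" "s \<in> D - P" "b \<in> carrier A" "s \<odot> x = (p ^ k) \<odot> b"
  using assms unfolding adic_def by blast

lemma adic_carrier: "x \<in> adic k \<Longrightarrow> x \<in> carrier A"
  by (simp add: adic_def)

lemma smult_commute: "\<lbrakk>c \<in> D; d \<in> D; x \<in> carrier A\<rbrakk> \<Longrightarrow> c \<odot> (d \<odot> x) = d \<odot> (c \<odot> x)"
  by (simp add: smult_smult mult.commute)

lemma scale_relation:
  assumes "t \<in> D" "s \<in> D" "x \<in> carrier A" "b \<in> carrier A" "s \<odot> x = (p ^ k) \<odot> b"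
  shows "(t * s) \<odot> x = (p ^ k) \<odot> (t \<odot> b)"
proof -
  have "(t * s) \<odot> x = t \<odot> (s \<odot> x)" by (rule smult_smult[OF assms(1-3), symmetric])
  also have "\<dots> = t \<odot> ((p ^ k) \<odot> b)" by (simp only: assms(5))
  also have "\<dots> = (p ^ k) \<odot> (t \<odot> b)" by (rule smult_commute[OF assms(1) p_pow_D assms(4)])
  finally show ?thesis .
qed

lemma adic_zero [simp]: "\<zero> \<in> adic k"
  using units_one by (intro adic_I[of _ 1 \<zero>]) auto

lemma adic_add:
  assumes "x \<in> adic k" "y \<in> adic k"
  shows "x \<oplus> y \<in> adic k"
proof -
  from assms(1) obtain s b where x: "x \<in> carrier A" "s \<in> D - P" "b \<in> carrier A" "s \<odot> x = (p ^ k) \<odot> b"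
    by (rule adic_E)
  from assms(2) obtain t c where y: "y \<in> carrier A" "t \<in> D - P" "c \<in> carrier A" "t \<odot> y = (p ^ k) \<odot> c"
    by (rule adic_E)
  note D = units_D[OF x(2)] units_D[OF y(2)]
  have "(s * t) \<odot> (x \<oplus> y) = (t * s) \<odot> x \<oplus> (s * t) \<odot> y"
    using smult_add_right[of "s * t" x y] x(1) y(1) D.mult_mem[OF D] by (simp only: mult.commute[of t s])
  also have "\<dots> = (p ^ k) \<odot> (t \<odot> b) \<oplus> (p ^ k) \<odot> (s \<odot> c)"
    by (simp only: scale_relation[OF D(2,1) x(1,3,4)] scale_relation[OF D y(1,3,4)])
  also have "\<dots> = (p ^ k) \<odot> (t \<odot> b \<oplus> s \<odot> c)"
    using x y D smult_add_right[of "p ^ k" "t \<odot> b" "s \<odot> c"] by simp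
  finally show ?thesis
    using x y D units_mult[OF x(2) y(2)] by (intro adic_I[of _ "s * t" "t \<odot> b \<oplus> s \<odot> c"]) auto
qed

lemma adic_smult:
  assumes "x \<in> adic k" "c \<in> D"
  shows "c \<odot> x \<in> adic k"
proof -
  from assms(1) obtain s b where x: "x \<in> carrier A" "s \<in> D - P" "b \<in> carrier A" "s \<odot> x = (p ^ k) \<odot> b"
    by (rule adic_E)
  have "s \<odot> (c \<odot> x) = c \<odot> (s \<odot> x)" using x(1,2) assms(2) by (intro smult_commute) auto
  also have "\<dots> = (p ^ k) \<odot> (c \<odot> b)" unfolding x(4) using x(3) assms(2) by (intro smult_commute) auto
  finally show ?thesis using x assms by (intro adic_I[of _ s "c \<odot> b"]) auto
qed

lemma adic_minus: "x \<in> adic k \<Longrightarrow> \<ominus> x \<in> adic k"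
  using adic_smult[of x k "- 1"] adic_carrier[of x k] by (simp add: D.uminus_mem smult_uminus_left)

lemma adic_diff: "x \<in> adic k \<Longrightarrow> y \<in> adic k \<Longrightarrow> x \<ominus> y \<in> adic k"
  unfolding M.minus_eq by (intro adic_add adic_minus)

lemma adic_mult:
  assumes "x \<in> adic j" "y \<in> adic k"
  shows "x \<otimes> y \<in> adic (j + k)"
proof -
  from assms(1) obtain s b where x: "x \<in> carrier A" "s \<in> D - P" "b \<in> carrier A" "s \<odot> x = (p ^ j) \<odot> b"
    by (rule adic_E)
  from assms(2) obtain t c where y: "y \<in> carrier A" "t \<in> D - P" "c \<in> carrier A" "t \<odot> y = (p ^ k) \<odot> c"
    by (rule adic_E)
  note D = units_D[OF x(2)] units_D[OF y(2)]
  have "(s * t) \<odot> (x \<otimes> y) = (s \<odot> x) \<otimes> (t \<odot> y)"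
    using x(1) y(1) D by (simp add: mult_smult_left mult_smult_right smult_smult mult.commute[of t s])
  also have "\<dots> = (p ^ (j + k)) \<odot> (b \<otimes> c)"
    unfolding x(4) y(4) using x(3) y(3) by (simp add: mult_smult_left mult_smult_right smult_smult power_add mult.commute[of "p ^ k" "p ^ j"])
  finally show ?thesis
    using x y D units_mult[OF x(2) y(2)] by (intro adic_I[of _ "s * t" "b \<otimes> c"]) auto
qed

lemma adic_zero_exponent: "adic 0 = carrier A"
proof
  show "carrier A \<subseteq> adic 0"
  proof
    fix x assume "x \<in> carrier A"
    then show "x \<in> adic 0" using units_one by (intro adic_I[of _ 1 x]) auto
  qed
qed (auto dest: adic_carrier)

lemma adic_lmult: "x \<in> carrier A \<Longrightarrow> y \<in> adic k \<Longrightarrow> x \<otimes> y \<in> adic k"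
  using adic_mult[of x 0 y k] by (simp add: adic_zero_exponent)

lemma adic_rmult: "x \<in> adic k \<Longrightarrow> y \<in> carrier A \<Longrightarrow> x \<otimes> y \<in> adic k"
  using adic_mult[of x k y 0] by (simp add: adic_zero_exponent)

lemma adic_mono:
  assumes "j \<le> k" "x \<in> adic k"
  shows "x \<in> adic j"
proof -
  from assms(2) obtain s b where x: "x \<in> carrier A" "s \<in> D - P" "b \<in> carrier A" "s \<odot> x = (p ^ k) \<odot> b"
    by (rule adic_E)
  have "p ^ k = p ^ j * p ^ (k - j)" using assms(1) by (simp add: power_add[symmetric])
  then have "(p ^ k) \<odot> b = (p ^ j) \<odot> ((p ^ (k - j)) \<odot> b)"
    using smult_smult[OF p_pow_D p_pow_D x(3), of j "k - j"] by simp
  then show ?thesis using x by (intro adic_I[of _ s "(p ^ (k - j)) \<odot> b"]) auto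
qed

lemma adic_p_pow: "b \<in> carrier A \<Longrightarrow> (p ^ k) \<odot> b \<in> adic k"
  using units_one by (intro adic_I[of _ 1 b]) auto

lemma adic_unit_cancel:
  assumes "s \<in> D - P" "x \<in> carrier A" "s \<odot> x \<in> adic k"
  shows "x \<in> adic k"
proof -
  from assms(3) obtain t b where x: "t \<in> D - P" "b \<in> carrier A" "t \<odot> (s \<odot> x) = (p ^ k) \<odot> b"
    by (rule adic_E)
  then have "(t * s) \<odot> x = (p ^ k) \<odot> b" using assms by (simp add: smult_smult)
  then show ?thesis using x assms units_mult[OF x(1) assms(1)] by (intro adic_I[of _ "t * s" b]) auto
qed

lemma adic_p_cancel:
  assumes "x \<in> carrier A" "(p ^ j) \<odot> x \<in> adic (j + k)"
  shows "x \<in> adic k"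
proof -
  from assms(2) obtain s b where x: "s \<in> D - P" "b \<in> carrier A" "s \<odot> ((p ^ j) \<odot> x) = (p ^ (j + k)) \<odot> b"
    by (rule adic_E)
  have "(p ^ j) \<odot> (s \<odot> x) = s \<odot> ((p ^ j) \<odot> x)"
    using x(1) assms(1) by (intro smult_commute) auto
  also have "\<dots> = (p ^ j) \<odot> ((p ^ k) \<odot> b)"
    unfolding x(3) using x(2) by (simp add: smult_smult power_add)
  finally have eq: "(p ^ j) \<odot> (s \<odot> x) = (p ^ j) \<odot> ((p ^ k) \<odot> b)" .
  have "s \<odot> x = (p ^ k) \<odot> b"
    by (rule smult_cancel[OF p_pow_D _ _ _ eq]) (use p_nonzero x(1,2) assms(1) in simp_all)
  with assms(1) x(1,2) show ?thesis by (rule adic_I)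
qed

lemma adic_P_pow:
  assumes "u \<in> P" "x \<in> carrier A"
  shows "(u ^ k) \<odot> x \<in> adic k"
proof -
  obtain s d where s: "s \<in> D - P" "d \<in> D" "s * u = p * d" using p_generates[OF assms(1)] by blast
  have sk: "s ^ k \<in> D - P" by (induction k) (use s units_one units_mult in auto)
  have u: "u \<in> D" using assms P_subset by auto
  have "s ^ k * u ^ k = p ^ k * d ^ k" using s(3) by (simp add: power_mult_distrib[symmetric])
  then have "(s ^ k) \<odot> ((u ^ k) \<odot> x) = (p ^ k) \<odot> ((d ^ k) \<odot> x)"
    by (simp only: smult_smult[OF units_D[OF sk] D.power_mem[OF u] assms(2)]
      smult_smult[OF p_pow_D D.power_mem[OF s(2)] assms(2)])
  then show ?thesis
    by (rule adic_I[rotated 3]) (use sk D.power_mem[OF u, of k] D.power_mem[OF s(2), of k] assms(2) in simp_all)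
qed

text \<open>An inverse of \<open>s\<close> modulo \<open>P\<close> has error \<open>u \<in> P\<close>; the geometric sum turns it into an inverse with error
  \<open>u\<^sup>k\<close>.\<close>

lemma unit_inverse:
  assumes "s \<in> D - P"
  obtains t u where "t \<in> D" "u \<in> P" "1 - s * t = u ^ k"
proof -
  obtain t where t: "t \<in> D" "1 - s * t \<in> P" using P_maximal[OF assms] by blast
  define u where "u = 1 - s * t"
  have u: "u \<in> D" using t P_subset by (auto simp: u_def)
  have "1 - u ^ k = (1 - u) * (\<Sum>i<k. u ^ i)" by (rule one_diff_power_eq)
  also have "1 - u = s * t" by (simp add: u_def)
  finally have "s * (t * (\<Sum>i<k. u ^ i)) = 1 - u ^ k" by (simp only: mult.assoc)
  then have "1 - s * (t * (\<Sum>i<k. u ^ i)) = u ^ k" by simp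
  moreover have "t * (\<Sum>i<k. u ^ i) \<in> D" using t u by (intro D.mult_mem D.sum_mem D.power_mem)
  moreover have "u \<in> P" using t(2) by (simp only: u_def)
  ultimately show ?thesis using that by blast
qed

text \<open>Denominators can be inverted up to an error that is as small as required.\<close>

lemma adic_approx:
  assumes "x \<in> adic j"
  obtains b where "b \<in> carrier A" "x \<ominus> (p ^ j) \<odot> b \<in> adic k"
proof -
  from assms obtain s b where x: "x \<in> carrier A" "s \<in> D - P" "b \<in> carrier A" "s \<odot> x = (p ^ j) \<odot> b"
    by (rule adic_E)
  obtain t u where t: "t \<in> D" "u \<in> P" "1 - s * t = u ^ k" using unit_inverse[OF x(2)] .
  have s: "s \<in> D" using x by simp
  have "(p ^ j) \<odot> (t \<odot> b) = (t * s) \<odot> x"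
    using scale_relation[OF t(1) s x(1,3,4)] by simp
  also have "t * s = s * t" by (rule mult.commute)
  finally have "x \<ominus> (p ^ j) \<odot> (t \<odot> b) = (1 - s * t) \<odot> x"
    using smult_diff_left[OF D.one_mem D.mult_mem[OF s t(1)] x(1)] x(1) by simp
  also have "\<dots> \<in> adic k" using adic_P_pow[OF t(2) x(1)] t(3) by simp
  finally show ?thesis using that[of "t \<odot> b"] t x by simp
qed

definition adic_cong :: "nat \<Rightarrow> 'a \<Rightarrow> 'a \<Rightarrow> bool" where
  "adic_cong k x y \<longleftrightarrow> x \<in> carrier A \<and> y \<in> carrier A \<and> x \<ominus> y \<in> adic k"

lemma adic_cong_carrier: "adic_cong k x y \<Longrightarrow> x \<in> carrier A" "adic_cong k x y \<Longrightarrow> y \<in> carrier A"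
  by (auto simp: adic_cong_def)

lemma adic_cong_refl: "x \<in> carrier A \<Longrightarrow> adic_cong k x x"
  by (simp add: adic_cong_def M.minus_eq M.r_neg)

lemma adic_cong_sym: "adic_cong k x y \<Longrightarrow> adic_cong k y x"
  unfolding adic_cong_def by (metis adic_minus A.minus_rules(2))

lemma adic_cong_trans [trans]: "adic_cong k x y \<Longrightarrow> adic_cong k y z \<Longrightarrow> adic_cong k x z"
  unfolding adic_cong_def by (metis adic_add A.minus_rules(1))

lemma adic_cong_add: "adic_cong k x x' \<Longrightarrow> adic_cong k y y' \<Longrightarrow> adic_cong k (x \<oplus> y) (x' \<oplus> y')"
  unfolding adic_cong_def by (metis adic_add A.minus_rules(3) M.a_closed)

lemma adic_cong_mult: "adic_cong k x x' \<Longrightarrow> adic_cong k y y' \<Longrightarrow> adic_cong k (x \<otimes> y) (x' \<otimes> y')"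
  unfolding adic_cong_def by (metis adic_add adic_rmult adic_lmult A.minus_rules(4) A.m_closed)

lemma adic_cong_smult: "adic_cong k x y \<Longrightarrow> c \<in> D \<Longrightarrow> adic_cong k (c \<odot> x) (c \<odot> y)"
  unfolding adic_cong_def by (metis adic_smult smult_diff_right smult_closed')

lemma adic_cong_mono: "j \<le> k \<Longrightarrow> adic_cong k x y \<Longrightarrow> adic_cong j x y"
  unfolding adic_cong_def using adic_mono[of j k "x \<ominus> y"] by blast

lemma adic_cong_zero: "adic_cong k x \<zero> \<longleftrightarrow> x \<in> adic k"
proof (cases "x \<in> carrier A")
  case True
  then show ?thesis by (simp add: adic_cong_def M.minus_eq)
next
  case False
  then show ?thesis using adic_carrier[of x k] by (auto simp: adic_cong_def)
qed

lemma adic_cong_finsum: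
  assumes "finite I" "\<And>i. i \<in> I \<Longrightarrow> adic_cong k (f i) (g i)"
  shows "adic_cong k (\<Oplus>i\<in>I. f i) (\<Oplus>i\<in>I. g i)"
  using assms
proof (induction I rule: finite_induct)
  case empty
  then show ?case by (simp add: adic_cong_refl)
next
  case (insert x I)
  have "f \<in> insert x I \<rightarrow> carrier A" "g \<in> insert x I \<rightarrow> carrier A"
    using adic_cong_carrier[OF insert.prems] by blast+
  then show ?case using insert by (simp add: Pi_def adic_cong_add)
qed

lemma numeral_poly_over: "poly_over D (numeral c)"
proof -
  have nat: "of_nat m \<in> D" for m by (induction m) (auto intro: D.add_mem)
  have "(numeral c :: 'k poly) = [:numeral c:]" by (simp add: numeral_poly)
  moreover have "poly_over D [:numeral c:]" using nat[of "numeral c"] by simp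
  ultimately show ?thesis by metis
qed

text \<open>Newton's iteration for the equation \<open>x\<^sup>2 = x\<close>: the step \<open>E \<mapsto> 3E\<^sup>2 - 2E\<^sup>3\<close> squares the error, since
  \<open>E'\<^sup>2 - E'\<close> is a multiple of \<open>(E\<^sup>2 - E)\<^sup>2\<close>. All elements involved are polynomials in \<open>E\<close>, so the
  identities are identities in \<open>K[x]\<close>.\<close>

lemma lift_idempotent:
  assumes e: "e \<in> carrier A" "e \<otimes> e \<ominus> e \<in> adic 1"
  shows "\<exists>E. E \<in> carrier A \<and> adic_cong 1 E e \<and> adic_cong (Suc k) (E \<otimes> E) E"
proof (induction k)
  case 0
  then show ?case using e by (intro exI[of _ e]) (auto simp: adic_cong_refl adic_cong_def M.minus_eq M.r_neg)
next
  case (Suc k)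
  then obtain E where E: "E \<in> carrier A" "adic_cong 1 E e" "E \<otimes> E \<ominus> E \<in> adic (Suc k)" by (auto simp: adic_cong_def)
  define x :: "'k poly" where "x = [:0, 1:]"
  have x: "poly_over D x" by (simp add: x_def)
  note over = D.poly_over_diff D.poly_over_mult D.poly_over_add D.poly_over_1 numeral_poly_over x
  define z where "z = ev (x * x - x) E"
  have z: "z \<in> adic (Suc k)" "z \<in> carrier A"
    using E x by (simp_all add: z_def ev_diff ev_mult D.poly_over_mult) (simp_all add: x_def)
  define f where "f = 3 * (x * x) - 2 * (x * x * x)"
  have f: "poly_over D f" unfolding f_def by (intro over)
  define E' where "E' = ev f E"
  have E': "E' \<in> carrier A" using f E by (simp add: E'_def)
  have "E' \<ominus> E = ev (f - x) E" using f x E by (simp add: E'_def ev_diff) (simp add: x_def)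
  also have "f - x = (x * x - x) * (1 - 2 * x)" unfolding f_def by Groebner_Basis.algebra
  also have "ev \<dots> E = z \<otimes> ev (1 - 2 * x) E"
    unfolding z_def using E by (intro ev_mult over)
  also have "\<dots> \<in> adic (Suc k)" by (rule adic_rmult[OF z(1)], rule ev_closed[OF _ E(1)], intro over)
  finally have c1: "adic_cong (Suc k) E' E" using E E' by (simp add: adic_cong_def)
  have "E' \<otimes> E' \<ominus> E' = ev (f * f - f) E" using f E by (simp add: E'_def ev_diff ev_mult D.poly_over_mult)
  also have "f * f - f = (x * x - x) * (x * x - x) * (4 * (x * x) - 4 * x - 3)" unfolding f_def by Groebner_Basis.algebra
  also have "ev \<dots> E = z \<otimes> z \<otimes> ev (4 * (x * x) - 4 * x - 3) E"
    unfolding z_def using E by (subst ev_mult, (intro over)+, simp, subst ev_mult, (intro over)+, simp_all)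
  also have "\<dots> \<in> adic (Suc k + Suc k)"
    by (rule adic_rmult[OF adic_mult[OF z(1) z(1)]], rule ev_closed[OF _ E(1)], intro over)
  finally have "E' \<otimes> E' \<ominus> E' \<in> adic (Suc (Suc k))" by (rule adic_mono[rotated]) simp
  then have "adic_cong (Suc (Suc k)) (E' \<otimes> E') E'" using E' by (simp add: adic_cong_def)
  moreover have "adic_cong 1 E' e" using adic_cong_trans[OF adic_cong_mono[OF _ c1, of 1] E(2)] by simp
  ultimately show ?case using E' by blast
qed

end

section \<open>Approximate annihilators of degree n\<close>

text \<open>The relation \<open>rho x T\<close> says that \<open>x \<in> A\<close> and the matrix \<open>T\<close> over \<open>D\<close> have the same image in
  \<open>M\<^sub>n(D/P\<^sup>N)\<close> under a fixed isomorphism \<open>A/P\<^sup>NA \<cong> M\<^sub>n(D/P\<^sup>N)\<close>. A relation makes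
  the choice of representatives on either side unnecessary.\<close>

locale matrix_reduction = local_algebra D A P p
  for D :: "'k::field set" and A :: "('k, 'a) module" (structure) and P and p +
  fixes n N :: nat and rho :: "'a \<Rightarrow> 'k mat \<Rightarrow> bool"
  assumes n_pos: "n \<ge> 1" and N_pos: "N \<ge> 1"
    and rho_carrier: "rho x T \<Longrightarrow> x \<in> carrier A" "rho x T \<Longrightarrow> T \<in> carrier (mat_algebra n (ring_of D))"
    and rho_left_total: "x \<in> carrier A \<Longrightarrow> \<exists>T. rho x T"
    and rho_right_total: "T \<in> carrier (mat_algebra n (ring_of D)) \<Longrightarrow> \<exists>x. rho x T"
    and rho_add: "\<lbrakk>rho x T; rho y S\<rbrakk> \<Longrightarrow> rho (x \<oplus> y) (T + S)"
    and rho_mult: "\<lbrakk>rho x T; rho y S\<rbrakk> \<Longrightarrow> rho (x \<otimes> y) (T * S)"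
    and rho_smult: "\<lbrakk>rho x T; c \<in> D\<rbrakk> \<Longrightarrow> rho (c \<odot> x) (c \<cdot>\<^sub>m T)"
    and rho_one: "rho \<one> (1\<^sub>m n)"
    and rho_cong: "\<lbrakk>rho x T; rho y T\<rbrakk> \<Longrightarrow> x \<ominus> y \<in> adic N"
    and rho_unique: "\<lbrakk>rho x T; rho x S; i < n; j < n\<rbrakk> \<Longrightarrow> T $$ (i, j) - S $$ (i, j) \<in> P"
begin

lemma rho_adic_cong: "rho x T \<Longrightarrow> rho y T \<Longrightarrow> adic_cong N x y"
  using rho_cong rho_carrier unfolding adic_cong_def by blast

lemma rho_adic_cong1: "rho x T \<Longrightarrow> rho y T \<Longrightarrow> adic_cong 1 x y"
  using adic_cong_mono[OF N_pos rho_adic_cong] .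

lemma rho_zero: "rho \<zero> (0\<^sub>m n n)"
proof -
  have "rho (0 \<odot> \<one>) (0 \<cdot>\<^sub>m 1\<^sub>m n)" using rho_smult[OF rho_one D.zero_mem] .
  moreover have "0 \<cdot>\<^sub>m 1\<^sub>m n = (0\<^sub>m n n :: 'k mat)" by (intro eq_matI) auto
  ultimately show ?thesis by simp
qed

lemma rho_finsum:
  assumes "finite I" "\<And>i. i \<in> I \<Longrightarrow> rho (x i) (T i)"
  shows "rho (\<Oplus>i\<in>I. x i) (mat n n (\<lambda>(a, b). \<Sum>i\<in>I. T i $$ (a, b)))"
  using assms
proof (induction I rule: finite_induct)
  case empty
  have "mat n n (\<lambda>a. 0) = (0\<^sub>m n n :: 'k mat)" by (intro eq_matI) auto
  then show ?case using rho_zero by simp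
next
  case (insert j I)
  have c: "x \<in> insert j I \<rightarrow> carrier A" using rho_carrier(1) insert.prems by blast
  have "rho (x j \<oplus> (\<Oplus>i\<in>I. x i)) (T j + mat n n (\<lambda>(a, b). \<Sum>i\<in>I. T i $$ (a, b)))"
    by (rule rho_add[OF insert.prems[of j] insert.IH]) (use insert.prems in auto)
  moreover have "T j + mat n n (\<lambda>(a, b). \<Sum>i\<in>I. T i $$ (a, b)) = mat n n (\<lambda>(a, b). \<Sum>i\<in>insert j I. T i $$ (a, b))"
    using insert rho_carrier(2)[of "x j" "T j"] by (intro eq_matI) (auto simp: D.mat_algebra_carrier)
  moreover have "(\<Oplus>i\<in>insert j I. x i) = x j \<oplus> (\<Oplus>i\<in>I. x i)"
    using insert.hyps c by (intro M.finsum_insert) auto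
  ultimately show ?case by (simp only:)
qed

definition unit_mat :: "nat \<Rightarrow> nat \<Rightarrow> 'k mat" where
  "unit_mat i j = mat n n (\<lambda>(a, b). if a = i \<and> b = j then 1 else 0)"

lemma unit_mat_carrier: "unit_mat i j \<in> carrier (mat_algebra n (ring_of D))"
  by (auto simp: unit_mat_def D.mat_algebra_carrier)

lemma unit_mat_mult:
  assumes "k < n"
  shows "unit_mat i k * unit_mat k j = unit_mat i j"
proof (rule eq_matI)
  fix a b assume "a < dim_row (unit_mat i j)" "b < dim_col (unit_mat i j)"
  then have ab: "a < n" "b < n" by (auto simp: unit_mat_def)
  then have "(unit_mat i k * unit_mat k j) $$ (a, b)
      = (\<Sum>l\<in>{0..<n}. (if a = i \<and> l = k then 1 else 0) * (if l = k \<and> b = j then 1 else 0))"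
    by (simp add: unit_mat_def scalar_prod_def)
  also have "\<dots> = (\<Sum>l\<in>{0..<n}. if l = k then (if a = i \<and> b = j then 1 else 0) else 0)"
    by (intro sum.cong) auto
  finally show "(unit_mat i k * unit_mat k j) $$ (a, b) = unit_mat i j $$ (a, b)"
    using ab assms by (simp add: unit_mat_def)
qed (auto simp: unit_mat_def)

lemma matrix_units:
  obtains eL eR e0 where "\<And>i. rho (eL i) (unit_mat i 0)" "\<And>i. rho (eR i) (unit_mat 0 i)" "rho e0 (unit_mat 0 0)"
proof -
  have "\<exists>f. \<forall>i j. rho (f i j) (unit_mat i j)"
    using rho_right_total[OF unit_mat_carrier] by (intro choice allI)
  then obtain f where "\<And>i j. rho (f i j) (unit_mat i j)" by blast
  then show ?thesis using that[of "\<lambda>i. f i 0" "\<lambda>i. f 0 i" "f 0 0"] by blast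
qed

text \<open>Right multiplication by \<open>E\<^sub>0\<^sub>0\<close> keeps only the first column of a matrix.\<close>

lemma first_column:
  assumes eL: "\<And>i. rho (eL i) (unit_mat i 0)" and e0: "rho e0 (unit_mat 0 0)" and b: "b \<in> carrier A"
  obtains d where "\<And>i. d i \<in> D" "adic_cong 1 (b \<otimes> e0) (\<Oplus>i\<in>{..<n}. d i \<odot> eL i)"
proof -
  obtain T where T: "rho b T" using rho_left_total[OF b] by blast
  then have Tc: "T \<in> carrier_mat n n" "\<And>i j. i < n \<Longrightarrow> j < n \<Longrightarrow> T $$ (i, j) \<in> D"
    using rho_carrier(2) by (auto simp: D.mat_algebra_carrier)
  define d where "d i = (if i < n then T $$ (i, 0) else 0)" for i
  have d: "d i \<in> D" for i using Tc n_pos by (simp add: d_def)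
  have 1: "rho (b \<otimes> e0) (T * unit_mat 0 0)" using rho_mult[OF T e0] .
  have 2: "rho (\<Oplus>i\<in>{..<n}. d i \<odot> eL i) (mat n n (\<lambda>(a, c). \<Sum>i\<in>{..<n}. (d i \<cdot>\<^sub>m unit_mat i 0) $$ (a, c)))"
    using d eL by (intro rho_finsum rho_smult) auto
  have "T * unit_mat 0 0 = mat n n (\<lambda>(a, c). \<Sum>i\<in>{..<n}. (d i \<cdot>\<^sub>m unit_mat i 0) $$ (a, c))"
  proof (rule eq_matI)
    fix a c assume "a < dim_row (mat n n (\<lambda>(a, c). \<Sum>i\<in>{..<n}. (d i \<cdot>\<^sub>m unit_mat i 0) $$ (a, c)))"
      "c < dim_col (mat n n (\<lambda>(a, c). \<Sum>i\<in>{..<n}. (d i \<cdot>\<^sub>m unit_mat i 0) $$ (a, c)))"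
    then have ac: "a < n" "c < n" by auto
    have "(T * unit_mat 0 0) $$ (a, c) = (\<Sum>l\<in>{0..<n}. T $$ (a, l) * (if l = 0 \<and> c = 0 then 1 else 0))"
      using ac Tc by (simp add: unit_mat_def scalar_prod_def)
    also have "\<dots> = (\<Sum>l\<in>{0..<n}. if l = 0 then (if c = 0 then T $$ (a, 0) else 0) else 0)"
      by (intro sum.cong) auto
    also have "\<dots> = (if c = 0 then d a else 0)" using n_pos ac by (simp add: d_def)
    also have "\<dots> = (\<Sum>i\<in>{..<n}. if i = a then (if c = 0 then d a else 0) else 0)" using ac by simp
    also have "\<dots> = (\<Sum>i\<in>{..<n}. (d i \<cdot>\<^sub>m unit_mat i 0) $$ (a, c))"
      using ac by (intro sum.cong) (auto simp: unit_mat_def)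
    finally show "(T * unit_mat 0 0) $$ (a, c) = mat n n (\<lambda>(a, c). \<Sum>i\<in>{..<n}. (d i \<cdot>\<^sub>m unit_mat i 0) $$ (a, c)) $$ (a, c)"
      using ac by simp
  qed (use Tc in \<open>auto simp: unit_mat_def\<close>)
  then have "adic_cong 1 (b \<otimes> e0) (\<Oplus>i\<in>{..<n}. d i \<odot> eL i)" using rho_adic_cong1[OF 1] 2 by simp
  then show ?thesis using that d by blast
qed

text \<open>The two-sided ideal generated by \<open>E\<^sub>0\<^sub>0\<close> contains the identity, since \<open>E\<^sub>i\<^sub>0 E\<^sub>0\<^sub>0 E\<^sub>0\<^sub>i = E\<^sub>i\<^sub>i\<close>.\<close>

lemma unit_decomposition:
  assumes eL: "\<And>i. rho (eL i) (unit_mat i 0)" and eR: "\<And>i. rho (eR i) (unit_mat 0 i)" and e0: "rho e0 (unit_mat 0 0)"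
  shows "adic_cong 1 (\<Oplus>i\<in>{..<n}. (eL i \<otimes> e0) \<otimes> eR i) \<one>"
proof -
  have "rho ((eL i \<otimes> e0) \<otimes> eR i) (unit_mat i i)" for i
    using rho_mult[OF rho_mult[OF eL e0] eR, of i i] n_pos by (simp add: unit_mat_mult)
  then have "rho (\<Oplus>i\<in>{..<n}. (eL i \<otimes> e0) \<otimes> eR i) (mat n n (\<lambda>(a, c). \<Sum>i\<in>{..<n}. unit_mat i i $$ (a, c)))"
    by (intro rho_finsum) auto
  moreover have "mat n n (\<lambda>(a, c). \<Sum>i\<in>{..<n}. unit_mat i i $$ (a, c)) = 1\<^sub>m n"
  proof (rule eq_matI)
    fix a c assume "a < dim_row (1\<^sub>m n)" "c < dim_col (1\<^sub>m n)"
    then have ac: "a < n" "c < n" by auto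
    have "(\<Sum>i\<in>{..<n}. unit_mat i i $$ (a, c)) = (\<Sum>i\<in>{..<n}. if i = a then (if a = c then 1 else 0) else 0)"
      using ac by (intro sum.cong) (auto simp: unit_mat_def)
    then show "mat n n (\<lambda>(a, c). \<Sum>i\<in>{..<n}. unit_mat i i $$ (a, c)) $$ (a, c) = (1\<^sub>m n :: 'k mat) $$ (a, c)"
      using ac by simp
  qed auto
  ultimately show ?thesis using rho_adic_cong1[OF _ rho_one] by simp
qed

lemma finsum_smult_add:
  assumes "\<And>i. i \<in> I \<Longrightarrow> c i \<in> D" "\<And>i. i \<in> I \<Longrightarrow> d i \<in> D" "\<And>i. i \<in> I \<Longrightarrow> v i \<in> carrier A" "t \<in> D"
  shows "(\<Oplus>i\<in>I. (c i + t * d i) \<odot> v i) = (\<Oplus>i\<in>I. c i \<odot> v i) \<oplus> t \<odot> (\<Oplus>i\<in>I. d i \<odot> v i)"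
proof -
  have "(\<Oplus>i\<in>I. (c i + t * d i) \<odot> v i) = (\<Oplus>i\<in>I. c i \<odot> v i \<oplus> t \<odot> (d i \<odot> v i))"
    using assms by (intro M.finsum_cong') (auto simp: smult_add_left smult_smult D.mult_mem)
  also have "\<dots> = (\<Oplus>i\<in>I. c i \<odot> v i) \<oplus> (\<Oplus>i\<in>I. t \<odot> (d i \<odot> v i))"
    using assms by (intro M.finsum_addf) auto
  also have "(\<Oplus>i\<in>I. t \<odot> (d i \<odot> v i)) = t \<odot> (\<Oplus>i\<in>I. d i \<odot> v i)"
    using assms by (intro smult_finsum[symmetric]) auto
  finally show ?thesis .
qed

text \<open>Nakayama's lemma for the left ideal generated by \<open>E\<close> modulo \<open>p\<^sup>k\<close>. Modulo \<open>p\<close> this is the first-column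
  module of the matrix algebra, spanned by the \<open>n\<close> matrix units \<open>E\<^sub>i\<^sub>0\<close>. The error of an approximation
  is \<open>p\<^sup>j\<close> times an element of the left ideal again, because \<open>E\<close> is idempotent modulo \<open>p\<^sup>k\<close>, so the
  approximation can be repeated until \<open>j = k\<close>.\<close>

lemma column_module_generated:
  assumes eL: "\<And>i. rho (eL i) (unit_mat i 0)" and e0: "rho e0 (unit_mat 0 0)"
    and E: "E \<in> carrier A" "adic_cong 1 E e0" "adic_cong k (E \<otimes> E) E" and x: "x \<in> carrier A"
  obtains d where "\<And>i. d i \<in> D" "adic_cong k (x \<otimes> E) (\<Oplus>i\<in>{..<n}. d i \<odot> (eL i \<otimes> E))"
proof -
  have eLc: "eL i \<in> carrier A" for i using rho_carrier(1)[OF eL] .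
  define v where "v i = eL i \<otimes> E" for i
  have v: "v i \<in> carrier A" for i using eLc E(1) by (simp add: v_def)
  define sm where "sm d = (\<Oplus>i\<in>{..<n}. d i \<odot> v i)" for d
  have sm: "sm d \<in> carrier A" if "\<And>i. d i \<in> D" for d
    unfolding sm_def using v that by (intro M.finsum_closed) auto
  have step: "\<exists>d b'. (\<forall>i. d i \<in> D) \<and> b' \<in> carrier A \<and> adic_cong k (b \<otimes> E) (sm d \<oplus> p \<odot> (b' \<otimes> E))"
    if b: "b \<in> carrier A" for b
  proof -
    obtain d where d: "\<And>i. d i \<in> D" "adic_cong 1 (b \<otimes> e0) (\<Oplus>i\<in>{..<n}. d i \<odot> eL i)"
      using first_column[OF eL e0 b] by blast
    define s where "s = (\<Oplus>i\<in>{..<n}. d i \<odot> eL i)"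
    have s: "s \<in> carrier A" using adic_cong_carrier(2)[OF d(2)] by (simp add: s_def)
    have "adic_cong 1 (b \<otimes> E) s"
      using adic_cong_trans[OF adic_cong_mult[OF adic_cong_refl[OF b] E(2)] d(2)] by (simp add: s_def)
    then have w: "b \<otimes> E \<ominus> s \<in> adic 1" by (simp add: adic_cong_def)
    obtain b' where b': "b' \<in> carrier A" "b \<otimes> E \<ominus> s \<ominus> (p ^ 1) \<odot> b' \<in> adic k"
      using adic_approx[OF w] by blast
    have "adic_cong k (b \<otimes> E \<ominus> s) (p \<odot> b')" using b' b s E(1) p_D by (simp add: adic_cong_def)
    then have "adic_cong k (s \<oplus> (b \<otimes> E \<ominus> s)) (s \<oplus> p \<odot> b')" using adic_cong_add[OF adic_cong_refl[OF s]] by blast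
    then have "adic_cong k (b \<otimes> E) (s \<oplus> p \<odot> b')" using A.minus_rules(5)[of "b \<otimes> E" s] b s E(1) by simp
    then have "adic_cong k (b \<otimes> E \<otimes> E) ((s \<oplus> p \<odot> b') \<otimes> E)" using adic_cong_mult[OF _ adic_cong_refl[OF E(1)]] by blast
    moreover have "adic_cong k (b \<otimes> E) (b \<otimes> (E \<otimes> E))" using adic_cong_mult[OF adic_cong_refl[OF b] adic_cong_sym[OF E(3)]] .
    moreover have "b \<otimes> (E \<otimes> E) = b \<otimes> E \<otimes> E" using b E(1) by (simp add: A.m_assoc)
    ultimately have "adic_cong k (b \<otimes> E) ((s \<oplus> p \<odot> b') \<otimes> E)" using adic_cong_trans by simp
    moreover have "(s \<oplus> p \<odot> b') \<otimes> E = s \<otimes> E \<oplus> p \<odot> (b' \<otimes> E)"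
      using s b'(1) E(1) p_D by (simp add: A.l_distr mult_smult_left)
    moreover have "s \<otimes> E = sm d"
    proof -
      have "s \<otimes> E = (\<Oplus>i\<in>{..<n}. (d i \<odot> eL i) \<otimes> E)"
        unfolding s_def using eLc d(1) E(1) by (intro A.finsum_ldistr) auto
      also have "\<dots> = sm d"
        unfolding sm_def v_def using eLc d(1) E(1) by (intro M.finsum_cong') (auto simp: mult_smult_left)
      finally show ?thesis .
    qed
    ultimately have "adic_cong k (b \<otimes> E) (sm d \<oplus> p \<odot> (b' \<otimes> E))" by simp
    then show ?thesis using d(1) b'(1) by blast
  qed
  have "\<exists>d b. (\<forall>i. d i \<in> D) \<and> b \<in> carrier A \<and> adic_cong k (x \<otimes> E) (sm d \<oplus> (p ^ j) \<odot> (b \<otimes> E))" for j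
  proof (induction j)
    case 0
    have "sm (\<lambda>_. 0) = \<zero>" unfolding sm_def using v by (simp add: M.finsum_cong'[of _ _ "\<lambda>_. \<zero>"])
    then show ?case using x E(1) adic_cong_refl[of "x \<otimes> E" k]
      by (intro exI[of _ "\<lambda>_. 0"] exI[of _ x]) simp
  next
    case (Suc j)
    then obtain d b where d: "\<And>i. d i \<in> D" and b: "b \<in> carrier A"
      and c: "adic_cong k (x \<otimes> E) (sm d \<oplus> (p ^ j) \<odot> (b \<otimes> E))" by blast
    obtain d' b' where d': "\<And>i. d' i \<in> D" and b': "b' \<in> carrier A"
      and c': "adic_cong k (b \<otimes> E) (sm d' \<oplus> p \<odot> (b' \<otimes> E))" using step[OF b] by blast
    have "adic_cong k ((p ^ j) \<odot> (b \<otimes> E)) ((p ^ j) \<odot> (sm d' \<oplus> p \<odot> (b' \<otimes> E)))"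
      by (rule adic_cong_smult[OF c' p_pow_D])
    then have "adic_cong k (sm d \<oplus> (p ^ j) \<odot> (b \<otimes> E)) (sm d \<oplus> (p ^ j) \<odot> (sm d' \<oplus> p \<odot> (b' \<otimes> E)))"
      by (rule adic_cong_add[OF adic_cong_refl[OF sm[OF d]]])
    with c have "adic_cong k (x \<otimes> E) (sm d \<oplus> (p ^ j) \<odot> (sm d' \<oplus> p \<odot> (b' \<otimes> E)))" by (rule adic_cong_trans)
    also have "(p ^ j) \<odot> (sm d' \<oplus> p \<odot> (b' \<otimes> E)) = (p ^ j) \<odot> sm d' \<oplus> (p ^ Suc j) \<odot> (b' \<otimes> E)"
      using sm[OF d'] b' E(1) p_D smult_smult[OF p_pow_D p_D, of "b' \<otimes> E" j]
      by (simp add: smult_add_right mult.commute)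
    also have "sm d \<oplus> ((p ^ j) \<odot> sm d' \<oplus> (p ^ Suc j) \<odot> (b' \<otimes> E))
        = sm d \<oplus> (p ^ j) \<odot> sm d' \<oplus> (p ^ Suc j) \<odot> (b' \<otimes> E)"
      using sm[OF d] sm[OF d'] b' E(1) p_pow_D[of "Suc j"] by (simp add: M.a_assoc del: power_Suc)
    also have "sm d \<oplus> (p ^ j) \<odot> sm d' = sm (\<lambda>i. d i + p ^ j * d' i)"
      unfolding sm_def using finsum_smult_add[of "{..<n}" d d' v "p ^ j"] d d' v by simp
    finally have "adic_cong k (x \<otimes> E) (sm (\<lambda>i. d i + p ^ j * d' i) \<oplus> (p ^ Suc j) \<odot> (b' \<otimes> E))" .
    moreover have "d i + p ^ j * d' i \<in> D" for i
      by (rule D.add_mem[OF d D.mult_mem[OF p_pow_D d']])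
    ultimately show ?case using b' by (intro exI[of _ "\<lambda>i. d i + p ^ j * d' i"] exI[of _ b'] conjI allI)
  qed
  then obtain d b where d: "\<And>i. d i \<in> D" and b: "b \<in> carrier A"
    and c: "adic_cong k (x \<otimes> E) (sm d \<oplus> (p ^ k) \<odot> (b \<otimes> E))" by blast
  have "adic_cong k ((p ^ k) \<odot> (b \<otimes> E)) \<zero>" using adic_p_pow[of "b \<otimes> E" k] b E(1) by (simp add: adic_cong_zero)
  then have "adic_cong k (sm d \<oplus> (p ^ k) \<odot> (b \<otimes> E)) (sm d \<oplus> \<zero>)"
    by (rule adic_cong_add[OF adic_cong_refl[OF sm[OF d]]])
  with c have "adic_cong k (x \<otimes> E) (sm d \<oplus> \<zero>)" by (rule adic_cong_trans)
  then have "adic_cong k (x \<otimes> E) (sm d)" using sm[OF d] by simp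
  then show ?thesis using that[of d] d unfolding sm_def v_def by blast
qed

text \<open>The determinant trick for \<open>a\<close> acting on the left ideal generated by a lifted idempotent \<open>E\<close>. The resulting
  value \<open>z\<close> kills this left ideal modulo \<open>p\<^sup>k\<close>. Now \<open>u = \<Sum>\<^sub>i v\<^sub>i E\<^sub>0\<^sub>i\<close> is congruent to \<open>1\<close> modulo
  \<open>p\<close>, and \<open>z = zu + z(1 - u)\<close> shows step by step that \<open>z\<close> is divisible by higher powers of \<open>p\<close>.\<close>

theorem approximate_annihilator:
  assumes a: "a \<in> carrier A"
  obtains m where "poly_over D m" "Polynomial.degree m = n" "Polynomial.lead_coeff m = 1" "ev m a \<in> adic k"
proof -
  obtain eL eR e0 where eL: "\<And>i. rho (eL i) (unit_mat i 0)" and eR: "\<And>i. rho (eR i) (unit_mat 0 i)"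
    and e0: "rho e0 (unit_mat 0 0)" using matrix_units by blast
  have eLc: "eL i \<in> carrier A" for i using rho_carrier(1)[OF eL] .
  have eRc: "eR i \<in> carrier A" for i using rho_carrier(1)[OF eR] .
  have e0c: "e0 \<in> carrier A" using rho_carrier(1)[OF e0] .
  have "rho (e0 \<otimes> e0) (unit_mat 0 0)" using rho_mult[OF e0 e0] n_pos by (simp add: unit_mat_mult)
  then have "e0 \<otimes> e0 \<ominus> e0 \<in> adic 1" using rho_adic_cong1[OF _ e0] by (auto simp: adic_cong_def)
  then obtain E where E: "E \<in> carrier A" "adic_cong 1 E e0" "adic_cong (Suc k) (E \<otimes> E) E"
    using lift_idempotent[OF e0c] by blast
  have E3: "adic_cong k (E \<otimes> E) E" using adic_cong_mono[OF _ E(3)] by simp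
  define v where "v i = eL i \<otimes> E" for i
  have v: "v i \<in> carrier A" for i using eLc E(1) by (simp add: v_def)
  have "\<exists>d. (\<forall>i. d i \<in> D) \<and> adic_cong k (a \<otimes> v j) (\<Oplus>i\<in>{..<n}. d i \<odot> v i)" for j
  proof -
    obtain d where "\<And>i. d i \<in> D" "adic_cong k ((a \<otimes> eL j) \<otimes> E) (\<Oplus>i\<in>{..<n}. d i \<odot> (eL i \<otimes> E))"
      using column_module_generated[OF eL e0 E(1,2) E3, of "a \<otimes> eL j"] a eLc by blast
    moreover have "(a \<otimes> eL j) \<otimes> E = a \<otimes> (eL j \<otimes> E)" using a eLc E(1) by (simp add: A.m_assoc)
    ultimately show ?thesis unfolding v_def by auto
  qed
  then obtain d where d: "\<And>j i. d j i \<in> D" "\<And>j. adic_cong k (a \<otimes> v j) (\<Oplus>i\<in>{..<n}. d j i \<odot> v i)" by metis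
  define T where "T = mat n n (\<lambda>(j, i). d j i)"
  have T: "T \<in> carrier_mat n n" "\<And>i j. i < n \<Longrightarrow> j < n \<Longrightarrow> T $$ (i, j) \<in> D" using d by (auto simp: T_def)
  define z where "z = ev (char_poly T) a"
  have over: "poly_over D (char_poly T)" by (rule D.char_poly_over[OF T])
  have z: "z \<in> carrier A" using over a by (simp add: z_def)
  have zv: "z \<otimes> v i \<in> adic k" if "i < n" for i
    unfolding z_def
  proof (rule determinant_trick[where v = v and N = n, OF a v T])
    fix j assume j: "j < n"
    have "(\<Oplus>l\<in>{..<n}. T $$ (j, l) \<odot> v l) = (\<Oplus>l\<in>{..<n}. d j l \<odot> v l)"
      using j d v by (intro M.finsum_cong') (auto simp: T_def)
    then show "a \<otimes> v j \<ominus> (\<Oplus>l\<in>{..<n}. T $$ (j, l) \<odot> v l) \<in> adic k" using d(2)[of j] by (simp add: adic_cong_def)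
  qed (use that adic_carrier adic_add adic_lmult in auto)
  define u where "u = (\<Oplus>i\<in>{..<n}. v i \<otimes> eR i)"
  have u: "u \<in> carrier A" unfolding u_def using v eRc by (intro M.finsum_closed) auto
  have "z \<otimes> u = (\<Oplus>i\<in>{..<n}. z \<otimes> (v i \<otimes> eR i))"
    unfolding u_def using v eRc z by (intro A.finsum_rdistr) auto
  also have "\<dots> \<in> adic k"
  proof (rule finsum_mem_subgroup)
    fix i assume "i \<in> {..<n}"
    then have "z \<otimes> v i \<otimes> eR i \<in> adic k" using adic_rmult[OF zv eRc] by simp
    then show "z \<otimes> (v i \<otimes> eR i) \<in> adic k" using z v eRc by (simp add: A.m_assoc)
  qed (use adic_carrier adic_add in auto)
  finally have zu: "z \<otimes> u \<in> adic k" .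
  have "adic_cong 1 u (\<Oplus>i\<in>{..<n}. (eL i \<otimes> e0) \<otimes> eR i)"
    unfolding u_def v_def using adic_cong_refl[OF eLc] adic_cong_refl[OF eRc] E(2)
    by (intro adic_cong_finsum adic_cong_mult) auto
  then have "adic_cong 1 u \<one>" using unit_decomposition[OF eL eR e0] by (rule adic_cong_trans)
  then have u1: "\<one> \<ominus> u \<in> adic 1" using adic_cong_sym[of 1 u \<one>] by (simp add: adic_cong_def)
  have zz: "z = z \<otimes> u \<oplus> z \<otimes> (\<one> \<ominus> u)"
    using z u A.minus_rules(5)[of \<one> u] A.r_distr[of u "\<one> \<ominus> u" z] by simp
  have "z \<in> adic j" if "j \<le> k" for j
    using that
  proof (induction j)
    case 0
    then show ?case using z by (simp add: adic_zero_exponent)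
  next
    case (Suc j)
    then have "z \<otimes> (\<one> \<ominus> u) \<in> adic (j + 1)" by (intro adic_mult u1) simp
    moreover have "z \<otimes> u \<in> adic (Suc j)" using adic_mono[OF Suc.prems zu] .
    ultimately show ?case using zz adic_add by (metis Suc_eq_plus1)
  qed
  then have "z \<in> adic k" by simp
  then show ?thesis
    using that[OF over] degree_monic_char_poly[OF T(1)] by (simp add: z_def)
qed

end

section \<open>Annihilators of degree n\<close>

context torsion_free_algebra_over
begin

definition linear_on :: "'a set \<Rightarrow> ('a \<Rightarrow> 'k) \<Rightarrow> bool" where
  "linear_on N f \<longleftrightarrow> N \<subseteq> carrier A \<and> \<zero> \<in> N \<and> (\<forall>x\<in>N. \<forall>y\<in>N. x \<oplus> y \<in> N \<and> f (x \<oplus> y) = f x + f y) \<and>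
    (\<forall>c\<in>D. \<forall>x\<in>N. c \<odot> x \<in> N \<and> f (c \<odot> x) = c * f x)"

lemma linear_onD:
  assumes "linear_on N f"
  shows "x \<in> N \<Longrightarrow> x \<in> carrier A" "\<zero> \<in> N" "x \<in> N \<Longrightarrow> y \<in> N \<Longrightarrow> x \<oplus> y \<in> N"
    "x \<in> N \<Longrightarrow> y \<in> N \<Longrightarrow> f (x \<oplus> y) = f x + f y" "c \<in> D \<Longrightarrow> x \<in> N \<Longrightarrow> c \<odot> x \<in> N"
    "c \<in> D \<Longrightarrow> x \<in> N \<Longrightarrow> f (c \<odot> x) = c * f x"
  using assms unfolding linear_on_def by blast+

lemma linear_on_diff:
  assumes "linear_on N f" "x \<in> N" "y \<in> N"
  shows "x \<ominus> y \<in> N" "f (x \<ominus> y) = f x - f y"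
proof -
  have m: "- 1 \<in> D" by (simp add: D.uminus_mem)
  have "x \<ominus> y = x \<oplus> (- 1) \<odot> y"
    using linear_onD(1)[OF assms(1)] assms(2,3) by (simp add: smult_uminus_left M.minus_eq)
  then show "x \<ominus> y \<in> N" "f (x \<ominus> y) = f x - f y"
    using linear_onD(3,4)[OF assms(1) assms(2) linear_onD(5)[OF assms(1) m assms(3)]]
      linear_onD(6)[OF assms(1) m assms(3)] by simp_all
qed

text \<open>\<open>K\<close> is an injective \<open>D\<close>-module: if a nonzero multiple \<open>cs\<close> lies in \<open>N\<close>, the value at \<open>s\<close> must be
  \<open>f(cs)/c\<close>, and otherwise every value is possible.\<close>

lemma linear_on_extend1:
  assumes f: "linear_on N f" and s: "s \<in> carrier A"
  obtains N' f' where "linear_on N' f'" "N \<subseteq> N'" "s \<in> N'" "\<And>x. x \<in> N \<Longrightarrow> f' x = f x"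
proof -
  note lin = linear_onD[OF f]
  \<comment> \<open>The value \<open>t\<close> that the extension takes at \<open>s\<close>.\<close>
  have "\<exists>t. \<forall>c\<in>D. c \<odot> s \<in> N \<longrightarrow> f (c \<odot> s) = c * t"
  proof (cases "\<exists>c\<in>D. c \<noteq> 0 \<and> c \<odot> s \<in> N")
    case True
    then obtain c where c: "c \<in> D" "c \<noteq> 0" "c \<odot> s \<in> N" by blast
    have "f (e \<odot> s) = e * (f (c \<odot> s) / c)" if e: "e \<in> D" "e \<odot> s \<in> N" for e
    proof -
      have "c * f (e \<odot> s) = f (c \<odot> (e \<odot> s))" using lin(6)[OF c(1) e(2)] by simp
      also have "c \<odot> (e \<odot> s) = e \<odot> (c \<odot> s)" using c e s by (simp add: smult_smult mult.commute[of e c])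
      also have "f \<dots> = e * f (c \<odot> s)" using lin(6)[OF e(1) c(3)] .
      finally show ?thesis using c(2) by (simp add: field_simps)
    qed
    then show ?thesis by blast
  next
    case False
    have "f (c \<odot> s) = c * 0" if "c \<in> D" "c \<odot> s \<in> N" for c
    proof -
      have c0: "c = 0" using False that by blast
      have "f (0 \<odot> \<zero>) = 0 * f \<zero>" by (rule lin(6)[OF D.zero_mem lin(2)])
      then show ?thesis using c0 s by simp
    qed
    then show ?thesis by blast
  qed
  then obtain t where t: "\<And>c. c \<in> D \<Longrightarrow> c \<odot> s \<in> N \<Longrightarrow> f (c \<odot> s) = c * t" by blast
  define N' where "N' = {z. \<exists>x\<in>N. \<exists>e\<in>D. z = x \<oplus> e \<odot> s}"
  define f' where "f' z = (THE y. \<exists>x\<in>N. \<exists>e\<in>D. z = x \<oplus> e \<odot> s \<and> y = f x + e * t)" for z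
  have f': "f' (x \<oplus> e \<odot> s) = f x + e * t" if x: "x \<in> N" "e \<in> D" for x e
    unfolding f'_def
  proof (rule the_equality)
    show "\<exists>x'\<in>N. \<exists>e'\<in>D. x \<oplus> e \<odot> s = x' \<oplus> e' \<odot> s \<and> f x + e * t = f x' + e' * t" using x by blast
    fix y assume "\<exists>x'\<in>N. \<exists>e'\<in>D. x \<oplus> e \<odot> s = x' \<oplus> e' \<odot> s \<and> y = f x' + e' * t"
    then obtain x' e' where x': "x' \<in> N" "e' \<in> D" "x \<oplus> e \<odot> s = x' \<oplus> e' \<odot> s" "y = f x' + e' * t" by blast
    have c: "x \<in> carrier A" "x' \<in> carrier A" "e \<odot> s \<in> carrier A" "e' \<odot> s \<in> carrier A"
      using x x' s lin(1) by auto
    have "x \<ominus> x' = (x \<oplus> e \<odot> s) \<ominus> (x' \<oplus> e \<odot> s)"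
      using c A.minus_rules(3)[of x "e \<odot> s" x' "e \<odot> s"] by (simp add: M.minus_eq M.r_neg)
    also have "\<dots> = (x' \<oplus> e' \<odot> s) \<ominus> (x' \<oplus> e \<odot> s)" using x'(3) by simp
    also have "\<dots> = e' \<odot> s \<ominus> e \<odot> s"
      using c A.minus_rules(3)[of x' "e' \<odot> s" x' "e \<odot> s"] by (simp add: M.minus_eq M.r_neg)
    also have "\<dots> = (e' - e) \<odot> s" using x(2) x'(2) s by (simp add: smult_diff_left)
    finally have eq: "x \<ominus> x' = (e' - e) \<odot> s" .
    have "f x - f x' = (e' - e) * t"
      using linear_on_diff[OF f x(1) x'(1)] t[of "e' - e"] eq D.diff_mem[OF x'(2) x(2)] by simp
    then show "y = f x + e * t" using x'(4) by (simp add: algebra_simps)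
  qed
  have zero: "x = x \<oplus> 0 \<odot> s" if "x \<in> N" for x using that s lin(1) by simp
  have add: "(x \<oplus> e \<odot> s) \<oplus> (x' \<oplus> e' \<odot> s) = (x \<oplus> x') \<oplus> (e + e') \<odot> s" if "x \<in> N" "x' \<in> N" "e \<in> D" "e' \<in> D" for x x' e e'
    using that s lin(1) by (simp add: smult_add_left M.a_ac)
  have mult: "c \<odot> (x \<oplus> e \<odot> s) = c \<odot> x \<oplus> (c * e) \<odot> s" if "x \<in> N" "c \<in> D" "e \<in> D" for x c e
    using that s lin(1) by (simp add: smult_add_right smult_smult)
  have "linear_on N' f'"
    unfolding linear_on_def
  proof (intro conjI ballI)
    show "N' \<subseteq> carrier A" using s lin(1) by (auto simp: N'_def)
    show "\<zero> \<in> N'" unfolding N'_def using zero[OF lin(2)] lin(2) D.zero_mem by blast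
  next
    fix z z' assume "z \<in> N'" "z' \<in> N'"
    then obtain x e x' e' where z: "x \<in> N" "e \<in> D" "z = x \<oplus> e \<odot> s" "x' \<in> N" "e' \<in> D" "z' = x' \<oplus> e' \<odot> s"
      unfolding N'_def by blast
    have *: "z \<oplus> z' = (x \<oplus> x') \<oplus> (e + e') \<odot> s" using add z by simp
    show "z \<oplus> z' \<in> N'" unfolding N'_def * using lin(3)[OF z(1,4)] D.add_mem[OF z(2,5)] by blast
    show "f' (z \<oplus> z') = f' z + f' z'"
      unfolding * using f'[OF lin(3)[OF z(1,4)] D.add_mem[OF z(2,5)]] f'[OF z(1,2)] f'[OF z(4,5)] lin(4)[OF z(1,4)] z(3,6)
      by (simp add: algebra_simps)
  next
    fix c z assume c: "c \<in> D" and "z \<in> N'"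
    then obtain x e where z: "x \<in> N" "e \<in> D" "z = x \<oplus> e \<odot> s" unfolding N'_def by blast
    have *: "c \<odot> z = c \<odot> x \<oplus> (c * e) \<odot> s" using mult z c by simp
    show "c \<odot> z \<in> N'" unfolding N'_def * using lin(5)[OF c z(1)] D.mult_mem[OF c z(2)] by blast
    show "f' (c \<odot> z) = c * f' z"
      unfolding * using f'[OF lin(5)[OF c z(1)] D.mult_mem[OF c z(2)]] f'[OF z(1,2)] lin(6)[OF c z(1)] z(3)
      by (simp add: algebra_simps)
  qed
  moreover have "N \<subseteq> N'" unfolding N'_def using zero D.zero_mem by blast
  moreover have "s \<in> N'"
  proof -
    have "s = \<zero> \<oplus> 1 \<odot> s" using s by simp
    then show ?thesis unfolding N'_def using lin(2) D.one_mem by blast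
  qed
  moreover have "f' x = f x" if "x \<in> N" for x using f'[OF that D.zero_mem] zero[OF that] by simp
  ultimately show ?thesis using that by blast
qed

text \<open>The generators are adjoined one at a time; a common denominator \<open>e\<close> of their values is one for all values.\<close>

lemma linear_on_extend:
  assumes "fin_gen_module (ring_of D) A" and f: "linear_on N f"
  obtains f' e where "linear_on (carrier A) f'" "\<And>x. x \<in> N \<Longrightarrow> f' x = f x"
    "e \<in> D" "e \<noteq> 0" "\<And>x. x \<in> carrier A \<Longrightarrow> e * f' x \<in> D"
proof -
  obtain S where S: "finite S" "S \<subseteq> carrier A"
    and gen: "\<And>x. x \<in> carrier A \<Longrightarrow> \<exists>r\<in>S \<rightarrow> D. x = (\<Oplus>s\<in>S. r s \<odot> s)"
    using assms(1) unfolding fin_gen_module_def by auto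
  have "\<exists>N' f'. linear_on N' f' \<and> N \<subseteq> N' \<and> S \<subseteq> N' \<and> (\<forall>x\<in>N. f' x = f x)"
    using S
  proof (induction S rule: finite_induct)
    case empty
    then show ?case using f by blast
  next
    case (insert s S)
    then obtain N' f' where I: "linear_on N' f'" "N \<subseteq> N'" "S \<subseteq> N'" "\<forall>x\<in>N. f' x = f x" by auto
    obtain N'' f'' where J: "linear_on N'' f''" "N' \<subseteq> N''" "s \<in> N''" "\<And>x. x \<in> N' \<Longrightarrow> f'' x = f' x"
      using linear_on_extend1[OF I(1), of s] insert.prems by blast
    have "N \<subseteq> N''" "insert s S \<subseteq> N''" "\<forall>x\<in>N. f'' x = f x" using I J by auto
    then show ?case using J(1) by blast
  qed
  then obtain N' f' where I: "linear_on N' f'" "N \<subseteq> N'" "S \<subseteq> N'" "\<forall>x\<in>N. f' x = f x" by blast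
  note lin = linear_onD[OF I(1)]
  have sum: "(\<Oplus>s\<in>S'. r s \<odot> s) \<in> N' \<and> f' (\<Oplus>s\<in>S'. r s \<odot> s) = (\<Sum>s\<in>S'. r s * f' s)"
    if "finite S'" "S' \<subseteq> S" "r \<in> S \<rightarrow> D" for S' r
    using that(1,2)
  proof (induction S' rule: finite_induct)
    case empty
    have "f' (0 \<odot> \<zero>) = 0 * f' \<zero>" by (rule lin(6)[OF D.zero_mem lin(2)])
    then show ?case using lin(2) by simp
  next
    case (insert s S')
    have rs: "r s \<in> D" "s \<in> N'" using insert.prems that(3) I(3) by auto
    have "r x \<odot> x \<in> carrier A" if "x \<in> insert s S'" for x
      using that insert.prems \<open>r \<in> S \<rightarrow> D\<close> S(2) by (intro smult_closed') auto
    then have "(\<Oplus>x\<in>insert s S'. r x \<odot> x) = r s \<odot> s \<oplus> (\<Oplus>x\<in>S'. r x \<odot> x)"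
      using insert.hyps by (intro M.finsum_insert) auto
    moreover have "(\<Oplus>x\<in>S'. r x \<odot> x) \<in> N'" "f' (\<Oplus>x\<in>S'. r x \<odot> x) = (\<Sum>s\<in>S'. r s * f' s)"
      using insert by auto
    ultimately show ?case
      using insert.hyps lin(3,4)[OF lin(5)[OF rs]] lin(6)[OF rs] by simp
  qed
  obtain e where e: "e \<in> D" "e \<noteq> 0" "\<And>x. x \<in> f' ` S \<Longrightarrow> e * x \<in> D"
    using common_denom[of "f' ` S"] S(1) by blast
  have all: "x \<in> N' \<and> e * f' x \<in> D" if "x \<in> carrier A" for x
  proof -
    obtain r where r: "r \<in> S \<rightarrow> D" "x = (\<Oplus>s\<in>S. r s \<odot> s)" using gen[OF \<open>x \<in> carrier A\<close>] by blast
    have "x \<in> N'" "f' x = (\<Sum>s\<in>S. r s * f' s)" using sum[OF S(1) subset_refl r(1)] r(2) by auto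
    moreover have "e * (\<Sum>s\<in>S. r s * f' s) = (\<Sum>s\<in>S. r s * (e * f' s))"
      by (simp add: sum_distrib_left mult.left_commute)
    moreover have "\<dots> \<in> D"
    proof (rule D.sum_mem)
      fix s assume s: "s \<in> S"
      show "r s * (e * f' s) \<in> D" by (rule D.mult_mem) (use r(1) e(3) s in auto)
    qed
    ultimately show ?thesis by simp
  qed
  have "N' = carrier A" using all lin(1) by blast
  then show ?thesis using that[of f' e] I e all by blast
qed

text \<open>\<open>f(a) = 0\<close> in \<open>K \<otimes>\<^sub>D A\<close> for \<open>f \<in> K[x]\<close>, after clearing denominators.\<close>

definition annihilates :: "'k poly \<Rightarrow> 'a \<Rightarrow> bool" where
  "annihilates f a \<longleftrightarrow> (\<exists>t\<in>D. t \<noteq> 0 \<and> poly_over D (Polynomial.smult t f) \<and> ev (Polynomial.smult t f) a = \<zero>)"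

lemma annihilates_over:
  assumes "poly_over D f" "a \<in> carrier A"
  shows "annihilates f a \<longleftrightarrow> ev f a = \<zero>"
proof
  assume "annihilates f a"
  then obtain t where t: "t \<in> D" "t \<noteq> 0" "ev (Polynomial.smult t f) a = \<zero>" by (auto simp: annihilates_def)
  then have "t \<odot> ev f a = \<zero>" using assms by (simp add: ev_smult)
  then show "ev f a = \<zero>" using smult_eq_zero[OF t(1) _ t(2)] assms by simp
next
  assume "ev f a = \<zero>"
  then show "annihilates f a" unfolding annihilates_def using assms D.one_mem by (intro bexI[of _ 1]) auto
qed

lemma annihilates_diff_mult:
  assumes "annihilates f a" "annihilates g a" and a: "a \<in> carrier A"
  shows "annihilates (f - h * g) a"
proof -
  obtain t where t: "t \<in> D" "t \<noteq> 0" "poly_over D (Polynomial.smult t f)" "ev (Polynomial.smult t f) a = \<zero>"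
    using assms(1) unfolding annihilates_def by blast
  obtain u where u: "u \<in> D" "u \<noteq> 0" "poly_over D (Polynomial.smult u g)" "ev (Polynomial.smult u g) a = \<zero>"
    using assms(2) unfolding annihilates_def by blast
  obtain w where w: "w \<in> D" "w \<noteq> 0" "poly_over D (Polynomial.smult w h)" using poly_common_denom .
  have uw: "u * w \<in> D" using u w D.mult_mem by blast
  have eq: "Polynomial.smult (t * (u * w)) (f - h * g)
      = Polynomial.smult (u * w) (Polynomial.smult t f) - Polynomial.smult t (Polynomial.smult w h * Polynomial.smult u g)"
    by (simp add: Polynomial.smult_diff_right mult_ac)
  have 1: "poly_over D (Polynomial.smult (u * w) (Polynomial.smult t f))"
    "poly_over D (Polynomial.smult t (Polynomial.smult w h * Polynomial.smult u g))"
    by (intro D.poly_over_smult D.poly_over_mult t u w uw)+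
  have "ev (Polynomial.smult (u * w) (Polynomial.smult t f)) a = \<zero>"
    using ev_smult[OF t(3) uw a] t(4) uw by simp
  moreover have "ev (Polynomial.smult t (Polynomial.smult w h * Polynomial.smult u g)) a = \<zero>"
    using ev_smult[OF D.poly_over_mult[OF w(3) u(3)] t(1) a] ev_mult[OF w(3) u(3) a] u(4) w a t(1) by simp
  ultimately have "ev (Polynomial.smult (t * (u * w)) (f - h * g)) a = \<zero>"
    unfolding eq using ev_diff[OF 1 a] by (simp add: M.minus_eq)
  moreover have "poly_over D (Polynomial.smult (t * (u * w)) (f - h * g))"
    unfolding eq by (rule D.poly_over_diff[OF 1])
  ultimately show ?thesis
    unfolding annihilates_def using t u w uw D.mult_mem by (intro bexI[of _ "t * (u * w)"]) auto
qed

text \<open>Division with remainder shows that a nonzero annihilator of least degree divides every other one,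
  in particular the monic \<open>q\<close> over \<open>D\<close>.\<close>

lemma minimal_polynomial_integral:
  assumes ic: "integrally_closed D" and a: "a \<in> carrier A"
    and q: "poly_over D q" "Polynomial.lead_coeff q = 1" "ev q a = \<zero>"
    and f: "f \<noteq> 0" "annihilates f a"
  obtains m where "poly_over D m" "Polynomial.lead_coeff m = 1" "ev m a = \<zero>"
    "Polynomial.degree m \<le> Polynomial.degree f"
proof -
  obtain g where g: "g \<noteq> 0 \<and> annihilates g a"
    and min: "\<And>h. h \<noteq> 0 \<and> annihilates h a \<Longrightarrow> Polynomial.degree g \<le> Polynomial.degree h"
    using f ex_has_least_nat[of "\<lambda>g. g \<noteq> 0 \<and> annihilates g a" f Polynomial.degree] by blast
  have dvd: "g dvd h" if "annihilates h a" for h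
  proof -
    have "annihilates (h - (h div g) * g) a" using annihilates_diff_mult[OF that _ a] g by blast
    then have "annihilates (h mod g) a" by (simp add: minus_div_mult_eq_mod)
    moreover have "h mod g = 0 \<or> Polynomial.degree (h mod g) < Polynomial.degree g"
      using g degree_mod_less by blast
    ultimately have "h mod g = 0" using min[of "h mod g"] by force
    then show ?thesis by auto
  qed
  define m where "m = Polynomial.smult (1 / Polynomial.lead_coeff g) g"
  have lead: "Polynomial.lead_coeff m = 1" using g by (simp add: m_def)
  have "annihilates m a"
  proof -
    have "annihilates 0 a" using a by (simp add: annihilates_over)
    then have "annihilates (0 - [:- (1 / Polynomial.lead_coeff g):] * g) a"
      using annihilates_diff_mult a g by blast
    then show ?thesis by (simp add: m_def)
  qed
  moreover have "m dvd q"
  proof -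
    have "g dvd q" using dvd q a by (simp add: annihilates_over)
    then show ?thesis using g by (simp add: m_def smult_dvd_iff)
  qed
  then have over: "poly_over D m"
    using monic_factor_over_integrally_closed[OF D.unital_subring_axioms ic frac_field q(1,2) _ lead] by blast
  moreover have "Polynomial.degree m \<le> Polynomial.degree f" using min f by (simp add: m_def)
  ultimately show ?thesis using that lead a by (simp add: annihilates_over)
qed

end

context local_algebra
begin

text \<open>Otherwise the coefficient of \<open>x\<^sup>n\<close> is a well-defined linear form on the span of \<open>1, a, \<dots>, a\<^sup>n\<close>. It extends
  to a form \<open>l'\<close> on \<open>A\<close> with common denominator \<open>e\<close>. Applied to the approximate annihilators, it shows
  that \<open>e\<close> is divisible by every power of \<open>p\<close> in \<open>D\<^sub>P\<close>.\<close>

lemma dependent_if_approximately_annihilated: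
  assumes fg: "fin_gen_module (ring_of D) A" and a: "a \<in> carrier A"
    and approx: "\<And>k. \<exists>m. poly_over D m \<and> Polynomial.degree m = n \<and> Polynomial.lead_coeff m = 1 \<and> ev m a \<in> adic k"
  shows "\<exists>f. f \<noteq> 0 \<and> Polynomial.degree f \<le> n \<and> poly_over D f \<and> ev f a = \<zero>"
proof (rule ccontr)
  assume no: "\<not> ?thesis"
  define R where "R = {f. poly_over D f \<and> Polynomial.degree f \<le> n}"
  have R: "f \<in> R \<Longrightarrow> g \<in> R \<Longrightarrow> f + g \<in> R" "f \<in> R \<Longrightarrow> g \<in> R \<Longrightarrow> f - g \<in> R" "c \<in> D \<Longrightarrow> f \<in> R \<Longrightarrow> Polynomial.smult c f \<in> R"
    "0 \<in> R" for f g c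
    using degree_smult_le[of c f]
    by (auto simp: R_def intro: D.poly_over_add D.poly_over_diff D.poly_over_smult degree_add_le degree_diff_le)
  have over: "poly_over D f" if "f \<in> R" for f using that by (simp add: R_def)
  have inj: "f = g" if "f \<in> R" "g \<in> R" "ev f a = ev g a" for f g
  proof -
    have "ev (f - g) a = \<zero>" using that over a by (simp add: ev_diff M.minus_eq M.r_neg)
    then show ?thesis using no R(2)[OF that(1,2)] by (auto simp: R_def)
  qed
  define N where "N = (\<lambda>f. ev f a) ` R"
  define l where "l x = Polynomial.coeff (THE f. f \<in> R \<and> ev f a = x) n" for x
  have l: "l (ev f a) = Polynomial.coeff f n" if "f \<in> R" for f
  proof -
    have "(THE g. g \<in> R \<and> ev g a = ev f a) = f"
      using that inj by (intro the_equality) auto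
    then show ?thesis by (simp add: l_def)
  qed
  have "linear_on N l"
    unfolding linear_on_def
  proof (intro conjI ballI)
    show "N \<subseteq> carrier A" using over a by (auto simp: N_def)
    show "\<zero> \<in> N" unfolding N_def using R(4) a by (intro image_eqI[of _ _ 0]) auto
  next
    fix x y assume "x \<in> N" "y \<in> N"
    then obtain f g where fg: "f \<in> R" "g \<in> R" "x = ev f a" "y = ev g a" by (auto simp: N_def)
    then have eq: "x \<oplus> y = ev (f + g) a" using over a by (simp add: ev_add)
    show "x \<oplus> y \<in> N" unfolding eq N_def using R(1)[OF fg(1,2)] by (rule imageI)
    show "l (x \<oplus> y) = l x + l y" unfolding eq using l[OF R(1)[OF fg(1,2)]] l[OF fg(1)] l[OF fg(2)] fg(3,4) by simp
  next
    fix c x assume c: "c \<in> D" and "x \<in> N"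
    then obtain f where f: "f \<in> R" "x = ev f a" by (auto simp: N_def)
    then have eq: "c \<odot> x = ev (Polynomial.smult c f) a" using over a c by (simp add: ev_smult)
    show "c \<odot> x \<in> N" unfolding eq N_def using R(3)[OF c f(1)] by (rule imageI)
    show "l (c \<odot> x) = c * l x" unfolding eq using l[OF R(3)[OF c f(1)]] l[OF f(1)] f(2) by simp
  qed
  then obtain l' e where l': "linear_on (carrier A) l'" "\<And>x. x \<in> N \<Longrightarrow> l' x = l x"
    and e: "e \<in> D" "e \<noteq> 0" "\<And>x. x \<in> carrier A \<Longrightarrow> e * l' x \<in> D"
    using linear_on_extend[OF fg] by blast
  have "\<exists>s\<in>D - P. \<exists>d\<in>D. s * e = p ^ k * d" for k
  proof -
    obtain m where m: "poly_over D m" "Polynomial.degree m = n" "Polynomial.lead_coeff m = 1" "ev m a \<in> adic k"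
      using approx by blast
    have mR: "m \<in> R" using m by (simp add: R_def)
    obtain s b where s: "s \<in> D - P" "b \<in> carrier A" "s \<odot> ev m a = (p ^ k) \<odot> b" using m(4) by (rule adic_E)
    have "l' (ev m a) = 1" using l'(2)[of "ev m a"] l[OF mR] mR m(2,3) by (simp add: N_def)
    then have "s = l' (s \<odot> ev m a)"
      using linear_onD(6)[OF l'(1), of s "ev m a"] s(1) m(1) a by simp
    also have "\<dots> = p ^ k * l' b" using linear_onD(6)[OF l'(1) p_pow_D s(2)] s(3) by simp
    finally have "s * e = p ^ k * (e * l' b)" by simp
    then show ?thesis using s(1) e(3)[OF s(2)] by blast
  qed
  then have "e = 0" by (rule krull[OF e(1)])
  with e(2) show False by simp
qed

end

text \<open>The minimal polynomial is padded with a power of \<open>x\<close> to reach degree exactly \<open>n\<close>.\<close>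

theorem (in matrix_reduction) monic_annihilator_degree_n:
  assumes fg: "fin_gen_module (ring_of D) A" and ic: "integrally_closed D" and a: "a \<in> carrier A"
  shows "\<exists>m. poly_over D m \<and> Polynomial.degree m = n \<and> Polynomial.lead_coeff m = 1 \<and> ev m a = \<zero>"
proof -
  have "\<exists>m. poly_over D m \<and> Polynomial.degree m = n \<and> Polynomial.lead_coeff m = 1 \<and> ev m a \<in> adic k" for k
    using approximate_annihilator[OF a, of k] by blast
  then obtain f where f: "f \<noteq> 0" "Polynomial.degree f \<le> n" "poly_over D f" "ev f a = \<zero>"
    using dependent_if_approximately_annihilated[OF fg a] by blast
  obtain q where q: "poly_over D q" "Polynomial.lead_coeff q = 1" "ev q a = \<zero>"
    using monic_annihilator[OF fg a] .
  have fa: "annihilates f a" using f a by (simp add: annihilates_over)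
  obtain m where m: "poly_over D m" "Polynomial.lead_coeff m = 1" "ev m a = \<zero>"
    "Polynomial.degree m \<le> Polynomial.degree f"
    using minimal_polynomial_integral[OF ic a q f(1) fa] .
  define r where "r = Polynomial.monom 1 (n - Polynomial.degree m) * m"
  have "m \<noteq> 0" using m(2) by auto
  then have "Polynomial.degree r = n"
    using m(4) f(2) by (simp add: r_def degree_mult_eq degree_monom_eq)
  moreover have "Polynomial.lead_coeff r = 1" using m(2) by (simp add: r_def lead_coeff_mult degree_monom_eq)
  moreover have mo: "poly_over D (Polynomial.monom 1 (n - Polynomial.degree m))" by (simp add: D.poly_over_monom)
  then have "poly_over D r" using m(1) by (simp add: r_def D.poly_over_mult)
  moreover have "ev r a = \<zero>" using mo m(1,3) a by (simp add: r_def ev_mult)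
  ultimately show ?thesis by blast
qed

section \<open>Localization at a prime of a Dedekind domain\<close>

locale dedekind_prime =
  fixes D P :: "'k::field set"
  assumes dedekind: "dedekind_domain D" and frac: "frac_field D = UNIV"
    and prime: "primeideal P (ring_of D)" and nonzero: "P \<noteq> {0}"
begin

sublocale R: noetherian_domain "ring_of D"
  using dedekind by (simp add: dedekind_domain_def)

sublocale unital_subring D
  by (rule unital_subring_of_ring) (rule R.ring_axioms)

sublocale P: primeideal P "ring_of D"
  by (rule prime)

lemma P_sub: "x \<in> P \<Longrightarrow> x \<in> D"
  using P.Icarr by simp

lemma P_plus: "x \<in> P \<Longrightarrow> y \<in> P \<Longrightarrow> x + y \<in> P"
  using P.a_closed[of x y] by simp

lemma P_zero: "0 \<in> P"
  using P.zero_closed by simp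

lemma P_times: "c \<in> D \<Longrightarrow> x \<in> P \<Longrightarrow> c * x \<in> P"
  using P.I_l_closed[of x c] by simp

lemma one_not_in_P: "1 \<notin> P"
  using P.one_imp_carrier P.I_notcarr by auto

lemma P_primeD: "x \<in> D \<Longrightarrow> y \<in> D \<Longrightarrow> x * y \<in> P \<Longrightarrow> x \<in> P \<or> y \<in> P"
  using P.I_prime[of x y] by simp

lemma U_mult: "s \<in> D - P \<Longrightarrow> t \<in> D - P \<Longrightarrow> s * t \<in> D - P"
  using P_primeD mult_mem by auto

lemma U_nonzero: "s \<in> D - P \<Longrightarrow> s \<noteq> 0"
  using P_zero by auto

lemma U_one: "1 \<in> D - P"
  using one_not_in_P by simp

lemma P_max:
  assumes s: "s \<in> D - P"
  shows "\<exists>t\<in>D. 1 - s * t \<in> P"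
proof -
  interpret Mx: maximalideal P "ring_of D"
    using dedekind prime nonzero by (simp add: dedekind_domain_def)
  define J where "J = PIdl\<^bsub>ring_of D\<^esub> s <+>\<^bsub>ring_of D\<^esub> P"
  have J: "ideal J (ring_of D)"
    unfolding J_def by (rule R.add_ideals[OF R.cgenideal_ideal P.is_ideal]) (use s in simp)
  have el: "x \<in> J \<longleftrightarrow> (\<exists>t\<in>D. \<exists>u\<in>P. x = t * s + u)" for x
    unfolding J_def set_add_def' cgenideal_def ring_of_simps by blast
  have "P \<subseteq> J"
  proof
    fix x assume "x \<in> P"
    moreover have "x = 0 * s + x" by simp
    ultimately show "x \<in> J" unfolding el using zero_mem by blast
  qed
  moreover have "J \<subseteq> carrier (ring_of D)" using ideal.Icarr[OF J] by blast
  ultimately consider "J = P" | "J = carrier (ring_of D)" using Mx.I_maximal[OF J] by blast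
  then have "1 \<in> J"
  proof cases
    case 1
    have "s = 1 * s + 0" by simp
    then have "s \<in> J" unfolding el using P_zero one_mem by blast
    then show ?thesis using 1 s by simp
  qed simp
  then obtain t u where t: "t \<in> D" "u \<in> P" "1 = t * s + u" unfolding el by blast
  have "1 - s * t = u" unfolding t(3) by (simp add: mult.commute)
  then show ?thesis using t by blast
qed

definition V where "V = localization D P"
definition PV where "PV = {a / s | a s. a \<in> P \<and> s \<in> D - P}"

lemma V_iff: "x \<in> V \<longleftrightarrow> (\<exists>s\<in>D - P. s * x \<in> D)"
proof
  assume "x \<in> V"
  then obtain a s where "x = a / s" "a \<in> D" "s \<in> D - P" by (auto simp: V_def localization_def)
  then show "\<exists>s\<in>D - P. s * x \<in> D" using U_nonzero[of s] by (intro bexI[of _ s]) auto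
next
  assume "\<exists>s\<in>D - P. s * x \<in> D"
  then obtain s where s: "s \<in> D - P" "s * x \<in> D" by blast
  then have "x = (s * x) / s" using U_nonzero[OF s(1)] by simp
  then show "x \<in> V" unfolding V_def localization_def using s by blast
qed

lemma PV_iff: "x \<in> PV \<longleftrightarrow> (\<exists>s\<in>D - P. s * x \<in> P)"
proof
  assume "x \<in> PV"
  then obtain a s where "x = a / s" "a \<in> P" "s \<in> D - P" by (auto simp: PV_def)
  then show "\<exists>s\<in>D - P. s * x \<in> P" using U_nonzero[of s] by (intro bexI[of _ s]) auto
next
  assume "\<exists>s\<in>D - P. s * x \<in> P"
  then obtain s where s: "s \<in> D - P" "s * x \<in> P" by blast
  then have "x = (s * x) / s" using U_nonzero[OF s(1)] by simp
  then show "x \<in> PV" unfolding PV_def using s by blast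
qed

lemma D_subset_V: "x \<in> D \<Longrightarrow> x \<in> V"
  unfolding V_iff using U_one by (intro bexI[of _ 1]) auto

lemma subring_V: "unital_subring V"
proof
  show "0 \<in> V" "1 \<in> V" by (simp_all add: D_subset_V)
next
  fix x y assume "x \<in> V" "y \<in> V"
  then obtain s t where s: "s \<in> D - P" "s * x \<in> D" and t: "t \<in> D - P" "t * y \<in> D" unfolding V_iff by blast
  have "(s * t) * (x + y) = t * (s * x) + s * (t * y)" by (simp add: algebra_simps)
  then have "(s * t) * (x + y) \<in> D" using s t by (simp add: add_mem mult_mem)
  then show "x + y \<in> V" unfolding V_iff using U_mult[OF s(1) t(1)] by blast
  have "(s * t) * (x * y) = (s * x) * (t * y)" by (simp add: algebra_simps)
  then have "(s * t) * (x * y) \<in> D" using mult_mem[OF s(2) t(2)] by (simp only:)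
  then show "x * y \<in> V" unfolding V_iff using U_mult[OF s(1) t(1)] by blast
next
  fix x assume "x \<in> V"
  then obtain s where s: "s \<in> D - P" "s * x \<in> D" unfolding V_iff by blast
  then have "s * (- x) \<in> D" using uminus_mem[of "s * x"] by simp
  then show "- x \<in> V" unfolding V_iff using s by blast
qed

sublocale V: unital_subring V
  by (rule subring_V)

lemma PV_subset_V: "x \<in> PV \<Longrightarrow> x \<in> V"
  unfolding V_iff PV_iff using P_sub by blast

lemma PV_add: "x \<in> PV \<Longrightarrow> y \<in> PV \<Longrightarrow> x + y \<in> PV"
proof -
  assume "x \<in> PV" "y \<in> PV"
  then obtain s t where s: "s \<in> D - P" "s * x \<in> P" and t: "t \<in> D - P" "t * y \<in> P" unfolding PV_iff by blast
  have "(s * t) * (x + y) = t * (s * x) + s * (t * y)" by (simp add: algebra_simps)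
  then have "(s * t) * (x + y) \<in> P" using s t by (simp add: P_plus P_times)
  then show "x + y \<in> PV" unfolding PV_iff using U_mult[OF s(1) t(1)] by blast
qed

lemma PV_mult: "x \<in> V \<Longrightarrow> y \<in> PV \<Longrightarrow> x * y \<in> PV"
proof -
  assume "x \<in> V" "y \<in> PV"
  then obtain s t where s: "s \<in> D - P" "s * x \<in> D" and t: "t \<in> D - P" "t * y \<in> P" unfolding PV_iff V_iff by blast
  have "(s * t) * (x * y) = (s * x) * (t * y)" by (simp add: algebra_simps)
  then have "(s * t) * (x * y) \<in> P" using P_times[OF s(2) t(2)] by (simp only:)
  then show "x * y \<in> PV" unfolding PV_iff using U_mult[OF s(1) t(1)] by blast
qed

lemma PV_uminus: "x \<in> PV \<Longrightarrow> - x \<in> PV"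
  using PV_mult[of "- 1" x] V.uminus_mem[OF V.one_mem] by simp

lemma PV_zero: "0 \<in> PV"
  unfolding PV_iff using U_one P_zero by (intro bexI[of _ 1]) auto

lemma P_eq_PV: "x \<in> D \<Longrightarrow> x \<in> PV \<longleftrightarrow> x \<in> P"
  unfolding PV_iff using P_primeD U_one by (metis Diff_iff mult_1)

lemma one_notin_PV: "1 \<notin> PV"
  using P_eq_PV[OF one_mem] one_not_in_P by simp

lemma unit_V: "x \<in> V \<Longrightarrow> x \<notin> PV \<Longrightarrow> \<exists>y\<in>V. y * x = 1"
proof -
  assume x: "x \<in> V" "x \<notin> PV"
  obtain s where s: "s \<in> D - P" "s * x \<in> D" using x(1) unfolding V_iff by blast
  then have sx: "s * x \<in> D - P" using x(2) unfolding PV_iff by blast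
  then have "s / (s * x) \<in> V" unfolding V_iff using U_nonzero s by (intro bexI[of _ "s * x"]) auto
  moreover have "s / (s * x) * x = 1" using U_nonzero[OF sx] by simp
  ultimately show ?thesis by blast
qed

lemma unit_mult: "x \<in> V - PV \<Longrightarrow> y \<in> V - PV \<Longrightarrow> x * y \<in> V - PV"
proof -
  assume x: "x \<in> V - PV" and y: "y \<in> V - PV"
  have "y \<in> PV" if "x * y \<in> PV"
  proof -
    obtain z where z: "z \<in> V" "z * x = 1" using unit_V x by blast
    have "z * (x * y) = z * x * y" by (simp only: mult.assoc)
    then have "z * (x * y) = y" by (simp only: z(2) mult_1_left)
    then show ?thesis using PV_mult[OF z(1) that] by (simp only:)
  qed
  then show "x * y \<in> V - PV" using x y V.mult_mem by blast
qed

lemma unit_prod: "(\<And>i. i \<in> I \<Longrightarrow> f i \<in> V - PV) \<Longrightarrow> prod f I \<in> V - PV"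
proof (induction I rule: infinite_finite_induct)
  case (insert x I)
  then show ?case using unit_mult by simp
qed (use one_notin_PV in simp_all)

lemma unit_power: "x \<in> V - PV \<Longrightarrow> x ^ k \<in> V - PV"
  by (induction k) (use unit_mult one_notin_PV in simp_all)

lemma ideal_PV: "ideal PV (ring_of V)"
proof (rule idealI)
  interpret VR: cring "ring_of V" by (rule V.cring_ring_of)
  show "Ring.ring (ring_of V)" by (rule VR.ring_axioms)
  show "subgroup PV (add_monoid (ring_of V))"
  proof (rule VR.add.subgroupI)
    show "PV \<subseteq> carrier (ring_of V)" using PV_subset_V by auto
    show "PV \<noteq> {}" using PV_zero by blast
    show "\<ominus>\<^bsub>ring_of V\<^esub> a \<in> PV" if "a \<in> PV" for a
      using PV_uminus[OF that] PV_subset_V[OF that] by simp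
    show "a \<oplus>\<^bsub>ring_of V\<^esub> b \<in> PV" if "a \<in> PV" "b \<in> PV" for a b
      using PV_add[OF that] by simp
  qed
next
  fix a x assume "a \<in> PV" "x \<in> carrier (ring_of V)"
  then have "x * a \<in> PV" using PV_mult by simp
  then show "x \<otimes>\<^bsub>ring_of V\<^esub> a \<in> PV" "a \<otimes>\<^bsub>ring_of V\<^esub> x \<in> PV" by (simp_all add: mult.commute[of a x])
qed

text \<open>Elements outside \<open>PV\<close> are units, so a maximal ideal is contained in \<open>PV\<close>.\<close>

lemma maximal_eq_PV:
  assumes "maximalideal I (ring_of V)"
  shows "I = PV"
proof -
  interpret I: maximalideal I "ring_of V" by fact
  have no_one: "1 \<notin> I"
    using I.one_imp_carrier I.I_notcarr by (simp only: ring_of_simps) blast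
  have "x \<in> PV" if x: "x \<in> I" for x
  proof (rule ccontr)
    assume "x \<notin> PV"
    moreover have "x \<in> V" using I.Icarr[OF x] by (simp only: ring_of_simps)
    ultimately obtain y where y: "y \<in> V" "y * x = 1" using unit_V by blast
    have "y * x \<in> I" using I.I_l_closed[OF x, of y] y(1) by (simp only: ring_of_simps)
    then show False using no_one by (simp only: y(2))
  qed
  then have "I \<subseteq> PV" by blast
  moreover have "PV \<subseteq> carrier (ring_of V)" using PV_subset_V by auto
  ultimately consider "PV = I" | "PV = carrier (ring_of V)" using I.I_maximal[OF ideal_PV] by blast
  then show ?thesis
  proof cases
    case 2
    then have "1 \<in> PV" using V.one_mem by (simp only: ring_of_simps)
    then show ?thesis using one_notin_PV by simp
  qed simp
qed

lemma PIdl_V: "x \<in> V \<Longrightarrow> PIdl\<^bsub>ring_of V\<^esub> x = {v * x | v. v \<in> V}"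
  by (auto simp: cgenideal_def)

text \<open>A generator \<open>\<pi>\<close> of the maximal ideal of \<open>V\<close> need not lie in \<open>D\<close>; a multiple \<open>s\<pi>\<close> by a unit of \<open>V\<close> does.\<close>

lemma uniformizer:
  assumes \<pi>: "\<pi> \<in> V" "maximalideal (PIdl\<^bsub>ring_of V\<^esub> \<pi>) (ring_of V)"
  obtains s where "s \<in> D - P" "s * \<pi> \<in> P" "\<pi> \<noteq> 0"
    "\<forall>x\<in>PV. \<exists>v\<in>V. x = v * \<pi>"
    "\<forall>x\<in>P. \<exists>t\<in>D - P. \<exists>d\<in>D. t * x = (s * \<pi>) * d"
proof -
  have eq: "{v * \<pi> | v. v \<in> V} = PV" using maximal_eq_PV[OF \<pi>(2)] PIdl_V[OF \<pi>(1)] by simp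
  have "1 * \<pi> \<in> PV" unfolding eq[symmetric] using V.one_mem by blast
  then obtain s where s: "s \<in> D - P" "s * \<pi> \<in> P" unfolding PV_iff by auto
  have gen: "\<exists>v\<in>V. x = v * \<pi>" if "x \<in> PV" for x using that unfolding eq[symmetric] by blast
  have gen2: "\<exists>t\<in>D - P. \<exists>d\<in>D. t * x = (s * \<pi>) * d" if x: "x \<in> P" for x
  proof -
    have "x \<in> PV" using P_eq_PV[OF P_sub[OF x]] x by simp
    then obtain v where v: "v \<in> V" "x = v * \<pi>" using gen by blast
    obtain t where t: "t \<in> D - P" "t * v \<in> D" using v(1) unfolding V_iff by blast
    have "(s * t) * x = (s * \<pi>) * (t * v)" using v(2) by simp
    then show ?thesis using U_mult[OF s(1) t(1)] t(2) by blast
  qed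
  obtain x where x: "x \<in> P" "x \<noteq> 0" using nonzero P_zero by blast
  have "x \<in> PV" using P_eq_PV[OF P_sub[OF x(1)]] x by simp
  then have "\<pi> \<noteq> 0" using gen[of x] x(2) by auto
  with s show ?thesis using gen gen2 by (intro that ballI)
qed

text \<open>The ideals \<open>J k = {x. p\<^sup>k x \<in> dV}\<close> of \<open>D\<close> form a chain, which becomes stationary. If \<open>p\<^sup>k\<^sup>+\<^sup>1e\<close> is \<open>d\<close>
  up to a unit, then \<open>e \<in> J (Suc k) = J k\<close> means that \<open>p\<^sup>ke\<close> is also a multiple of \<open>d\<close>, so that \<open>p\<close> would be a unit.\<close>

lemma krull_intersection:
  assumes d: "d \<in> D" and p: "p \<in> P" and div: "\<And>k. \<exists>s\<in>D - P. \<exists>e\<in>D. s * d = p ^ k * e"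
  shows "d = 0"
proof (rule ccontr)
  assume d0: "d \<noteq> 0"
  have pD: "p \<in> D" using p P_sub by simp
  obtain s e where se: "\<And>k. s k \<in> D - P" "\<And>k. e k \<in> D" "\<And>k. s k * d = p ^ k * e k"
    using div by metis
  define J where "J k = {x \<in> D. \<exists>t\<in>D - P. \<exists>y\<in>D. t * p ^ k * x = d * y}" for k
  have ideal: "ideal (J k) (ring_of D)" for k
  proof (rule idealI)
    show "Ring.ring (ring_of D)" by (rule R.ring_axioms)
    have J0: "0 \<in> J k" 
    proof -
      have "1 * p ^ k * 0 = d * 0" by simp
      then show ?thesis unfolding J_def using U_one zero_mem by blast
    qed
    have Jmult: "c * x \<in> J k" if cx: "c \<in> D" "x \<in> J k" for c x
    proof -
      obtain t y where t: "x \<in> D" "t \<in> D - P" "y \<in> D" "t * p ^ k * x = d * y" using cx(2) unfolding J_def by blast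
      have "t * p ^ k * (c * x) = c * (t * p ^ k * x)" by simp
      also have "\<dots> = d * (c * y)" unfolding t(4) by simp
      finally have "t * p ^ k * (c * x) = d * (c * y)" .
      then show ?thesis unfolding J_def using t mult_mem[OF cx(1) t(1)] mult_mem[OF cx(1) t(3)] by blast
    qed
    have Jadd: "x + x' \<in> J k" if xx: "x \<in> J k" "x' \<in> J k" for x x'
    proof -
      obtain t y where t: "x \<in> D" "t \<in> D - P" "y \<in> D" "t * p ^ k * x = d * y" using xx(1) unfolding J_def by blast
      obtain t' y' where t': "x' \<in> D" "t' \<in> D - P" "y' \<in> D" "t' * p ^ k * x' = d * y'" using xx(2) unfolding J_def by blast
      have "(t * t') * p ^ k * (x + x') = t' * (t * p ^ k * x) + t * (t' * p ^ k * x')" by (simp add: algebra_simps)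
      also have "\<dots> = d * (t' * y + t * y')" unfolding t(4) t'(4) by (simp add: algebra_simps)
      finally have "(t * t') * p ^ k * (x + x') = d * (t' * y + t * y')" .
      moreover have "t' * y + t * y' \<in> D" using t t' by (intro add_mem mult_mem) auto
      ultimately show ?thesis unfolding J_def using U_mult[OF t(2) t'(2)] add_mem[OF t(1) t'(1)] by blast
    qed
    show "subgroup (J k) (add_monoid (ring_of D))"
    proof (rule R.add.subgroupI)
      show "J k \<subseteq> carrier (ring_of D)" by (auto simp: J_def)
      show "J k \<noteq> {}" using J0 by blast
      show "\<ominus>\<^bsub>ring_of D\<^esub> x \<in> J k" if "x \<in> J k" for x
      proof -
        have "x \<in> D" using that by (simp add: J_def)
        then show ?thesis using Jmult[OF uminus_mem[OF one_mem] that] by simp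
      qed
      show "x \<oplus>\<^bsub>ring_of D\<^esub> y \<in> J k" if "x \<in> J k" "y \<in> J k" for x y
        using Jadd[OF that] by simp
    qed
    show "c \<otimes>\<^bsub>ring_of D\<^esub> x \<in> J k" if "x \<in> J k" "c \<in> carrier (ring_of D)" for c x using Jmult that by simp
    show "x \<otimes>\<^bsub>ring_of D\<^esub> c \<in> J k" if "x \<in> J k" "c \<in> carrier (ring_of D)" for c x
      using Jmult that by (simp add: mult.commute)
  qed
  have step: "J k \<subseteq> J (Suc k)" for k
  proof
    fix x assume "x \<in> J k"
    then obtain t y where t: "x \<in> D" "t \<in> D - P" "y \<in> D" "t * p ^ k * x = d * y" unfolding J_def by blast
    have "t * p ^ Suc k * x = p * (t * p ^ k * x)" by simp
    also have "\<dots> = d * (p * y)" unfolding t(4) by simp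
    finally show "x \<in> J (Suc k)" unfolding J_def using t mult_mem[OF pD t(3)] by blast
  qed
  then have mono: "j \<le> k \<Longrightarrow> J j \<subseteq> J k" for j k by (rule lift_Suc_mono_le)
  have "subset.chain {I. ideal I (ring_of D)} (range J)"
    unfolding subset_chain_def
  proof (intro conjI ballI)
    show "range J \<subseteq> {I. ideal I (ring_of D)}" using ideal by blast
    fix B C assume "B \<in> range J" "C \<in> range J"
    then obtain i j where "B = J i" "C = J j" by blast
    then show "B \<subseteq> C \<or> C \<subseteq> B" using mono[of i j] mono[of j i] nat_le_linear[of i j] by blast
  qed
  then have "\<Union> (range J) \<in> range J" by (intro R.ideal_chain_is_trivial) simp_all
  then obtain k where k: "\<Union> (range J) = J k" by blast
  have "e (Suc k) \<in> J (Suc k)"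
  proof -
    have "1 * p ^ Suc k * e (Suc k) = d * s (Suc k)" using se(3)[of "Suc k"] by (simp add: mult.commute)
    then show ?thesis unfolding J_def using se(2) U_one se(1)[of "Suc k"] by blast
  qed
  then have "e (Suc k) \<in> J k" using k by blast
  then obtain t y where t: "t \<in> D - P" "y \<in> D" "t * p ^ k * e (Suc k) = d * y" unfolding J_def by blast
  have "d * (t * s (Suc k)) = t * (s (Suc k) * d)" by simp
  also have "\<dots> = t * (p ^ Suc k * e (Suc k))" by (simp only: se(3))
  also have "\<dots> = p * (t * p ^ k * e (Suc k))" by simp
  also have "\<dots> = d * (y * p)" unfolding t(3) by simp
  finally have "t * s (Suc k) = y * p" using d0 by simp
  moreover have "y * p \<in> P" using P_times[OF t(2) p] .
  moreover have "t * s (Suc k) \<in> D - P" using U_mult[OF t(1) se(1)] .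
  ultimately show False by simp
qed

lemma local_uniformizer:
  assumes \<pi>: "\<pi> \<in> V" "maximalideal (PIdl\<^bsub>ring_of V\<^esub> \<pi>) (ring_of V)"
  obtains s where "s \<in> D - P" "\<pi> \<noteq> 0" "\<forall>x\<in>PV. \<exists>v\<in>V. x = v * \<pi>" "local_uniformizer D P (s * \<pi>)"
proof -
  obtain s where s: "s \<in> D - P" "s * \<pi> \<in> P" "\<pi> \<noteq> 0" "\<forall>x\<in>PV. \<exists>v\<in>V. x = v * \<pi>"
    "\<forall>x\<in>P. \<exists>t\<in>D - P. \<exists>d\<in>D. t * x = (s * \<pi>) * d"
    by (rule uniformizer[OF \<pi>])
  have "local_uniformizer D P (s * \<pi>)"
  proof (rule local_uniformizer.intro)
    show "P \<subseteq> D" using P_sub by blast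
    show "s * \<pi> \<noteq> 0" using s(3) U_nonzero[OF s(1)] by simp
    show "d = 0" if "d \<in> D" "\<And>k. \<exists>t\<in>D - P. \<exists>e\<in>D. t * d = (s * \<pi>) ^ k * e" for d
      using krull_intersection[OF that(1) s(2) that(2)] .
    show "\<exists>t\<in>D - P. \<exists>d\<in>D. t * x = (s * \<pi>) * d" if "x \<in> P" for x using bspec[OF s(5) that] .
    show "\<exists>u\<in>D. 1 - t * u \<in> P" if "t \<in> D - P" for t using P_max[OF that] .
    show "x \<in> P \<or> y \<in> P" if "x \<in> D" "y \<in> D" "x * y \<in> P" for x y using P_primeD[OF that] .
    show "x + y \<in> P" if "x \<in> P" "y \<in> P" for x y using P_plus[OF that] .
    show "c * x \<in> P" if "c \<in> D" "x \<in> P" for c x using P_times[OF that] .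
    show "1 \<notin> P" by (rule one_not_in_P)
    show "s * \<pi> \<in> P" by (rule s(2))
  qed
  with s(1,3,4) show ?thesis by (rule that)
qed

end

section \<open>Algebras that are matrix algebras modulo a prime power\<close>

context algebra_over
begin

lemma ideal_smult_closed:
  assumes I: "ideal I A" and r: "r \<in> D" and x: "x \<in> I"
  shows "r \<odot> x \<in> I"
proof -
  have xc: "x \<in> carrier A" using ideal.Icarr[OF I x] .
  have "(r \<odot> \<one>) \<otimes> x \<in> I" using ideal.I_l_closed[OF I x, of "r \<odot> \<one>"] r by simp
  then show ?thesis using r xc by (simp add: mult_smult_left)
qed

lemma coset_eq_iff_diff:
  assumes I: "ideal I A" and x: "x \<in> carrier A" "y \<in> carrier A"
  shows "I +> x = I +> y \<longleftrightarrow> x \<ominus> y \<in> I"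
  using ring.quotient_eq_iff_same_a_r_cos[OF A.ring_axioms I x(1) x(2)] by blast

text \<open>The union in the definition of the scalar multiplication runs over equal cosets.\<close>

lemma quot_smult_coset:
  assumes I: "ideal I A" and r: "r \<in> D" and x: "x \<in> carrier A"
  shows "r \<odot>\<^bsub>quot_algebra A I\<^esub> (I +> x) = I +> (r \<odot> x)"
proof -
  have "I +> (r \<odot> y) = I +> (r \<odot> x)" if y: "y \<in> I +> x" for y
  proof -
    obtain i where i: "i \<in> I" "y = i \<oplus> x" using y by (auto simp: a_r_coset_def r_coset_def)
    have ic: "i \<in> carrier A" using ideal.Icarr[OF I i(1)] .
    have "r \<odot> y \<ominus> r \<odot> x = r \<odot> i"
      using ic x r by (simp add: i(2) smult_add_right M.minus_eq M.a_assoc M.r_neg)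
    then show ?thesis
      using coset_eq_iff_diff[OF I, of "r \<odot> y" "r \<odot> x"] ideal_smult_closed[OF I r i(1)] ic x r i(2) by simp
  qed
  moreover have "I +> x \<noteq> {}"
    using additive_subgroup.zero_closed[OF ideal.axioms(1)[OF I]]
    by (auto simp: a_r_coset_def r_coset_def)
  ultimately show ?thesis unfolding quot_algebra_def by auto
qed

lemma quot_algebra_simps:
  assumes I: "ideal I A"
  shows "X' \<in> carrier (quot_algebra A I) \<longleftrightarrow> (\<exists>x\<in>carrier A. X' = I +> x)"
    "\<lbrakk>x \<in> carrier A; y \<in> carrier A\<rbrakk> \<Longrightarrow> (I +> x) \<oplus>\<^bsub>quot_algebra A I\<^esub> (I +> y) = I +> (x \<oplus> y)"
    "\<lbrakk>x \<in> carrier A; y \<in> carrier A\<rbrakk> \<Longrightarrow> (I +> x) \<otimes>\<^bsub>quot_algebra A I\<^esub> (I +> y) = I +> (x \<otimes> y)"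
    "\<one>\<^bsub>quot_algebra A I\<^esub> = I +> \<one>" "\<zero>\<^bsub>quot_algebra A I\<^esub> = I +> \<zero>"
proof -
  interpret I: ideal I A by fact
  note hom = I.rcos_ring_hom
  show "X' \<in> carrier (quot_algebra A I) \<longleftrightarrow> (\<exists>x\<in>carrier A. X' = I +> x)"
    by (auto simp: quot_algebra_def FactRing_def A_RCOSETS_def')
  show "(I +> x) \<oplus>\<^bsub>quot_algebra A I\<^esub> (I +> y) = I +> (x \<oplus> y)" if "x \<in> carrier A" "y \<in> carrier A"
    using ring_hom_add[OF hom that] by (simp add: quot_algebra_def)
  show "(I +> x) \<otimes>\<^bsub>quot_algebra A I\<^esub> (I +> y) = I +> (x \<otimes> y)" if "x \<in> carrier A" "y \<in> carrier A"
    using ring_hom_mult[OF hom that] by (simp add: quot_algebra_def)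
  show "\<one>\<^bsub>quot_algebra A I\<^esub> = I +> \<one>" "\<zero>\<^bsub>quot_algebra A I\<^esub> = I +> \<zero>"
    using M.a_coset_add_zero[OF I.a_subset] by (simp_all add: quot_algebra_def FactRing_def)
qed

lemma ideal_ideal_smult:
  assumes J: "J \<subseteq> D"
  shows "ideal (ideal_smult J A) A"
proof (rule idealI)
  let ?G = "{r \<odot> a | r a. r \<in> J \<and> a \<in> carrier A}"
  have sub: "?G \<subseteq> carrier (add_monoid A)" using J by auto
  have grp: "Group.group (add_monoid A)" by (rule M.a_group)
  show "Ring.ring A" by (rule A.ring_axioms)
  show sg: "subgroup (ideal_smult J A) (add_monoid A)"
    unfolding ideal_smult_def by (rule group.generate_is_subgroup[OF grp sub])
  have carr: "x \<in> carrier A" if "x \<in> ideal_smult J A" for x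
    using subgroup.mem_carrier[OF sg that] by simp
  have gen: "r \<odot> a \<in> ideal_smult J A" if "r \<in> J" "a \<in> carrier A" for r a
    unfolding ideal_smult_def using that by (intro generate.incl) blast
  have zero: "\<zero> \<in> ideal_smult J A" using subgroup.one_closed[OF sg] by simp
  have add: "x \<oplus> y \<in> ideal_smult J A" if "x \<in> ideal_smult J A" "y \<in> ideal_smult J A" for x y
    using subgroup.m_closed[OF sg that] by simp
  have neg: "\<ominus> x \<in> ideal_smult J A" if "x \<in> ideal_smult J A" for x
    using subgroup.m_inv_closed[OF sg that] by (simp add: a_inv_def)
  have mult: "x \<otimes> y \<in> ideal_smult J A \<and> y \<otimes> x \<in> ideal_smult J A" if x: "x \<in> ideal_smult J A" and y: "y \<in> carrier A" for x y
  proof -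
    have "x \<in> generate (add_monoid A) ?G" using x by (simp add: ideal_smult_def)
    then have "x \<in> carrier A \<and> x \<otimes> y \<in> ideal_smult J A \<and> y \<otimes> x \<in> ideal_smult J A"
    proof (induction rule: generate.induct)
      case one
      then show ?case using y zero by simp
    next
      case (incl h)
      then obtain r a where h: "h = r \<odot> a" "r \<in> J" "a \<in> carrier A" by blast
      then show ?case using y J gen[of r "a \<otimes> y"] gen[of r "y \<otimes> a"]
        by (auto simp: mult_smult_left mult_smult_right)
    next
      case (inv h)
      then obtain r a where h: "h = r \<odot> a" "r \<in> J" "a \<in> carrier A" by blast
      then have hc: "h \<in> carrier A" using J by auto
      have "h \<otimes> y \<in> ideal_smult J A" "y \<otimes> h \<in> ideal_smult J A"
        using h y J gen[of r "a \<otimes> y"] gen[of r "y \<otimes> a"] by (auto simp: mult_smult_left mult_smult_right)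
      moreover have "inv\<^bsub>add_monoid A\<^esub> h = \<ominus> h" by (simp add: a_inv_def)
      ultimately show ?case using hc y neg by (simp add: A.l_minus A.r_minus)
    next
      case (eng h1 h2)
      then show ?case using y add by (simp add: A.l_distr A.r_distr)
    qed
    then show ?thesis by blast
  qed
  show "x \<otimes> a \<in> ideal_smult J A" if "a \<in> ideal_smult J A" "x \<in> carrier A" for a x using mult that by blast
  show "a \<otimes> x \<in> ideal_smult J A" if "a \<in> ideal_smult J A" "x \<in> carrier A" for a x using mult that by blast
qed

end

lemma (in unital_subring) algebra_over_self: "assoc_algebra (ring_of S) (ring_of S)"
proof -
  interpret R: cring "ring_of S" by (rule cring_ring_of)
  have "module (ring_of S) (ring_of S)"
    by (rule moduleI) (auto simp: R.cring_axioms R.is_abelian_group mult_mem ring_distribs)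
  then show ?thesis
    unfolding assoc_algebra_def assoc_algebra_axioms_def using R.ring_axioms by auto
qed

context dedekind_prime
begin

lemma prime_power:
  "ideal (P [^]\<^bsub>ideals_set (ring_of D)\<^esub> (k::nat)) (ring_of D)"
  "k \<ge> 1 \<Longrightarrow> P [^]\<^bsub>ideals_set (ring_of D)\<^esub> k \<subseteq> P"
proof -
  have *: "ideal (P [^]\<^bsub>ideals_set (ring_of D)\<^esub> k) (ring_of D) \<and> (k \<ge> 1 \<longrightarrow> P [^]\<^bsub>ideals_set (ring_of D)\<^esub> k \<subseteq> P)" for k :: nat
  proof (induction k)
    case 0
    then show ?case using R.oneideal by (simp add: ideals_set_def nat_pow_def)
  next
    case (Suc k)
    have eq: "P [^]\<^bsub>ideals_set (ring_of D)\<^esub> Suc k = ideal_prod (ring_of D) (P [^]\<^bsub>ideals_set (ring_of D)\<^esub> k) P"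
      by (simp add: nat_pow_def ideals_set_def)
    show ?case unfolding eq
      using R.ideal_prod_is_ideal[OF _ P.is_ideal] R.ideal_prod_inter[OF _ P.is_ideal] Suc by blast
  qed
  show "ideal (P [^]\<^bsub>ideals_set (ring_of D)\<^esub> k) (ring_of D)" using * by blast
  show "k \<ge> 1 \<Longrightarrow> P [^]\<^bsub>ideals_set (ring_of D)\<^esub> k \<subseteq> P" using * by blast
qed

lemma prime_power_divisible:
  assumes "local_uniformizer D P p" and "x \<in> P [^]\<^bsub>ideals_set (ring_of D)\<^esub> (k::nat)"
  shows "\<exists>s\<in>D - P. \<exists>d\<in>D. s * x = p ^ k * d"
  using assms(2)
proof (induction k arbitrary: x)
  case 0
  then show ?case using U_one by (auto simp: ideals_set_def nat_pow_def intro!: bexI[of _ 1])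
next
  case (Suc k)
  interpret local_uniformizer D P p by fact
  let ?Q = "P [^]\<^bsub>ideals_set (ring_of D)\<^esub> k"
  have "x \<in> ideal_prod (ring_of D) ?Q P"
    using Suc.prems by (simp add: nat_pow_def ideals_set_def)
  then show ?case
  proof (induction rule: ideal_prod.induct)
    case (prod i j)
    obtain s d where s: "s \<in> D - P" "d \<in> D" "s * i = p ^ k * d" using Suc.IH[OF prod(1)] by blast
    obtain t e where t: "t \<in> D - P" "e \<in> D" "t * j = p * e" using p_generates[OF prod(2)] by blast
    have "(s * t) * (i * j) = (s * i) * (t * j)" by simp
    also have "\<dots> = p ^ Suc k * (d * e)" unfolding s(3) t(3) by simp
    finally show ?case using U_mult[OF s(1) t(1)] mult_mem[OF s(2) t(2)] by (auto simp only: ring_of_simps)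
  next
    case (sum x y)
    obtain s d where s: "s \<in> D - P" "d \<in> D" "s * x = p ^ Suc k * d" using sum by blast
    obtain t e where t: "t \<in> D - P" "e \<in> D" "t * y = p ^ Suc k * e" using sum by blast
    have "(s * t) * (x + y) = t * (s * x) + s * (t * y)" by (simp add: algebra_simps)
    also have "\<dots> = p ^ Suc k * (t * d + s * e)" unfolding s(3) t(3) by (simp add: algebra_simps)
    finally have "(s * t) * (x + y) = p ^ Suc k * (t * d + s * e)" .
    moreover have "t * d + s * e \<in> D" using s t by (intro add_mem mult_mem) auto
    ultimately show ?case using U_mult[OF s(1) t(1)] by (auto simp only: ring_of_simps)
  qed
qed

end

text \<open>The relation \<open>rho x T\<close> compares the image of the coset of \<open>x\<close> with the entrywise reduction of \<open>T\<close>. Its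
  properties are those of the two reduction homomorphisms and of the isomorphism between them.\<close>

theorem (in local_algebra) matrix_reduction_of_iso:
  assumes dp: "dedekind_prime D P" and n: "n \<ge> 1" and N: "N \<ge> (1::nat)"
    and iso: "algebra_iso (ring_of D)
      (quot_algebra A (ideal_smult (P [^]\<^bsub>ideals_set (ring_of D)\<^esub> N) A))
      (mat_algebra n (quot_algebra (ring_of D) (P [^]\<^bsub>ideals_set (ring_of D)\<^esub> N)))"
  obtains rho where "matrix_reduction D A P p n N rho"
proof -
  interpret dp: dedekind_prime D P by fact
  define J where "J = P [^]\<^bsub>ideals_set (ring_of D)\<^esub> N"
  define I where "I = ideal_smult J A"
  interpret S: algebra_over D "ring_of D"
    unfolding algebra_over_def by (rule D.algebra_over_self)
  have J: "ideal J (ring_of D)" unfolding J_def by (rule dp.prime_power)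
  have JP: "J \<subseteq> P" unfolding J_def using N by (rule dp.prime_power)
  have JD: "J \<subseteq> D" using JP P_subset by blast
  have I: "ideal I A" unfolding I_def by (rule ideal_ideal_smult[OF JD])
  have IM: "x \<in> adic N" if "x \<in> I" for x
  proof -
    have "x \<in> generate (add_monoid A) {r \<odot> a | r a. r \<in> J \<and> a \<in> carrier A}"
      using that by (simp add: I_def ideal_smult_def)
    moreover have "h \<in> adic N" if gen: "h \<in> {r \<odot> a | r a. r \<in> J \<and> a \<in> carrier A}" for h
    proof -
      obtain r a where h: "h = r \<odot> a" "r \<in> J" "a \<in> carrier A" using gen by blast
      obtain s d where s: "s \<in> D - P" "d \<in> D" "s * r = p ^ N * d"
        using dp.prime_power_divisible[OF local_uniformizer_axioms h(2)[unfolded J_def]] by blast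
      have r: "r \<in> D" using h(2) JD by blast
      have "s \<odot> h = (s * r) \<odot> a" unfolding h(1) by (rule smult_smult[OF units_D[OF s(1)] r h(3)])
      also have "\<dots> = (p ^ N) \<odot> (d \<odot> a)" unfolding s(3) by (rule smult_smult[OF p_pow_D s(2) h(3), symmetric])
      finally show ?thesis using h r s by (intro adic_I[of h s "d \<odot> a"]) auto
    qed
    ultimately show ?thesis
    proof (induction rule: generate.induct)
      case one
      then show ?case by simp
    next
      case (incl h)
      then show ?case by blast
    next
      case (inv h)
      then have "\<ominus> h \<in> adic N" using adic_minus by blast
      then show ?case by (simp add: a_inv_def)
    next
      case (eng h1 h2)
      then show ?case using adic_add by simp
    qed
  qed
  define Q where "Q = quot_algebra (ring_of D) J"
  define c where "c d = J +>\<^bsub>ring_of D\<^esub> d" for d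
  have Q: "Z \<in> carrier Q \<longleftrightarrow> (\<exists>d\<in>D. Z = c d)"
    "d \<in> D \<Longrightarrow> e \<in> D \<Longrightarrow> c d \<oplus>\<^bsub>Q\<^esub> c e = c (d + e)" "d \<in> D \<Longrightarrow> e \<in> D \<Longrightarrow> c d \<otimes>\<^bsub>Q\<^esub> c e = c (d * e)"
    "\<one>\<^bsub>Q\<^esub> = c 1" "\<zero>\<^bsub>Q\<^esub> = c 0" "d \<in> D \<Longrightarrow> e \<in> D \<Longrightarrow> d \<odot>\<^bsub>Q\<^esub> c e = c (d * e)" for Z d e
    using S.quot_algebra_simps[OF J] S.quot_smult_coset[OF J] unfolding Q_def c_def by simp_all
  have c_eq: "d - e \<in> J" if "d \<in> D" "e \<in> D" "c d = c e" for d e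
    using S.coset_eq_iff_diff[OF J, of d e] that by (simp add: c_def a_minus_def D.uminus_mem)
  interpret QR: Ring.ring "ring_of D Quot J" by (rule ideal.quotient_is_ring[OF J])
  have Qsum: "(\<Oplus>\<^bsub>Q\<^esub>k\<in>{..<m}. c (f k)) = c (\<Sum>k\<in>{..<m}. f k)" if "\<And>k. k < m \<Longrightarrow> f k \<in> D" for m :: nat and f
  proof -
    have eqs: "finsum Q g K = finsum (ring_of D Quot J) g K" for g and K :: "nat set"
      by (simp add: Q_def quot_algebra_def finsum_def finprod_def)
    have car: "c d \<in> carrier (ring_of D Quot J)" if "d \<in> D" for d
      using Q(1)[of "c d"] that by (auto simp: Q_def quot_algebra_def)
    have add: "c d \<oplus>\<^bsub>ring_of D Quot J\<^esub> c e = c (d + e)" if "d \<in> D" "e \<in> D" for d e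
      using Q(2)[OF that] by (simp add: Q_def quot_algebra_def)
    show ?thesis unfolding eqs using that
    proof (induction m)
      case 0
      then show ?case using Q(5) by (simp add: Q_def quot_algebra_def)
    next
      case (Suc m)
      have "(\<Oplus>\<^bsub>ring_of D Quot J\<^esub>k\<in>{..<Suc m}. c (f k)) = c (f m) \<oplus>\<^bsub>ring_of D Quot J\<^esub> (\<Oplus>\<^bsub>ring_of D Quot J\<^esub>k\<in>{..<m}. c (f k))"
        unfolding lessThan_Suc using Suc.prems car by (intro QR.finsum_insert) auto
      also have "\<dots> = c (f m + (\<Sum>k\<in>{..<m}. f k))"
      proof -
        have "f m \<in> D" "(\<Sum>k\<in>{..<m}. f k) \<in> D" using Suc.prems by (auto intro: D.sum_mem)
        then show ?thesis using Suc by (simp add: add)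
      qed
      finally show ?case by (simp add: add.commute)
    qed
  qed
  obtain \<phi> where \<phi>: "\<phi> \<in> ring_iso (quot_algebra A I) (mat_algebra n Q)"
    and \<phi>s: "\<And>r Z. r \<in> D \<Longrightarrow> Z \<in> carrier (quot_algebra A I) \<Longrightarrow>
      \<phi> (r \<odot>\<^bsub>quot_algebra A I\<^esub> Z) = r \<odot>\<^bsub>mat_algebra n Q\<^esub> \<phi> Z"
    using iso unfolding algebra_iso_def J_def[symmetric] I_def[symmetric] Q_def[symmetric] by auto
  have hom: "\<phi> \<in> Ring.ring_hom (quot_algebra A I) (mat_algebra n Q)"
    and bij: "bij_betw \<phi> (carrier (quot_algebra A I)) (carrier (mat_algebra n Q))"
    using \<phi> by (auto simp: ring_iso_def)
  have cos: "I +> x \<in> carrier (quot_algebra A I)" if "x \<in> carrier A" for x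
    using quot_algebra_simps(1)[OF I] that by blast
  define rho where "rho x T \<longleftrightarrow> x \<in> carrier A \<and> T \<in> carrier (mat_algebra n (ring_of D)) \<and>
      \<phi> (I +> x) = map_mat c T" for x T
  note MC = D.mat_algebra_carrier
  have mc: "map_mat c T \<in> carrier (mat_algebra n Q)" if "T \<in> carrier (mat_algebra n (ring_of D))" for T
    using that Q(1) by (fastforce simp: MC mat_algebra_def)
  have "matrix_reduction D A P p n N rho"
  proof
    show "n \<ge> 1" "N \<ge> 1" by fact+
    show "x \<in> carrier A" "T \<in> carrier (mat_algebra n (ring_of D))" if "rho x T" for x T
      using that by (auto simp: rho_def)
    show "\<exists>T. rho x T" if x: "x \<in> carrier A" for x
    proof -
      have "\<phi> (I +> x) \<in> carrier (mat_algebra n Q)" using ring_hom_closed[OF hom cos[OF x]] .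
      then have F: "\<phi> (I +> x) \<in> carrier_mat n n" "\<And>i j. i < n \<Longrightarrow> j < n \<Longrightarrow> \<phi> (I +> x) $$ (i, j) \<in> carrier Q"
        by (auto simp: mat_algebra_def)
      then have "\<forall>i j. \<exists>d\<in>D. i < n \<longrightarrow> j < n \<longrightarrow> \<phi> (I +> x) $$ (i, j) = c d" using Q(1) D.zero_mem by metis
      then obtain t where t: "\<And>i j. t i j \<in> D" "\<And>i j. i < n \<Longrightarrow> j < n \<Longrightarrow> \<phi> (I +> x) $$ (i, j) = c (t i j)" by metis
      have "\<phi> (I +> x) = map_mat c (mat n n (\<lambda>(i, j). t i j))"
        using F(1) t(2) by (intro eq_matI) auto
      moreover have "mat n n (\<lambda>(i, j). t i j) \<in> carrier (mat_algebra n (ring_of D))" using t(1) by (auto simp: MC)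
      ultimately show ?thesis using x by (auto simp: rho_def)
    qed
    show "\<exists>x. rho x T" if T: "T \<in> carrier (mat_algebra n (ring_of D))" for T
    proof -
      obtain Z where Z: "Z \<in> carrier (quot_algebra A I)" "\<phi> Z = map_mat c T"
        using bij mc[OF T] unfolding bij_betw_def by (metis imageE)
      then show ?thesis using T quot_algebra_simps(1)[OF I] by (auto simp: rho_def)
    qed
    show "rho (x \<oplus> y) (T + S)" if "rho x T" "rho y S" for x T y S
    proof -
      have xy: "x \<in> carrier A" "y \<in> carrier A" "\<phi> (I +> x) = map_mat c T" "\<phi> (I +> y) = map_mat c S"
        and TS: "T \<in> carrier (mat_algebra n (ring_of D))" "S \<in> carrier (mat_algebra n (ring_of D))"
        using that by (auto simp: rho_def)
      have "\<phi> (I +> (x \<oplus> y)) = map_mat c T \<oplus>\<^bsub>mat_algebra n Q\<^esub> map_mat c S"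
        using ring_hom_add[OF hom cos[OF xy(1)] cos[OF xy(2)]] quot_algebra_simps(2)[OF I xy(1,2)] xy(3,4) by simp
      also have "\<dots> = map_mat c (T + S)"
      proof -
        have "T \<in> carrier_mat n n" "S \<in> carrier_mat n n" "\<And>i j. i < n \<Longrightarrow> j < n \<Longrightarrow> T $$ (i, j) \<in> D \<and> S $$ (i, j) \<in> D"
          using TS by (auto simp: MC)
        then show ?thesis by (intro eq_matI) (auto simp: mat_algebra_def Q(2))
      qed
      finally show ?thesis using xy TS D.mat_algebra_closed(2) by (simp add: rho_def)
    qed
    show "rho (x \<otimes> y) (T * S)" if "rho x T" "rho y S" for x T y S
    proof -
      have xy: "x \<in> carrier A" "y \<in> carrier A" "\<phi> (I +> x) = map_mat c T" "\<phi> (I +> y) = map_mat c S"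
        and TS: "T \<in> carrier (mat_algebra n (ring_of D))" "S \<in> carrier (mat_algebra n (ring_of D))"
        using that by (auto simp: rho_def)
      have "\<phi> (I +> (x \<otimes> y)) = map_mat c T \<otimes>\<^bsub>mat_algebra n Q\<^esub> map_mat c S"
        using ring_hom_mult[OF hom cos[OF xy(1)] cos[OF xy(2)]] quot_algebra_simps(3)[OF I xy(1,2)] xy(3,4) by simp
      also have "\<dots> = map_mat c (T * S)"
      proof (rule eq_matI)
        fix i j assume "i < dim_row (map_mat c (T * S))" "j < dim_col (map_mat c (T * S))"
        then have ij: "i < n" "j < n" using TS by (auto simp: MC)
        have car: "T $$ (i, k) \<in> D" "S $$ (k, j) \<in> D" if "k < n" for k using TS ij that by (auto simp: MC)
        have dims: "dim_row T = n" "dim_col T = n" "dim_row S = n" "dim_col S = n" using TS by (auto simp: MC)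
        have "(map_mat c T \<otimes>\<^bsub>mat_algebra n Q\<^esub> map_mat c S) $$ (i, j)
            = (\<Oplus>\<^bsub>Q\<^esub>k\<in>{..<n}. map_mat c T $$ (i, k) \<otimes>\<^bsub>Q\<^esub> map_mat c S $$ (k, j))"
          using ij by (simp add: mat_algebra_def)
        also have "\<dots> = (\<Oplus>\<^bsub>Q\<^esub>k\<in>{..<n}. c (T $$ (i, k) * S $$ (k, j)))"
        proof -
          have "map_mat c T $$ (i, k) \<otimes>\<^bsub>Q\<^esub> map_mat c S $$ (k, j) = c (T $$ (i, k) * S $$ (k, j))" if "k < n" for k
            using that ij dims Q(3)[OF car(1)[OF that] car(2)[OF that]] by simp
          moreover have "c (T $$ (i, k) * S $$ (k, j)) \<in> carrier (ring_of D Quot J)" if "k < n" for k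
            using Q(1)[of "c (T $$ (i, k) * S $$ (k, j))"] D.mult_mem[OF car(1)[OF that] car(2)[OF that]]
            by (auto simp: Q_def quot_algebra_def)
          ultimately have "(\<Oplus>\<^bsub>ring_of D Quot J\<^esub>k\<in>{..<n}. map_mat c T $$ (i, k) \<otimes>\<^bsub>Q\<^esub> map_mat c S $$ (k, j))
              = (\<Oplus>\<^bsub>ring_of D Quot J\<^esub>k\<in>{..<n}. c (T $$ (i, k) * S $$ (k, j)))"
            by (intro QR.finsum_cong') auto
          moreover have "finsum Q g K = finsum (ring_of D Quot J) g K" for g and K :: "nat set"
            by (simp add: Q_def quot_algebra_def finsum_def finprod_def)
          ultimately show ?thesis by simp
        qed
        also have "\<dots> = c (\<Sum>k\<in>{..<n}. T $$ (i, k) * S $$ (k, j))"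
          using car by (intro Qsum D.mult_mem) auto
        also have "\<dots> = map_mat c (T * S) $$ (i, j)"
          using ij dims by (simp add: scalar_prod_def atLeast0LessThan)
        finally show "(map_mat c T \<otimes>\<^bsub>mat_algebra n Q\<^esub> map_mat c S) $$ (i, j) = map_mat c (T * S) $$ (i, j)" .
      qed (use TS D.mat_algebra_carrier_mat[of T n] D.mat_algebra_carrier_mat[of S n] in \<open>auto simp: mat_algebra_def\<close>)
      finally show ?thesis using xy TS D.mat_algebra_closed(1) by (simp add: rho_def)
    qed
    show "rho (r \<odot> x) (r \<cdot>\<^sub>m T)" if "rho x T" "r \<in> D" for x T r
    proof -
      have x: "x \<in> carrier A" "\<phi> (I +> x) = map_mat c T" and T: "T \<in> carrier (mat_algebra n (ring_of D))"
        using that by (auto simp: rho_def)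
      have "\<phi> (I +> (r \<odot> x)) = r \<odot>\<^bsub>mat_algebra n Q\<^esub> map_mat c T"
        using \<phi>s[OF that(2) cos[OF x(1)]] quot_smult_coset[OF I that(2) x(1)] x(2) by simp
      also have "\<dots> = map_mat c (r \<cdot>\<^sub>m T)"
      proof -
        have "T \<in> carrier_mat n n" "\<And>i j. i < n \<Longrightarrow> j < n \<Longrightarrow> T $$ (i, j) \<in> D"
          using T by (auto simp: MC)
        then show ?thesis using that(2) by (intro eq_matI) (auto simp: mat_algebra_def Q(6))
      qed
      finally show ?thesis using x T that(2) D.mat_algebra_closed(3) by (simp add: rho_def)
    qed
    show "rho \<one> (1\<^sub>m n)"
    proof -
      have "\<phi> (I +> \<one>) = \<one>\<^bsub>mat_algebra n Q\<^esub>"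
        using ring_hom_one[OF hom] quot_algebra_simps(4)[OF I] by simp
      also have "\<dots> = map_mat c (1\<^sub>m n)"
        using Q(4,5) by (intro eq_matI) (auto simp: mat_algebra_def)
      finally show ?thesis using D.mat_algebra_consts_closed by (simp add: rho_def)
    qed
    show "x \<ominus> y \<in> adic N" if "rho x T" "rho y T" for x y T
    proof -
      have xy: "x \<in> carrier A" "y \<in> carrier A" "\<phi> (I +> x) = \<phi> (I +> y)"
        using that by (auto simp: rho_def)
      have "I +> x = I +> y"
        using inj_onD[OF bij_betw_imp_inj_on[OF bij] xy(3) cos[OF xy(1)] cos[OF xy(2)]] .
      then have "x \<ominus> y \<in> I" using coset_eq_iff_diff[OF I xy(1,2)] by simp
      then show ?thesis by (rule IM)
    qed
    show "T $$ (i, j) - S $$ (i, j) \<in> P" if "rho x T" "rho x S" "i < n" "j < n" for x T S i j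
    proof -
      have TS: "T \<in> carrier (mat_algebra n (ring_of D))" "S \<in> carrier (mat_algebra n (ring_of D))"
        "map_mat c T = map_mat c S" using that by (auto simp: rho_def)
      have dims: "dim_row T = n" "dim_col T = n" "dim_row S = n" "dim_col S = n" using TS by (auto simp: MC)
      have "map_mat c T $$ (i, j) = map_mat c S $$ (i, j)" by (simp only: TS(3))
      then have "c (T $$ (i, j)) = c (S $$ (i, j))" using that dims by simp
      then have "T $$ (i, j) - S $$ (i, j) \<in> J" using c_eq TS that by (auto simp: MC)
      then show ?thesis using JP by blast
    qed
  qed
  then show ?thesis using that by blast
qed

section \<open>Polynomials that are not integer-valued\<close>

context matrix_reduction
begin

text \<open>A lift of the nilpotent Jordan block \<open>B\<close>. It satisfies \<open>B\<^sup>n = 0\<close>, while \<open>B\<^sup>n\<^sup>-\<^sup>1\<close> has an entry \<open>1\<close> in the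
  upper right corner.\<close>

lemma nilpotent_element:
  obtains y where "y \<in> carrier A" "y [^] n \<in> adic N" "y [^] (n - 1) \<notin> adic 1"
proof -
  define B :: "'k mat" where "B = jordan_block n 0"
  have "B \<in> carrier (mat_algebra n (ring_of D))"
    by (auto simp: D.mat_algebra_carrier B_def)
  then obtain y where y: "rho y B" using rho_right_total by blast
  have yc: "y \<in> carrier A" using rho_carrier(1)[OF y] .
  have pow: "rho (y [^] k) (B ^\<^sub>m k)" for k
  proof (induction k)
    case 0
    then show ?case using rho_one by (simp add: B_def)
  next
    case (Suc k)
    then show ?case using rho_mult[OF Suc y] by simp
  qed
  have "B ^\<^sub>m n = 0\<^sub>m n n"
    unfolding B_def jordan_block_zero_pow by (intro eq_matI) auto
  then have "adic_cong N (y [^] n) \<zero>" using rho_adic_cong[OF pow[of n]] rho_zero by simp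
  then have 1: "y [^] n \<in> adic N" by (simp add: adic_cong_zero)
  have 2: "y [^] (n - 1) \<notin> adic 1"
  proof
    assume "y [^] (n - 1) \<in> adic 1"
    then obtain s b where s: "s \<in> D - P" "b \<in> carrier A" "s \<odot> y [^] (n - 1) = (p ^ 1) \<odot> b" by (rule adic_E)
    obtain S where S: "rho b S" using rho_left_total[OF s(2)] by blast
    have Sc: "S \<in> carrier_mat n n" "\<And>i j. i < n \<Longrightarrow> j < n \<Longrightarrow> S $$ (i, j) \<in> D"
      using rho_carrier(2)[OF S] by (auto simp: D.mat_algebra_carrier)
    have r1: "rho ((p ^ 1) \<odot> b) (s \<cdot>\<^sub>m B ^\<^sub>m (n - 1))" using rho_smult[OF pow units_D[OF s(1)], of "n - 1"] s(3) by simp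
    have r2: "rho ((p ^ 1) \<odot> b) ((p ^ 1) \<cdot>\<^sub>m S)" using rho_smult[OF S p_pow_D] .
    have i: "0 < n" "n - 1 < n" using n_pos by auto
    have "(s \<cdot>\<^sub>m B ^\<^sub>m (n - 1)) $$ (0, n - 1) - ((p ^ 1) \<cdot>\<^sub>m S) $$ (0, n - 1) \<in> P"
      by (rule rho_unique[OF r1 r2 i])
    moreover have "(s \<cdot>\<^sub>m B ^\<^sub>m (n - 1)) $$ (0, n - 1) = s"
      using i by (simp add: B_def jordan_block_zero_pow)
    moreover have "((p ^ 1) \<cdot>\<^sub>m S) $$ (0, n - 1) = S $$ (0, n - 1) * p" using i Sc by (simp add: mult.commute)
    ultimately have "s - S $$ (0, n - 1) * p \<in> P" by simp
    moreover have "S $$ (0, n - 1) * p \<in> P" using P_mult[OF Sc(2)[OF i] p_mem] .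
    ultimately have "(s - S $$ (0, n - 1) * p) + S $$ (0, n - 1) * p \<in> P" by (rule P_add)
    then show False using s(1) by simp
  qed
  show ?thesis using that[OF yc 1 2] .
qed

text \<open>The equation says that \<open>f\<close> is, up to a unit at \<open>P\<close>, a polynomial divided by \<open>p\<^sup>r\<close> whose expansion around
  \<open>b\<close> starts, modulo \<open>p\<^sup>r\<close>, with \<open>p\<^sup>r\<^sup>-\<^sup>1\<kappa>(x - b)\<^sup>n\<^sup>-\<^sup>1\<close>. At \<open>b + y\<close>, with \<open>y\<close> the nilpotent element, this
  leading term alone survives modulo \<open>p\<^sup>r\<close>.\<close>

lemma not_Int_K_criterion:
  assumes r: "1 \<le> r" "r \<le> N" and b: "b \<in> D" and t: "t \<in> D - P" and \<kappa>: "\<kappa> \<in> D - P"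
    and L: "poly_over D L" "poly_over D L'"
    and eq: "Polynomial.smult (t * p ^ r) f
      = Polynomial.smult (p ^ (r - 1) * \<kappa>) ([:- b, 1:] ^ (n - 1)) + [:- b, 1:] ^ n * L + Polynomial.smult (p ^ r) L'"
  shows "f \<notin> Int_K D A"
proof
  assume f: "f \<in> Int_K D A"
  obtain y where y: "y \<in> carrier A" "y [^] n \<in> adic N" "y [^] (n - 1) \<notin> adic 1" using nilpotent_element by blast
  define x where "x = b \<odot> \<one> \<oplus> y"
  have x: "x \<in> carrier A" using y b by (simp add: x_def)
  define h where "h = [:- b, 1:]"
  have h: "poly_over D h" using b by (simp add: h_def D.uminus_mem)
  have evh: "ev h x = y"
  proof -
    have "ev h x = (- b) \<odot> \<one> \<oplus> x \<otimes> ev [:1:] x" unfolding h_def using b x by (intro ev_pCons) (auto simp: D.uminus_mem)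
    also have "\<dots> = (- b) \<odot> \<one> \<oplus> (b \<odot> \<one> \<oplus> y)" using x by (simp add: ev_const) (simp add: x_def)
    also have "\<dots> = y" using b y by (simp add: smult_uminus_left M.r_neg1)
    finally show ?thesis .
  qed
  have \<kappa>D: "\<kappa> \<in> D" "p ^ (r - 1) * \<kappa> \<in> D" using units_D[OF \<kappa>] D.mult_mem by auto
  have pieces: "poly_over D (Polynomial.smult (p ^ (r - 1) * \<kappa>) (h ^ (n - 1)))" "poly_over D (h ^ n * L)"
    "poly_over D (Polynomial.smult (p ^ r) L')"
    using h L \<kappa>D by (auto intro: D.poly_over_smult D.poly_over_mult D.poly_over_power)
  have d: "t * p ^ r \<in> D" "t * p ^ r \<noteq> 0"
    using units_D[OF t] units_nonzero[OF t] p_nonzero D.mult_mem by auto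
  have over: "poly_over D (Polynomial.smult (t * p ^ r) f)"
    unfolding eq using pieces by (simp add: h_def D.poly_over_add)
  obtain c where c: "c \<in> carrier A" "ev (Polynomial.smult (t * p ^ r) f) x = (t * p ^ r) \<odot> c"
    using f x unfolding Int_K_iff[OF d over] by blast
  define z1 z2 z3 where "z1 = (p ^ (r - 1) * \<kappa>) \<odot> y [^] (n - 1)" and "z2 = y [^] n \<otimes> ev L x" and "z3 = (p ^ r) \<odot> ev L' x"
  have z: "z1 \<in> carrier A" "z2 \<in> carrier A" "z3 \<in> carrier A"
    using y x L \<kappa>D by (simp_all add: z1_def z2_def z3_def)
  have "ev (Polynomial.smult (t * p ^ r) f) x = z1 \<oplus> z2 \<oplus> z3"
    unfolding eq h_def[symmetric] z1_def z2_def z3_def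
    using pieces h L x \<kappa>D evh
    by (simp add: ev_add D.poly_over_add ev_smult ev_mult ev_power D.poly_over_power)
  then have sum: "z1 \<oplus> z2 \<oplus> z3 = (t * p ^ r) \<odot> c" using c(2) by simp
  have "(t * p ^ r) \<odot> c = t \<odot> ((p ^ r) \<odot> c)" using c(1) units_D[OF t] by (simp add: smult_smult)
  then have m1: "z1 \<oplus> z2 \<oplus> z3 \<in> adic r" using sum adic_smult[OF adic_p_pow[OF c(1)] units_D[OF t]] by simp
  have m2: "z2 \<in> adic r" unfolding z2_def using adic_rmult[OF adic_mono[OF r(2) y(2)]] x L by simp
  have m3: "z3 \<in> adic r" unfolding z3_def using adic_p_pow x L by simp
  have "z1 = (z1 \<oplus> z2 \<oplus> z3) \<ominus> z3 \<ominus> z2"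
    using z by (simp add: M.minus_eq M.a_assoc M.r_neg)
  then have "z1 \<in> adic r" using adic_diff[OF adic_diff[OF m1 m3] m2] by simp
  moreover have "z1 = (p ^ (r - 1)) \<odot> (\<kappa> \<odot> y [^] (n - 1))"
    unfolding z1_def using y \<kappa>D by (simp add: smult_smult)
  moreover have "r = (r - 1) + 1" using r by simp
  ultimately have "(p ^ (r - 1)) \<odot> (\<kappa> \<odot> y [^] (n - 1)) \<in> adic ((r - 1) + 1)" by simp
  then have "\<kappa> \<odot> y [^] (n - 1) \<in> adic 1" using adic_p_cancel[of "\<kappa> \<odot> y [^] (n - 1)" "r - 1" 1] y(1) \<kappa>D by simp
  then have "y [^] (n - 1) \<in> adic 1" using adic_unit_cancel[OF \<kappa>, of "y [^] (n - 1)" 1] y(1) by simp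
  then show False using y(3) by simp
qed

end

lemma (in unital_subring) synthetic_div_over:
  assumes "poly_over S k" "b \<in> S"
  shows "poly_over S (synthetic_div k b)"
  using assms(1)
proof (induction k)
  case (pCons a k)
  then show ?case using poly_mem[of k b] assms(2) by simp
qed simp

lemma (in dedekind_prime) V_common_denom:
  assumes "finite W" "W \<subseteq> V"
  obtains t where "t \<in> D - P" "\<And>x. x \<in> W \<Longrightarrow> t * x \<in> D"
proof -
  have "\<exists>t\<in>D - P. \<forall>x\<in>W. t * x \<in> D"
    using assms
  proof (induction W rule: finite_induct)
    case empty
    then show ?case using U_one by blast
  next
    case (insert x W)
    then obtain t where t: "t \<in> D - P" "\<forall>x\<in>W. t * x \<in> D" by auto
    obtain s where s: "s \<in> D - P" "s * x \<in> D" using insert.prems V_iff by blast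
    have "s * t * y \<in> D" if "y \<in> insert x W" for y
    proof (cases "y = x")
      case True
      have "s * t * y = t * (s * x)" using True by simp
      moreover have "t * (s * x) \<in> D" using t(1) s(2) by (simp add: mult_mem)
      ultimately show ?thesis by (simp only:)
    next
      case False
      then show ?thesis using mult_mem[of s "t * y"] t s that by (simp add: mult.assoc)
    qed
    then show ?case using U_mult[OF s(1) t(1)] by blast
  qed
  then show ?thesis using that by blast
qed

text \<open>A denominator prime to \<open>P\<close>: clearing it changes nothing locally at \<open>P\<close>.\<close>

lemma (in dedekind_prime) V_polys_common_denom:
  assumes "poly_over V f" "poly_over V g" "w \<in> V"
  obtains t where "t \<in> D - P" "poly_over D (Polynomial.smult t f)" "poly_over D (Polynomial.smult t g)" "t * w \<in> D"
proof -
  let ?W = "insert w (Polynomial.coeff f ` {..Polynomial.degree f} \<union> Polynomial.coeff g ` {..Polynomial.degree g})"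
  have "?W \<subseteq> V" using assms by (auto simp: poly_over_def)
  then obtain t where t: "t \<in> D - P" "\<And>x. x \<in> ?W \<Longrightarrow> t * x \<in> D" using V_common_denom[of ?W] by auto
  have "t * Polynomial.coeff f i \<in> D" for i
    using t(2) by (cases "i \<le> Polynomial.degree f") (auto simp: coeff_eq_0)
  moreover have "t * Polynomial.coeff g i \<in> D" for i
    using t(2) by (cases "i \<le> Polynomial.degree g") (auto simp: coeff_eq_0)
  ultimately show ?thesis using that[OF t(1)] t(2)[of w] by (auto simp: poly_over_def)
qed

lemma shift_power:
  fixes b c e :: "'b::comm_ring_1"
  assumes "unital_subring S" "b \<in> S" "e \<in> S" "u \<in> S" and bc: "b = c + u * e"
  shows "\<exists>E. poly_over S E \<and> [:- b, 1:] ^ m = [:- c, 1:] ^ m + Polynomial.smult u E"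
proof (induction m)
  case 0
  interpret unital_subring S by fact
  show ?case by (intro exI[of _ 0]) simp
next
  case (Suc m)
  interpret unital_subring S by fact
  obtain E where E: "poly_over S E" "[:- b, 1:] ^ m = [:- c, 1:] ^ m + Polynomial.smult u E" using Suc by blast
  have cS: "c \<in> S" using bc assms diff_mem[of b "u * e"] mult_mem by simp
  have lin: "[:- b, 1:] = [:- c, 1:] + Polynomial.smult u [:- e:]" using bc by simp
  have "[:- b, 1:] ^ Suc m = [:- b, 1:] * ([:- c, 1:] ^ m + Polynomial.smult u E)" by (simp add: E(2))
  also have "\<dots> = [:- c, 1:] ^ Suc m + Polynomial.smult u ([:- e:] * [:- c, 1:] ^ m + [:- b, 1:] * E)"
  proof -
    have alg: "x0 * (z + u' * E') = xc * z + u' * (e' * z + x0 * E')" if "x0 = xc + u' * e'" for x0 xc z u' e' E' :: "'b poly"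
      unfolding that by (simp add: algebra_simps)
    show ?thesis
      using alg[of "[:- b, 1:]" "[:- c, 1:]" "[:u:]" "[:- e:]" "[:- c, 1:] ^ m" E] bc by simp
  qed
  finally have eq: "[:- b, 1:] ^ Suc m = [:- c, 1:] ^ Suc m + Polynomial.smult u ([:- e:] * [:- c, 1:] ^ m + [:- b, 1:] * E)" .
  have "poly_over S [:- e:]" "poly_over S [:- c, 1:]" "poly_over S [:- b, 1:]"
    using uminus_mem assms(2,3) cS by simp_all
  then have "poly_over S ([:- e:] * [:- c, 1:] ^ m + [:- b, 1:] * E)"
    using E(1) by (intro poly_over_add poly_over_mult poly_over_power)
  then show ?case using eq by blast
qed

text \<open>The centre \<open>b\<^sub>0\<close> lies in \<open>V\<close> only. It is replaced by \<open>b \<in> D\<close> with \<open>b \<equiv> b\<^sub>0\<close> modulo \<open>p\<^sup>r\<close>, which changes the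
  numerator by a multiple of \<open>p\<^sup>r\<close>; then denominators prime to \<open>P\<close> are cleared.\<close>

theorem (in matrix_reduction) not_integer_valued:
  assumes dp: "dedekind_prime D P" and V: "V = dedekind_prime.V D P" and PV: "PV = dedekind_prime.PV D P"
    and s0: "s0 \<in> D - P" "p = s0 * \<pi>" and r: "1 \<le> r" "r \<le> N" and c: "c \<in> D - P"
    and b0: "b0 \<in> V" and k: "poly_over V k" "poly k b0 = \<pi> ^ (r - 1) * w" "w \<in> V - PV"
  shows "Polynomial.smult c (Polynomial.smult (1 / \<pi> ^ r) ([:- b0, 1:] ^ (n - 1) * k)) \<notin> Int_K D A"
proof -
  interpret dp: dedekind_prime D P by fact
  interpret V: unital_subring V unfolding V by (rule dp.subring_V)
  have \<pi>0: "\<pi> \<noteq> 0" using p_nonzero s0 by auto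
  obtain s where s: "s \<in> D - P" "s * b0 \<in> D" using b0 dp.V_iff unfolding V by blast
  obtain t u where t: "t \<in> D" "u \<in> P" "1 - s * t = u ^ r" using unit_inverse[OF s(1)] by blast
  obtain s' d where s': "s' \<in> D - P" "d \<in> D" "s' * u = p * d" using p_generates[OF t(2)] by blast
  define v where "v = d / s'"
  have s'0: "s' \<noteq> 0" using units_nonzero[OF s'(1)] .
  have v: "v \<in> V" "u = p * v"
  proof -
    have "s' * v \<in> D" using s' s'0 by (simp add: v_def)
    then show "v \<in> V" using dp.V_iff s'(1) unfolding V by blast
    show "u = p * v" using s'(3) s'0 by (simp add: v_def field_simps)
  qed
  define b where "b = t * (s * b0)"
  have b: "b \<in> D" unfolding b_def using t(1) s(2) by (rule D.mult_mem)
  define e where "e = v ^ r * b0"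
  have e: "e \<in> V" unfolding e_def using v(1) b0 by (intro V.mult_mem V.power_mem)
  have pV: "p ^ r \<in> V" using dp.D_subset_V[OF p_pow_D] unfolding V .
  have "b0 - b = (1 - s * t) * b0" by (simp add: b_def algebra_simps)
  also have "\<dots> = p ^ r * e" unfolding t(3) v(2) e_def by (simp add: power_mult_distrib)
  finally have bb: "b0 = b + p ^ r * e" by (simp add: algebra_simps)
  define h0 where "h0 = [:- b0, 1:]"
  define h where "h = [:- b, 1:]"
  obtain E1 where E1: "poly_over V E1" "h0 ^ (n - 1) = h ^ (n - 1) + Polynomial.smult (p ^ r) E1"
    using shift_power[OF V.unital_subring_axioms b0 e pV bb, of "n - 1"] unfolding h0_def h_def by blast
  obtain E2 where E2: "poly_over V E2" "h0 ^ n = h ^ n + Polynomial.smult (p ^ r) E2"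
    using shift_power[OF V.unital_subring_axioms b0 e pV bb, of n] unfolding h0_def h_def by blast
  define l where "l = synthetic_div k b0"
  have l: "poly_over V l" unfolding l_def by (rule V.synthetic_div_over[OF k(1) b0])
  define \<kappa>0 where "\<kappa>0 = poly k b0"
  have \<kappa>0: "\<kappa>0 \<in> V" unfolding \<kappa>0_def by (rule V.poly_mem[OF k(1) b0])
  have kl: "k = [:\<kappa>0:] + h0 * l"
    using synthetic_div_correct'[of b0 k] by (simp add: l_def h0_def \<kappa>0_def add.commute)
  have nn: "h0 ^ (n - 1) * h0 = h0 ^ n" using n_pos by (metis Suc_diff_1 less_eq_Suc_le One_nat_def power_Suc2)
  define L' where "L' = Polynomial.smult \<kappa>0 E1 + E2 * l"
  have L': "poly_over V L'" unfolding L'_def using \<kappa>0 E1 E2 l by (intro V.poly_over_add V.poly_over_smult V.poly_over_mult)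
  have "h0 ^ (n - 1) * k = Polynomial.smult \<kappa>0 (h0 ^ (n - 1)) + h0 ^ (n - 1) * h0 * l"
    unfolding kl by (simp add: algebra_simps)
  also have "h0 ^ (n - 1) * h0 * l = h0 ^ n * l" by (simp only: nn)
  also have "Polynomial.smult \<kappa>0 (h0 ^ (n - 1)) + h0 ^ n * l
      = Polynomial.smult \<kappa>0 (h ^ (n - 1)) + h ^ n * l + Polynomial.smult (p ^ r) L'"
    unfolding E1(2) E2(2) L'_def by (simp add: algebra_simps Polynomial.smult_add_right)
  finally have G: "h0 ^ (n - 1) * k = Polynomial.smult \<kappa>0 (h ^ (n - 1)) + h ^ n * l + Polynomial.smult (p ^ r) L'" .
  obtain \<tau> where \<tau>: "\<tau> \<in> D - P" "poly_over D (Polynomial.smult \<tau> l)" "poly_over D (Polynomial.smult \<tau> L')" "\<tau> * w \<in> D"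
    using dp.V_polys_common_denom[of l L' w] l L' k(3) unfolding V by blast
  have \<tau>w: "\<tau> * w \<in> D - P"
  proof -
    have "\<tau> * w \<notin> PV" using dp.unit_mult[of \<tau> w] k(3) dp.D_subset_V dp.P_eq_PV \<tau>(1) unfolding V PV by blast
    then show ?thesis using \<tau>(4) dp.P_eq_PV[OF \<tau>(4)] unfolding PV by blast
  qed
  define \<gamma> where "\<gamma> = c * s0 ^ r"
  have s0r: "s0 ^ j \<in> D - P" for j by (induction j) (use s0 units_one units_mult in auto)
  have \<gamma>: "\<gamma> \<in> D" unfolding \<gamma>_def using units_D[OF c] units_D[OF s0r] D.mult_mem by blast
  \<comment> \<open>The factor \<open>s0\<^sup>r\<close> turns \<open>\<pi>\<^sup>r\<close> into \<open>p\<^sup>r\<close>; one factor \<open>s0\<close> remains beside \<open>p\<^sup>r\<^sup>-\<^sup>1\<close>.\<close>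
  define \<kappa> where "\<kappa> = c * s0 * (\<tau> * w)"
  have \<kappa>: "\<kappa> \<in> D - P" unfolding \<kappa>_def using units_mult[OF units_mult[OF c s0(1)] \<tau>w] .
  let ?f = "Polynomial.smult c (Polynomial.smult (1 / \<pi> ^ r) (h0 ^ (n - 1) * k))"
  have lead: "\<gamma> * \<tau> * \<kappa>0 = p ^ (r - 1) * \<kappa>"
  proof -
    have "s0 ^ r = s0 ^ (r - 1) * s0" using r(1) by (metis Suc_diff_1 less_eq_Suc_le One_nat_def power_Suc2)
    then show ?thesis unfolding \<gamma>_def \<kappa>_def \<kappa>0_def k(2) s0(2) by (simp add: power_mult_distrib)
  qed
  have "\<tau> * p ^ r * (c * (1 / \<pi> ^ r)) = \<gamma> * \<tau>"
    using \<pi>0 unfolding \<gamma>_def s0(2) by (simp add: power_mult_distrib)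
  then have "Polynomial.smult (\<tau> * p ^ r) ?f = Polynomial.smult (\<gamma> * \<tau>) (h0 ^ (n - 1) * k)"
    by (simp add: mult.assoc)
  also have "\<dots> = Polynomial.smult (\<gamma> * \<tau> * \<kappa>0) (h ^ (n - 1)) + h ^ n * Polynomial.smult \<gamma> (Polynomial.smult \<tau> l)
      + Polynomial.smult (p ^ r) (Polynomial.smult \<gamma> (Polynomial.smult \<tau> L'))"
    unfolding G by (simp add: Polynomial.smult_add_right mult_ac)
  finally have eq: "Polynomial.smult (\<tau> * p ^ r) ?f = Polynomial.smult (p ^ (r - 1) * \<kappa>) ([:- b, 1:] ^ (n - 1))
      + [:- b, 1:] ^ n * Polynomial.smult \<gamma> (Polynomial.smult \<tau> l)
      + Polynomial.smult (p ^ r) (Polynomial.smult \<gamma> (Polynomial.smult \<tau> L'))"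
    unfolding lead h_def .
  have "?f \<notin> Int_K D A"
    by (rule not_Int_K_criterion[OF r b \<tau>(1) \<kappa> _ _ eq]) (use \<gamma> \<tau> D.poly_over_smult in blast)+
  then show ?thesis by (simp add: h0_def)
qed

section \<open>The polynomial F\<close>

text \<open>Otherwise \<open>x\<close> would be a proper factor of \<open>f\<close> that is not a unit.\<close>

lemma (in UP_domain) irreducible_const_coeff:
  assumes f: "f \<in> carrier P" "Divisibility.irreducible P f" and deg: "2 \<le> deg R f"
  shows "up_ring.coeff P f 0 \<noteq> \<zero>"
proof
  assume f0: "up_ring.coeff P f 0 = \<zero>"
  define x where "x = UnivPoly.monom P \<one> 1"
  have x: "x \<in> carrier P" by (simp add: x_def)
  have fup: "f \<in> up R" using f(1) unfolding P_def UP_def partial_object.select_convs .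
  define g where "g = (\<lambda>n. f (Suc n))"
  have gup: "g \<in> up R"
  proof (rule mem_upI)
    show "g n \<in> carrier R" for n unfolding g_def by (rule mem_upD[OF fup])
    obtain n where n: "bound \<zero> n f" using R.bound_upD[OF fup] by blast
    have "bound \<zero> n g" unfolding g_def by (rule bound.intro) (rule bound.bound[OF n], simp)
    then show "\<exists>n. bound \<zero> n g" by blast
  qed
  have g: "g \<in> carrier P" using gup unfolding P_def UP_def partial_object.select_convs .
  have cg: "up_ring.coeff P g n = up_ring.coeff P f (Suc n)" for n
    using gup fup unfolding P_def UP_def up_ring.select_convs restrict_def by (simp only: if_True g_def)
  have fx: "f = x \<otimes>\<^bsub>P\<^esub> g"
  proof (rule up_eqI[OF _ f(1) UP_mult_closed[OF x g]])
    fix n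
    show "up_ring.coeff P f n = up_ring.coeff P (x \<otimes>\<^bsub>P\<^esub> g) n"
    proof (cases n)
      case 0
      have "up_ring.coeff P (x \<otimes>\<^bsub>P\<^esub> g) 0 = (\<Oplus>i\<in>{..0}. up_ring.coeff P x i \<otimes> up_ring.coeff P g (0 - i))"
        by (rule coeff_mult[OF x g])
      also have "\<dots> = up_ring.coeff P x 0 \<otimes> up_ring.coeff P g 0"
        using x g by simp
      also have "up_ring.coeff P x 0 = \<zero>" unfolding x_def by (subst coeff_monom) simp_all
      also have "\<zero> \<otimes> up_ring.coeff P g 0 = \<zero>" using g by simp
      finally show ?thesis using f0 0 by simp
    next
      case (Suc k)
      have "up_ring.coeff P (x \<otimes>\<^bsub>P\<^esub> g) (k + 1) = \<one> \<otimes> up_ring.coeff P g k"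
        unfolding x_def by (rule coeff_monom_mult) (use g in simp_all)
      also have "\<dots> = up_ring.coeff P f (Suc k)" using cg[of k] coeff_closed[OF f(1), of "Suc k"] by simp
      finally show ?thesis using Suc by simp
    qed
  qed
  have degx: "deg R x = 1" unfolding x_def by (rule deg_monom) simp_all
  have x0: "x \<noteq> \<zero>\<^bsub>P\<^esub>"
  proof
    assume "x = \<zero>\<^bsub>P\<^esub>"
    then show False using degx deg_zero by simp
  qed
  have fn0: "f \<noteq> \<zero>\<^bsub>P\<^esub>"
  proof
    assume "f = \<zero>\<^bsub>P\<^esub>"
    then show False using deg deg_zero by simp
  qed
  have "x divides\<^bsub>P\<^esub> f" unfolding factor_def using fx g by blast
  moreover have "\<not> f divides\<^bsub>P\<^esub> x"
  proof
    assume "f divides\<^bsub>P\<^esub> x"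
    then obtain c where c: "c \<in> carrier P" "x = f \<otimes>\<^bsub>P\<^esub> c" unfolding factor_def by blast
    have "c \<noteq> \<zero>\<^bsub>P\<^esub>"
    proof
      assume "c = \<zero>\<^bsub>P\<^esub>"
      then have "x = \<zero>\<^bsub>P\<^esub>" using c(2) P.r_null[OF f(1)] by simp
      then show False using x0 by contradiction
    qed
    then have "deg R x = deg R f + deg R c" unfolding c(2) by (rule deg_mult[OF fn0 _ f(1) c(1)])
    then show False using degx deg by simp
  qed
  ultimately have "x \<in> Units P" using f(2) x unfolding Divisibility.irreducible_def properfactor_def by blast
  then obtain y where y: "y \<in> carrier P" "x \<otimes>\<^bsub>P\<^esub> y = \<one>\<^bsub>P\<^esub>" unfolding Units_def by blast
  have "y \<noteq> \<zero>\<^bsub>P\<^esub>"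
  proof
    assume "y = \<zero>\<^bsub>P\<^esub>"
    then have "\<one>\<^bsub>P\<^esub> = \<zero>\<^bsub>P\<^esub>" using y(2) P.r_null[OF x] by simp
    then show False using UP_one_not_zero by contradiction
  qed
  then have "deg R (x \<otimes>\<^bsub>P\<^esub> y) = deg R x + deg R y" by (rule deg_mult[OF x0 _ x y(1)])
  then show False unfolding y(2) using degx deg_one by simp
qed

context dedekind_prime
begin

lemma residue_carrier:
  assumes "maximalideal (PIdl\<^bsub>ring_of V\<^esub> \<pi>) (ring_of V)"
  shows "residue_ring V \<pi> = ring_of V Quot PV"
    "Z \<in> carrier (residue_ring V \<pi>) \<longleftrightarrow> (\<exists>v\<in>V. Z = PV +>\<^bsub>ring_of V\<^esub> v)"
    "\<zero>\<^bsub>residue_ring V \<pi>\<^esub> = PV"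
proof -
  have "PIdl\<^bsub>ring_of V\<^esub> \<pi> = PV" using maximal_eq_PV[OF assms] .
  then show eq: "residue_ring V \<pi> = ring_of V Quot PV" by (simp add: residue_ring_def)
  show "Z \<in> carrier (residue_ring V \<pi>) \<longleftrightarrow> (\<exists>v\<in>V. Z = PV +>\<^bsub>ring_of V\<^esub> v)"
    unfolding eq by (auto simp: FactRing_def A_RCOSETS_def')
  show "\<zero>\<^bsub>residue_ring V \<pi>\<^esub> = PV" unfolding eq by (simp add: FactRing_def)
qed

lemma coset_V_iff: "v \<in> V \<Longrightarrow> x \<in> PV +>\<^bsub>ring_of V\<^esub> v \<longleftrightarrow> x - v \<in> PV"
proof
  assume "x \<in> PV +>\<^bsub>ring_of V\<^esub> v"
  then show "x - v \<in> PV" by (auto simp: a_r_coset_def r_coset_def)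
next
  assume "x - v \<in> PV"
  moreover have "x = (x - v) + v" by simp
  ultimately show "x \<in> PV +>\<^bsub>ring_of V\<^esub> v" by (force simp: a_r_coset_def r_coset_def)
qed

lemma coset_V_eq:
  assumes "v \<in> V" "w \<in> V" "v - w \<in> PV"
  shows "PV +>\<^bsub>ring_of V\<^esub> v = PV +>\<^bsub>ring_of V\<^esub> w"
proof -
  have "x - v \<in> PV \<longleftrightarrow> x - w \<in> PV" for x
  proof
    assume "x - v \<in> PV"
    then have "(x - v) + (v - w) \<in> PV" using assms(3) by (rule PV_add)
    then show "x - w \<in> PV" by simp
  next
    assume "x - w \<in> PV"
    then have "(x - w) + - (v - w) \<in> PV" using PV_uminus[OF assms(3)] by (rule PV_add)
    then show "x - v \<in> PV" by simp
  qed
  then show ?thesis using coset_V_iff assms by auto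
qed

lemma coset_V_subset: "v \<in> V \<Longrightarrow> x \<in> PV +>\<^bsub>ring_of V\<^esub> v \<Longrightarrow> x \<in> V"
proof -
  assume v: "v \<in> V" and "x \<in> PV +>\<^bsub>ring_of V\<^esub> v"
  then have "(x - v) + v \<in> V" using coset_V_iff PV_subset_V V.add_mem by blast
  then show ?thesis by simp
qed

text \<open>The map \<open>D/P \<rightarrow> V/PV\<close> is surjective because denominators are invertible modulo \<open>P\<close>. So
  the exponent of \<open>\<pi>\<close> in \<open>F\<close> is at most that of \<open>P\<close> in the isomorphism, as \<open>not_integer_valued\<close> requires.\<close>

lemma residue_field_card:
  assumes max: "maximalideal (PIdl\<^bsub>ring_of V\<^esub> \<pi>) (ring_of V)"
    and fin: "finite (carrier (ring_of D Quot P))"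
  shows "finite (carrier (residue_ring V \<pi>))"
    "card (carrier (residue_ring V \<pi>)) \<le> card (carrier (ring_of D Quot P))"
    "card (carrier (residue_ring V \<pi>)) \<ge> 1"
proof -
  define g where "g Z = PV +>\<^bsub>ring_of V\<^esub> (SOME d. d \<in> Z)" for Z :: "'k set"
  have sub: "carrier (residue_ring V \<pi>) \<subseteq> g ` carrier (ring_of D Quot P)"
  proof
    fix Z assume "Z \<in> carrier (residue_ring V \<pi>)"
    then obtain v where v: "v \<in> V" "Z = PV +>\<^bsub>ring_of V\<^esub> v" using residue_carrier[OF max] by blast
    obtain s where s: "s \<in> D - P" "s * v \<in> D" using v(1) V_iff by blast
    obtain t where t: "t \<in> D" "1 - s * t \<in> P" using P_max[OF s(1)] by blast
    define d where "d = t * (s * v)"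
    have d: "d \<in> D" unfolding d_def using t(1) s(2) by (rule mult_mem)
    have "1 - s * t \<in> PV" using P_eq_PV[OF P_sub[OF t(2)]] t(2) by simp
    then have "v * (1 - s * t) \<in> PV" by (rule PV_mult[OF v(1)])
    then have vd: "v - d \<in> PV" by (simp add: d_def algebra_simps)
    let ?Y = "P +>\<^bsub>ring_of D\<^esub> d"
    have "d = 0 + d" by simp
    then have "d \<in> ?Y" using P_zero by (force simp: a_r_coset_def r_coset_def)
    then have "(SOME d. d \<in> ?Y) \<in> ?Y" by (rule someI)
    then obtain u where u: "u \<in> P" "(SOME d. d \<in> ?Y) = u + d" by (auto simp: a_r_coset_def r_coset_def)
    have "u \<in> PV" using P_eq_PV[OF P_sub[OF u(1)]] u(1) by simp
    then have "u + - (v - d) \<in> PV" using PV_uminus[OF vd] by (rule PV_add)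
    then have "(u + d) - v \<in> PV" by (simp add: algebra_simps)
    then have "g ?Y = Z" unfolding g_def u(2) v(2)
      using D_subset_V[OF add_mem[OF P_sub[OF u(1)] d]] v(1) by (intro coset_V_eq)
    moreover have "?Y \<in> carrier (ring_of D Quot P)" using d by (auto simp: FactRing_def A_RCOSETS_def')
    ultimately show "Z \<in> g ` carrier (ring_of D Quot P)" by blast
  qed
  show f: "finite (carrier (residue_ring V \<pi>))" using finite_subset[OF sub] fin by simp
  show "card (carrier (residue_ring V \<pi>)) \<le> card (carrier (ring_of D Quot P))"
    using card_mono[OF finite_imageI[OF fin] sub] card_image_le[OF fin, of g] by simp
  have "PV +>\<^bsub>ring_of V\<^esub> 0 \<in> carrier (residue_ring V \<pi>)" using residue_carrier(2)[OF max] by auto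
  then show "card (carrier (residue_ring V \<pi>)) \<ge> 1"
    using f by (metis One_nat_def Suc_leI card_gt_0_iff empty_iff)
qed

text \<open>Modulo \<open>PV\<close> the factors of \<open>\<theta>\<close> are irreducible of degree at least \<open>2\<close>, so they do not vanish at \<open>0\<close>.\<close>

lemma theta_unit:
  assumes ch: "F_choices V n \<pi> rep lift" and b0: "b0 \<in> PV"
  shows "poly_over V (theta_poly V n \<pi> lift)" "poly (theta_poly V n \<pi> lift) b0 \<in> V - PV"
proof -
  have max: "maximalideal (PIdl\<^bsub>ring_of V\<^esub> \<pi>) (ring_of V)" using ch by (simp add: F_choices_def)
  let ?R = "residue_ring V \<pi>"
  have maxPV: "maximalideal PV (ring_of V)" using max maximal_eq_PV[OF max] by simp
  have "field ?R" unfolding residue_carrier(1)[OF max]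
    by (rule maximalideal.quotient_is_field[OF maxPV V.cring_ring_of])
  then interpret F: field ?R .
  interpret UP: UP_domain ?R "UP ?R" by unfold_locales simp
  have lift: "poly_over V (lift f) \<and> poly (lift f) b0 \<in> V - PV" if f: "f \<in> irred_polys V \<pi> n" for f
  proof -
    have fP: "f \<in> carrier (UP ?R)" "Divisibility.irreducible (UP ?R) f" "2 \<le> deg ?R f"
      using f by (auto simp: irred_polys_def)
    have co: "Polynomial.coeff (lift f) i \<in> up_ring.coeff (UP ?R) f i" for i
      using ch f by (simp add: F_choices_def)
    have car: "up_ring.coeff (UP ?R) f i \<in> carrier ?R" for i using fP(1) by simp
    have inV: "Polynomial.coeff (lift f) i \<in> V" for i
      using co[of i] car[of i] residue_carrier(2)[OF max] coset_V_subset by metis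
    then have over: "poly_over V (lift f)" by (simp add: poly_over_def)
    have "Polynomial.coeff (lift f) 0 \<notin> PV"
    proof
      assume in0: "Polynomial.coeff (lift f) 0 \<in> PV"
      obtain v where v: "v \<in> V" "up_ring.coeff (UP ?R) f 0 = PV +>\<^bsub>ring_of V\<^esub> v"
        using car[of 0] residue_carrier(2)[OF max] by blast
      have "Polynomial.coeff (lift f) 0 - v \<in> PV" using co[of 0] coset_V_iff[OF v(1)] v(2) by simp
      then have "- (Polynomial.coeff (lift f) 0 - v) + Polynomial.coeff (lift f) 0 \<in> PV"
        using PV_add[OF PV_uminus in0] by blast
      then have "v - 0 \<in> PV" by simp
      then have "up_ring.coeff (UP ?R) f 0 = PV +>\<^bsub>ring_of V\<^esub> 0"
        unfolding v(2) using v(1) by (intro coset_V_eq) auto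
      also have "PV +>\<^bsub>ring_of V\<^esub> 0 = PV"
        using coset_V_iff[OF V.zero_mem] by auto
      also have "PV = \<zero>\<^bsub>?R\<^esub>" using residue_carrier(3)[OF max] by simp
      finally show False using UP.irreducible_const_coeff[OF fP] by simp
    qed
    moreover have "poly (lift f) b0 - Polynomial.coeff (lift f) 0 \<in> PV"
    proof (cases "lift f")
      case (pCons a g)
      have "poly_over V g" using over pCons by simp
      then have "poly g b0 \<in> V" using V.poly_mem PV_subset_V[OF b0] by blast
      then have "poly g b0 * b0 \<in> PV" using b0 by (rule PV_mult)
      then show ?thesis using pCons by (simp add: mult.commute)
    qed
    moreover have "x \<in> PV" if "y - x \<in> PV" "y \<in> PV" for x y
      using PV_add[OF that(2) PV_uminus[OF that(1)]] by simp
    ultimately have "poly (lift f) b0 \<notin> PV" by blast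
    then show ?thesis using over V.poly_mem[OF over PV_subset_V[OF b0]] by simp
  qed
  show "poly_over V (theta_poly V n \<pi> lift)"
    unfolding theta_poly_def using lift by (intro V.poly_over_prod V.poly_over_power) blast
  show "poly (theta_poly V n \<pi> lift) b0 \<in> V - PV"
    unfolding theta_poly_def poly_prod poly_power using lift by (intro unit_prod unit_power) blast
qed

text \<open>The root \<open>b\<^sub>0\<close> represents the zero class. In the product \<open>H\<close> only the factor \<open>h(x - b\<^sub>0)\<close> is not a unit at
  \<open>b\<^sub>0\<close>. Besides \<open>(x - b\<^sub>0)\<^sup>n\<^sup>-\<^sup>1\<close> it consists of the \<open>q - 1\<close> factors \<open>(x - b\<^sub>0)\<^sup>n + \<pi>a\<close>, with value \<open>\<pi>a\<close> at \<open>b\<^sub>0\<close>.\<close>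

lemma F_decomposition:
  assumes ch: "F_choices V n \<pi> rep lift" and n: "n \<ge> 1"
    and fin: "finite (carrier (ring_of D Quot P))"
  defines "q \<equiv> card (carrier (residue_ring V \<pi>))"
  obtains b0 k w where "b0 \<in> V" "poly_over V k" "poly k b0 = \<pi> ^ (q - 1) * w" "w \<in> V - PV"
    "F_poly V n \<pi> rep lift = Polynomial.smult (1 / \<pi> ^ q) ([:- b0, 1:] ^ (n - 1) * k)"
proof -
  have \<pi>: "\<pi> \<in> V" and max: "maximalideal (PIdl\<^bsub>ring_of V\<^esub> \<pi>) (ring_of V)"
    and rep: "\<And>Z. Z \<in> carrier (residue_ring V \<pi>) \<Longrightarrow> rep Z \<in> Z"
    using ch by (auto simp: F_choices_def)
  let ?R = "residue_ring V \<pi>"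
  let ?C = "carrier ?R"
  note car = residue_carrier(2)[OF max]
  have finC: "finite ?C" using residue_field_card[OF max fin] by blast
  have zeroC: "PV \<in> ?C"
  proof -
    have "PV = PV +>\<^bsub>ring_of V\<^esub> 0"
      by (rule Set.set_eqI) (simp only: coset_V_iff[OF V.zero_mem] diff_zero)
    then show ?thesis by (intro car[THEN iffD2] bexI[OF _ V.zero_mem])
  qed
  have repV: "rep Z \<in> V" if Z: "Z \<in> ?C" for Z
  proof -
    obtain v where v: "v \<in> V" "Z = PV +>\<^bsub>ring_of V\<^esub> v" using car[THEN iffD1, OF Z] by blast
    have "rep Z \<in> PV +>\<^bsub>ring_of V\<^esub> v" using rep[OF that] by (simp only: v(2))
    then show ?thesis by (rule coset_V_subset[OF v(1)])
  qed
  have rep_diff: "rep Z - rep Z' \<in> V - PV" if ZZ: "Z \<in> ?C" "Z' \<in> ?C" "Z \<noteq> Z'" for Z Z'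
  proof -
    obtain v v' where v: "v \<in> V" "Z = PV +>\<^bsub>ring_of V\<^esub> v" "v' \<in> V" "Z' = PV +>\<^bsub>ring_of V\<^esub> v'"
      using car[THEN iffD1, OF ZZ(1)] car[THEN iffD1, OF ZZ(2)] by blast
    have "rep Z \<in> PV +>\<^bsub>ring_of V\<^esub> v" "rep Z' \<in> PV +>\<^bsub>ring_of V\<^esub> v'"
      using rep[OF ZZ(1)] rep[OF ZZ(2)] by (simp_all only: v(2,4))
    then have 1: "rep Z - v \<in> PV" "rep Z' - v' \<in> PV"
      using coset_V_iff[OF v(1)] coset_V_iff[OF v(3)] by blast+
    have "rep Z - rep Z' \<notin> PV"
    proof
      assume a: "rep Z - rep Z' \<in> PV"
      have "- (rep Z - v) + (rep Z - rep Z') + (rep Z' - v') \<in> PV"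
        using PV_add[OF PV_add[OF PV_uminus[OF 1(1)] a] 1(2)] .
      then have "v - v' \<in> PV" by simp
      then have "Z = Z'" unfolding v(2,4) by (rule coset_V_eq[OF v(1,3)])
      then show False using ZZ(3) by contradiction
    qed
    then show ?thesis using V.diff_mem[OF repV[OF ZZ(1)] repV[OF ZZ(2)]] by blast
  qed
  have inj: "inj_on rep ?C"
  proof (rule inj_onI)
    fix Z Z' assume Z: "Z \<in> ?C" "Z' \<in> ?C" "rep Z = rep Z'"
    then have "rep Z - rep Z' \<in> PV" using PV_zero by simp
    then show "Z = Z'" using rep_diff[OF Z(1,2)] by blast
  qed
  define b0 where "b0 = rep PV"
  have b0: "b0 \<in> PV" using rep[OF zeroC] by (simp add: b0_def)
  define Cs where "Cs = rep ` (?C - {\<zero>\<^bsub>?R\<^esub>})"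
  have Cs: "Cs = rep ` (?C - {PV})" by (simp add: Cs_def residue_carrier(3)[OF max])
  have CsV: "a \<in> V - PV" if "a \<in> Cs" for a
  proof -
    obtain Z where Z: "Z \<in> ?C" "Z \<noteq> PV" "a = rep Z" using \<open>a \<in> Cs\<close> unfolding Cs by blast
    have "a - b0 \<notin> PV" "a \<in> V"
      using rep_diff[OF Z(1) zeroC Z(2)] repV[OF Z(1)] unfolding b0_def Z(3) by blast+
    moreover have "a - b0 \<in> PV" if "a \<in> PV"
      using PV_add[OF that PV_uminus[OF b0]] by simp
    ultimately show ?thesis by blast
  qed
  have cardCs: "card Cs = q - 1"
  proof -
    have "card Cs = card (?C - {PV})" unfolding Cs using inj by (intro card_image) (rule inj_on_diff)
    also have "\<dots> = q - 1" using finC zeroC by (simp add: q_def)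
    finally show ?thesis .
  qed
  define h where "h = h_poly V n \<pi> rep"
  have h: "h = [:0, 1:] ^ (n - 1) * (\<Prod>a\<in>Cs. [:0, 1:] ^ n + [:\<pi> * a:])"
    by (simp add: h_def h_poly_def Cs_def)
  define \<theta> where "\<theta> = theta_poly V n \<pi> lift"
  note \<theta> = theta_unit[OF ch b0, folded \<theta>_def]
  define B where "B = rep ` ?C"
  have B: "finite B" "b0 \<in> B" using finC zeroC by (auto simp: B_def b0_def)
  \<comment> \<open>Everything in the numerator of \<open>F\<close> except \<open>(x - b\<^sub>0)\<^sup>n\<^sup>-\<^sup>1\<close>.\<close>
  define k where "k = (\<Prod>a\<in>Cs. [:- b0, 1:] ^ n + [:\<pi> * a:]) * (\<Prod>b\<in>B - {b0}. pcompose h [:- b, 1:]) * \<theta> ^ q"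
  have pc: "pcompose h [:- b0, 1:] = [:- b0, 1:] ^ (n - 1) * (\<Prod>a\<in>Cs. [:- b0, 1:] ^ n + [:\<pi> * a:])"
    by (simp add: h pcompose_mult pcompose_hom.hom_power pcompose_prod pcompose_add pcompose_pCons)
  have "H_poly V n \<pi> rep = pcompose h [:- b0, 1:] * (\<Prod>b\<in>B - {b0}. pcompose h [:- b, 1:])"
    unfolding H_poly_def h_def[symmetric] B_def[symmetric] by (rule prod.remove[OF B])
  then have FG: "F_poly V n \<pi> rep lift = Polynomial.smult (1 / \<pi> ^ q) ([:- b0, 1:] ^ (n - 1) * k)"
    unfolding F_poly_def Let_def q_def[symmetric] \<theta>_def[symmetric] k_def pc by (simp only: mult.assoc)
  have lin: "poly_over V [:- c, 1:]" if "c \<in> V" for c using that V.uminus_mem by simp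
  have hV: "poly_over V h"
    unfolding h using CsV \<pi>
    by (intro V.poly_over_mult V.poly_over_power V.poly_over_prod V.poly_over_add) (auto intro: V.mult_mem)
  have kV: "poly_over V k"
    unfolding k_def
  proof (intro V.poly_over_mult V.poly_over_prod V.poly_over_power V.poly_over_add V.poly_over_pcompose \<theta>(1) hV)
    show "poly_over V [:- b0, 1:]" using lin PV_subset_V[OF b0] by blast
    show "poly_over V [:\<pi> * a:]" if "a \<in> Cs" for a using CsV[OF that] \<pi> V.mult_mem by simp
    show "poly_over V [:- b, 1:]" if "b \<in> B - {b0}" for b using that repV lin by (auto simp: B_def)
  qed
  define w where "w = (\<Prod>a\<in>Cs. a) * (\<Prod>b\<in>B - {b0}. poly h (b0 - b)) * poly \<theta> b0 ^ q"
  have "poly k b0 = (\<Prod>a\<in>Cs. \<pi> * a) * (\<Prod>b\<in>B - {b0}. poly h (b0 - b)) * poly \<theta> b0 ^ q"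
  proof -
    have zero: "(0 :: 'k) ^ n = 0" using n by simp
    show ?thesis by (simp add: k_def poly_prod poly_pcompose zero)
  qed
  also have "(\<Prod>a\<in>Cs. \<pi> * a) = \<pi> ^ (q - 1) * (\<Prod>a\<in>Cs. a)"
    by (simp add: prod.distrib cardCs)
  finally have kb: "poly k b0 = \<pi> ^ (q - 1) * w" by (simp add: w_def mult.assoc)
  have \<pi>PV: "\<pi> \<in> PV"
    using maximal_eq_PV[OF max] PIdl_V[OF \<pi>] V.one_mem by (metis (mono_tags, lifting) mem_Collect_eq mult_1)
  have hb: "poly h (b0 - b) \<in> V - PV" if "b \<in> B - {b0}" for b
  proof -
    obtain Z where Z: "Z \<in> ?C" "b = rep Z" "Z \<noteq> PV" using \<open>b \<in> B - {b0}\<close> by (auto simp: B_def b0_def)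
    define e where "e = b0 - b"
    have e: "e \<in> V - PV" unfolding e_def b0_def Z(2) using rep_diff[OF zeroC Z(1)] Z(3) by blast
    have "e ^ n + \<pi> * a \<in> V - PV" if "a \<in> Cs" for a
    proof -
      have pa: "\<pi> * a \<in> PV" using PV_mult[of a \<pi>] CsV[OF that] \<pi>PV by (simp add: mult.commute)
      have en: "e ^ n \<in> V - PV" using unit_power[OF e] .
      have "e ^ n \<in> PV" if "e ^ n + \<pi> * a \<in> PV" using PV_add[OF that PV_uminus[OF pa]] by simp
      then show ?thesis using en V.add_mem[of "e ^ n" "\<pi> * a"] PV_subset_V[OF pa] by blast
    qed
    then have "e ^ (n - 1) * (\<Prod>a\<in>Cs. e ^ n + \<pi> * a) \<in> V - PV"
      by (intro unit_mult unit_power unit_prod e)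
    then show ?thesis by (simp add: h poly_prod e_def)
  qed
  have "w \<in> V - PV"
    unfolding w_def using CsV hb \<theta>(2) by (intro unit_mult unit_prod unit_power) auto
  then show ?thesis using that[OF PV_subset_V[OF b0] kV kb _ FG] by blast
qed

end

theorem corollary3p5:
  fixes D P :: "'k::field set"
    and A :: "('k, 'a) module"
    and n q :: nat
    and \<pi> c :: 'k
    and rep :: "'k set \<Rightarrow> 'k"
    and lift :: "(nat \<Rightarrow> 'k set) \<Rightarrow> 'k poly"
  defines "q \<equiv> card (carrier (ring_of D Quot P))"
    and "V \<equiv> localization D P"
    and "F \<equiv> F_poly (localization D P) n \<pi> rep lift"
  assumes "dedekind_domain D" and "finite_residue_fields D" and "frac_field D = UNIV"
    and "n \<ge> 2"
    and "admissible_algebra D A"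
    and "primeideal P (ring_of D)" and "P \<noteq> {0}"
    and "algebra_iso (ring_of D)
           (quot_algebra A (ideal_smult (P [^]\<^bsub>ideals_set (ring_of D)\<^esub> q) A))
           (mat_algebra n (quot_algebra (ring_of D) (P [^]\<^bsub>ideals_set (ring_of D)\<^esub> q)))"
    and "F_choices V n \<pi> rep lift"
    and "c \<in> D - P"
    and "properly_integral D (mat_algebra n (ring_of D)) (Polynomial.smult c F)"
  shows "properly_integral D A (Polynomial.smult c F) \<and> \<not> integrally_closed (Int_K_rat D A)"
proof -
  interpret dp: dedekind_prime D P
    by (rule dedekind_prime.intro) fact+
  have V: "V = dp.V" by (simp add: V_def dp.V_def)
  have F: "F = F_poly dp.V n \<pi> rep lift" by (simp add: F_def dp.V_def)
  have ch: "F_choices dp.V n \<pi> rep lift" using \<open>F_choices V n \<pi> rep lift\<close> by (simp add: V)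
  then have \<pi>: "\<pi> \<in> dp.V" and max: "maximalideal (PIdl\<^bsub>ring_of dp.V\<^esub> \<pi>) (ring_of dp.V)"
    by (auto simp: F_choices_def)
  have fin: "finite (carrier (ring_of D Quot P))"
    using assms by (simp add: finite_residue_fields_def)
  have fg: "fin_gen_module (ring_of D) A" using \<open>admissible_algebra D A\<close> by (simp add: admissible_algebra_def)
  have ic: "integrally_closed D" using \<open>dedekind_domain D\<close> by (simp add: dedekind_domain_def)
  interpret T: torsion_free_algebra_over D A
    using assms unfolding torsion_free_algebra_over_def algebra_over_def torsion_free_algebra_over_axioms_def
      admissible_algebra_def by blast
  obtain s0 where s0: "s0 \<in> D - P" "\<pi> \<noteq> 0" and lu: "local_uniformizer D P (s0 * \<pi>)"
    using dp.local_uniformizer[OF \<pi> max] by blast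
  interpret L: local_algebra D A P "s0 * \<pi>"
    by (intro local_algebra.intro T.torsion_free_algebra_over_axioms lu)
  define r where "r = card (carrier (residue_ring dp.V \<pi>))"
  have r: "1 \<le> r" "r \<le> q" using dp.residue_field_card[OF max fin] by (auto simp: r_def q_def)
  have n: "n \<ge> 1" and q: "q \<ge> 1" using \<open>n \<ge> 2\<close> r by auto
  obtain rho where "matrix_reduction D A P (s0 * \<pi>) n q rho"
    using L.matrix_reduction_of_iso[OF dp.dedekind_prime_axioms n q] assms by blast
  then interpret M: matrix_reduction D A P "s0 * \<pi>" n q rho .
  obtain b0 k w where d: "b0 \<in> dp.V" "poly_over dp.V k" "poly k b0 = \<pi> ^ (r - 1) * w" "w \<in> dp.V - dp.PV"
    "F_poly dp.V n \<pi> rep lift = Polynomial.smult (1 / \<pi> ^ r) ([:- b0, 1:] ^ (n - 1) * k)"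
    using dp.F_decomposition[OF ch n fin] unfolding r_def by blast
  have not: "Polynomial.smult c F \<notin> Int_K D A"
    unfolding F d(5)
    by (rule M.not_integer_valued[OF dp.dedekind_prime_axioms refl refl s0(1) refl r \<open>c \<in> D - P\<close> d(1-4)])
  have "Int_K D (mat_algebra n (ring_of D)) \<subseteq> Int_K D A"
    by (rule T.Int_K_mat_subset[OF n M.monic_annihilator_degree_n[OF fg ic]])
  then have sub: "Int_K_rat D (mat_algebra n (ring_of D)) \<subseteq> Int_K_rat D A"
    unfolding Int_K_rat_def by (rule image_mono)
  have "Fract (Polynomial.smult c F) 1 \<in> integral_closure (Int_K_rat D (mat_algebra n (ring_of D)))"
    using assms by (simp add: properly_integral_def)
  then have int: "Fract (Polynomial.smult c F) 1 \<in> integral_closure (Int_K_rat D A)"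
    using sub unfolding integral_closure_def frac_field_def integral_over_def by blast
  moreover have "Fract (Polynomial.smult c F) 1 \<notin> Int_K_rat D A"
    using not by (auto simp: Int_K_rat_def eq_fract)
  ultimately show ?thesis
    using not by (auto simp: properly_integral_def integrally_closed_def)
qed

end
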